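(* Let $V:\mathbb{R}^2\to\mathbb{R}$ satisfy (A1), (A2), (A3), let $f$ be the associated area-preserving twist diffeomorphism of $\mathbb{S}^1\times\mathbb{R}$, and assume (N1). If (N2) holds, then $\Delta_1\geq\tilde\Delta_1>0$.
   Context: Subscripts $1,2$ on $V$ denote partial derivatives. The conditions on $V:\mathbb{R}^2\to\mathbb{R}$ are: (A1) $V$ is $C^2$ and $V(x+1,x'+1)=V(x,x')$ for all $x,x'$; (A2) there is $\delta>0$ with $V_{12}(x,x')\le-\delta$ for all $x,x'$; (A3) $V_{11},V_{12},V_{22}$ are uniformly bounded and uniformly continuous on $\mathbb{R}^2$. Then $F:\mathbb{R}^2\to\mathbb{R}^2$, $F(x,p)=(x',p')$, is uniquely defined by $p=-V_1(x,x')$, $p'=V_2(x,x')$; it is the lift of a map $f:\mathbb{S}^1\times\mathbb{R}\to\mathbb{S}^1\times\mathbb{R}$ ($\mathbb{S}^1=\mathbb{R}/\mathbb{Z}$), the area-preserving twist diffeomorphism with generating function $V$. The rotation number of an orbit of $F$ with first coordinates $(x_k)_{k\in\mathbb{Z}}$ is $\lim_{|k|\to\infty}x_k/|k|$ when it exists; the rotation number of an orbit of $f$ is that of its lift to an $F$-orbit. (N1) $y_0$ is the unique (mod 1) minimum of $x\mapsto V(x,x)$, and $(y_0,p_0)$ with $p_0=-V_1(y_0,y_0)$ is a hyperbolic fixed point of $f$. (N2) There is no homotopically non-trivial $f$-invariant circle in $\mathbb{S}^1\times\mathbb{R}$ consisting of orbits with rotation number $0$. Homoclinics. For $x\in(y_0,y_0+1)$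 let $$S(x)=\inf\sum_{k=-\infty}^{\infty}\bigl(V(x_k,x_{k+1})-V(y_0,y_0)\bigr),$$ the infimum being over all $(x_k)\in\mathbb{R}^{\mathbb{Z}}$ with $x_0=x$, $\lim_{k\to-\infty}x_k=y_0$, $\lim_{k\to\infty}x_k=y_0+1$. It is known that the infimum is attained for each $x$, and that $S$ is continuous and attains its minimum and maximum on $(y_0,y_0+1)$. Let $\mathcal{R}$ be the set of all configurations attaining this infimum for some $x\in(y_0,y_0+1)$. Fix $\boldsymbol{z},\tilde{\boldsymbol{z}}\in\mathcal{R}$ such that $z_0$ minimizes and $\tilde z_0$ maximizes $S$ on $(y_0,y_0+1)$ ($\boldsymbol z$ is the minimizing homoclinic, $\tilde{\boldsymbol z}$ the minimax homoclinic), chosen, as is always possible, so that $$y_0<\dots<z_{-1}<\tilde z_0<z_0<\tilde z_1<z_1<\tilde z_2<\dots<y_0+1 .$$ The Peierls barrier is $\Delta_0=\sum_{k=-\infty}^{\infty}\bigl(V(\tilde z_k,\tilde z_{k+1})-V(z_k,z_{k+1})\bigr)$ (absolutely convergent). Let $\lambda>1$ be the eigenvalue of $Df(y_0,p_0)$ larger than $1$, and let $\kappa_1>0$ be a constant such that for all $j\ge0$: $|\tilde z_{-j}-y_0|\le\kappa_1\lambda^{-(j+1)}$ and $|\tilde z_j-y_0-1|\le\kappa_1\lambda^{-(j+1)}$. For $\boldsymbol h\in l^2(\mathbb{Z})$ let $$E(\boldsymbol h)=\sum_{k=-\infty}^{\infty}\bigl(V(z_k+h_k,z_{k+1}+h_{k+1})-V(z_k,z_{k+1})\bigr),$$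 $$\nabla E(\boldsymbol h)_k=V_2(z_{k-1}+h_{k-1},z_k+h_k)+V_1(z_k+h_k,z_{k+1}+h_{k+1}).$$ Let $\mathcal{X}_2=\{\boldsymbol x\in\mathbb{R}^{\mathbb{Z}}:\sup_j|x_j-x_{j+1}|\le2\}$ and $u_j=2\kappa_1\lambda^{-|j|}$. Let $\tilde{\mathcal N}(e)$ be the set of $\boldsymbol h\in l^2(\mathbb{Z})\cap\mathcal{X}_2$ with $E(\boldsymbol h)=e$ and $|h_j|\le u_j$ for all $j\in\mathbb{Z}$; let $\mathcal C(e)$ be the connected component of $\boldsymbol 0$ in $\{\boldsymbol h\in l^2(\mathbb{Z}):E(\boldsymbol h)\le e\}$; and let $\mathcal N(e)=\tilde{\mathcal N}(e)\cap\mathcal C(e)$. Define $$\Delta_1=\sup_{0\le e\le\Delta_0/2}\ \inf_{\boldsymbol h\in\mathcal N(e)}\|\nabla E(\boldsymbol h)\|^2_{l^2(\mathbb{Z})},\qquad \tilde\Delta_1=\sup_{0\le e\le\Delta_0/2}\ \inf_{\boldsymbol h\in\tilde{\mathcal N}(e)}\|\nabla E(\boldsymbol h)\|^2_{l^2(\mathbb{Z})}.$$ *)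

theory Defs
  imports "HOL-Analysis.Analysis"
begin

section \<open>Generating functions\<close>

definition D1 :: "(real \<Rightarrow> real \<Rightarrow> real) \<Rightarrow> real \<Rightarrow> real \<Rightarrow> real" where
  "D1 G x x' = deriv (\<lambda>t. G t x') x"

definition D2 :: "(real \<Rightarrow> real \<Rightarrow> real) \<Rightarrow> real \<Rightarrow> real \<Rightarrow> real" where
  "D2 G x x' = deriv (\<lambda>t. G x t) x'"

text \<open>\<open>deriv\<close> is total, so the existence of the partial derivatives is required separately.\<close>

definition C1_plane :: "(real \<Rightarrow> real \<Rightarrow> real) \<Rightarrow> bool" where
  "C1_plane G \<longleftrightarrow>
     (\<forall>x x'. (\<lambda>t. G t x') field_differentiable at x \<and>
             (\<lambda>t. G x t) field_differentiable at x') \<and>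
     continuous_on UNIV (\<lambda>(x, x'). D1 G x x') \<and>
     continuous_on UNIV (\<lambda>(x, x'). D2 G x x')"

definition C2_plane :: "(real \<Rightarrow> real \<Rightarrow> real) \<Rightarrow> bool" where
  "C2_plane G \<longleftrightarrow> C1_plane G \<and> C1_plane (D1 G) \<and> C1_plane (D2 G)"

definition A1 :: "(real \<Rightarrow> real \<Rightarrow> real) \<Rightarrow> bool" where
  "A1 V \<longleftrightarrow> C2_plane V \<and> (\<forall>x x'. V (x + 1) (x' + 1) = V x x')"

definition A2 :: "(real \<Rightarrow> real \<Rightarrow> real) \<Rightarrow> bool" where
  "A2 V \<longleftrightarrow> (\<exists>\<delta>>0. \<forall>x x'. D2 (D1 V) x x' \<le> - \<delta>)"

definition A3 :: "(real \<Rightarrow> real \<Rightarrow> real) \<Rightarrow> bool" where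
  "A3 V \<longleftrightarrow>
     (\<forall>G \<in> {D1 (D1 V), D2 (D1 V), D2 (D2 V)}.
        bounded (range (\<lambda>(x, x'). G x x')) \<and>
        uniformly_continuous_on UNIV (\<lambda>(x, x'). G x x'))"


section \<open>The twist diffeomorphism and its lift\<close>

text \<open>The lift \<open>F\<close>; under (A1)--(A3) the pair \<open>(x', p')\<close> exists and is unique.\<close>

definition twist_lift :: "(real \<Rightarrow> real \<Rightarrow> real) \<Rightarrow> real \<times> real \<Rightarrow> real \<times> real" where
  "twist_lift V = (\<lambda>(x, p). THE (x', p'). p = - D1 V x x' \<and> p' = D2 V x x')"

text \<open>The circle \<open>\<real>/\<int>\<close> is modelled as the unit circle of the complex plane,
  through \<open>x \<mapsto> exp (2 \<pi> i x)\<close>.\<close>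

definition cylinder :: "(complex \<times> real) set" where
  "cylinder = sphere 0 1 \<times> UNIV"

definition cyl_proj :: "real \<times> real \<Rightarrow> complex \<times> real" where
  "cyl_proj = (\<lambda>(x, p). (cis (2 * pi * x), p))"

text \<open>The map \<open>f\<close> induced on the cylinder. The value does not depend on the chosen preimage,
  since \<open>F (x + 1, p) = F (x, p) + (1, 0)\<close> by (A1).\<close>

definition twist_map :: "(real \<Rightarrow> real \<Rightarrow> real) \<Rightarrow> complex \<times> real \<Rightarrow> complex \<times> real" where
  "twist_map V w = cyl_proj (twist_lift V (inv_into UNIV cyl_proj w))"

definition full_orbit :: "('a \<Rightarrow> 'a) \<Rightarrow> (int \<Rightarrow> 'a) \<Rightarrow> bool" where
  "full_orbit g q \<longleftrightarrow> (\<forall>k. q (k + 1) = g (q k))"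

text \<open>On the integers the filter \<open>cofinite\<close> expresses \<open>\<bar>k\<bar> \<rightarrow> \<infinity>\<close>.\<close>

definition lift_rotation_number :: "(int \<Rightarrow> real \<times> real) \<Rightarrow> real \<Rightarrow> bool" where
  "lift_rotation_number q \<omega> \<longleftrightarrow>
     ((\<lambda>k. fst (q k) / real_of_int \<bar>k\<bar>) \<longlongrightarrow> \<omega>) cofinite"

definition rotation_number ::
  "(real \<Rightarrow> real \<Rightarrow> real) \<Rightarrow> (int \<Rightarrow> complex \<times> real) \<Rightarrow> real \<Rightarrow> bool" where
  "rotation_number V w \<omega> \<longleftrightarrow>
     (\<exists>q. full_orbit (twist_lift V) q \<and> (\<forall>k. cyl_proj (q k) = w k) \<and>
          lift_rotation_number q \<omega>)"

definition nontrivial_circle :: "(complex \<times> real) set \<Rightarrow> bool" where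
  "nontrivial_circle \<Gamma> \<longleftrightarrow>
     (\<exists>\<gamma>. simple_path \<gamma> \<and> pathfinish \<gamma> = pathstart \<gamma> \<and> path_image \<gamma> = \<Gamma> \<and>
          \<Gamma> \<subseteq> cylinder \<and> \<not> (\<exists>a. homotopic_loops cylinder \<gamma> (\<lambda>_. a)))"

text \<open>Hyperbolicity refers to the derivative of \<open>f\<close>, which in the coordinates \<open>(x, p)\<close> is the
  derivative of the lift. The complex number \<open>\<mu>\<close> is an eigenvalue of the complexification of
  \<open>L\<close> with eigenvector \<open>a + i b\<close>.\<close>

definition complex_eigenvalue :: "(real \<times> real \<Rightarrow> real \<times> real) \<Rightarrow> complex \<Rightarrow> bool" where
  "complex_eigenvalue L \<mu> \<longleftrightarrow>
     (\<exists>a b. (a, b) \<noteq> (0, 0) \<and>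
        L a = Re \<mu> *\<^sub>R a - Im \<mu> *\<^sub>R b \<and> L b = Im \<mu> *\<^sub>R a + Re \<mu> *\<^sub>R b)"

definition twist_deriv ::
  "(real \<Rightarrow> real \<Rightarrow> real) \<Rightarrow> real \<times> real \<Rightarrow> real \<times> real \<Rightarrow> real \<times> real" where
  "twist_deriv V q = frechet_derivative (twist_lift V) (at q)"

definition hyperbolic_fixed_point :: "(real \<Rightarrow> real \<Rightarrow> real) \<Rightarrow> real \<times> real \<Rightarrow> bool" where
  "hyperbolic_fixed_point V q \<longleftrightarrow>
     twist_map V (cyl_proj q) = cyl_proj q \<and>
     twist_lift V differentiable (at q) \<and>
     (\<forall>\<mu>. complex_eigenvalue (twist_deriv V q) \<mu> \<longrightarrow> norm \<mu> \<noteq> 1)"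

definition N1 :: "(real \<Rightarrow> real \<Rightarrow> real) \<Rightarrow> real \<Rightarrow> real \<Rightarrow> bool" where
  "N1 V y0 p0 \<longleftrightarrow>
     (\<forall>x. V y0 y0 \<le> V x x) \<and> (\<forall>x. V x x = V y0 y0 \<longrightarrow> x - y0 \<in> \<int>) \<and>
     p0 = - D1 V y0 y0 \<and> hyperbolic_fixed_point V (y0, p0)"

definition N2 :: "(real \<Rightarrow> real \<Rightarrow> real) \<Rightarrow> bool" where
  "N2 V \<longleftrightarrow>
     \<not> (\<exists>\<Gamma>. nontrivial_circle \<Gamma> \<and> twist_map V ` \<Gamma> = \<Gamma> \<and>
            (\<forall>w. full_orbit (twist_map V) w \<and> range w \<subseteq> \<Gamma> \<longrightarrow> rotation_number V w 0))"


section \<open>Homoclinics\<close>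

text \<open>Bi-infinite series are limits of the partial sums over \<open>{-m..n}\<close> as \<open>m\<close> and \<open>n\<close> tend
  to infinity independently. Unconditional summation (\<open>infsum\<close>) would be wrong: for a square
  summable \<open>h\<close> the series defining \<open>E h\<close> converges only conditionally in general, because of the
  telescoping first-order terms.\<close>

definition bi_partial_sum :: "(int \<Rightarrow> real) \<Rightarrow> nat \<times> nat \<Rightarrow> real" where
  "bi_partial_sum a = (\<lambda>(m, n). \<Sum>k = - int m..int n. a k)"

definition bi_sum :: "(int \<Rightarrow> real) \<Rightarrow> real" where
  "bi_sum a = Lim (sequentially \<times>\<^sub>F sequentially) (bi_partial_sum a)"

text \<open>The sum as an extended real; the action of a configuration may be \<open>\<infinity>\<close>.\<close>

definition has_bi_sum :: "(int \<Rightarrow> real) \<Rightarrow> ereal \<Rightarrow> bool" where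
  "has_bi_sum a s \<longleftrightarrow>
     ((\<lambda>mn. ereal (bi_partial_sum a mn)) \<longlongrightarrow> s) (sequentially \<times>\<^sub>F sequentially)"

definition connections :: "real \<Rightarrow> real \<Rightarrow> (int \<Rightarrow> real) set" where
  "connections y0 x =
     {\<xi>. \<xi> 0 = x \<and> (\<xi> \<longlongrightarrow> y0) at_bot \<and> (\<xi> \<longlongrightarrow> y0 + 1) at_top}"

definition S :: "(real \<Rightarrow> real \<Rightarrow> real) \<Rightarrow> real \<Rightarrow> real \<Rightarrow> ereal" where
  "S V y0 x =
     Inf {s. \<exists>\<xi> \<in> connections y0 x. has_bi_sum (\<lambda>k. V (\<xi> k) (\<xi> (k + 1)) - V y0 y0) s}"

definition minimal_connections ::
  "(real \<Rightarrow> real \<Rightarrow> real) \<Rightarrow> real \<Rightarrow> (int \<Rightarrow> real) set" where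
  "minimal_connections V y0 =
     {\<xi>. \<exists>x \<in> {y0<..<y0 + 1}. \<xi> \<in> connections y0 x \<and>
          has_bi_sum (\<lambda>k. V (\<xi> k) (\<xi> (k + 1)) - V y0 y0) (S V y0 x)}"

definition homoclinic_pair ::
  "(real \<Rightarrow> real \<Rightarrow> real) \<Rightarrow> real \<Rightarrow> (int \<Rightarrow> real) \<Rightarrow> (int \<Rightarrow> real) \<Rightarrow> bool" where
  "homoclinic_pair V y0 z zt \<longleftrightarrow>
     z \<in> minimal_connections V y0 \<and> zt \<in> minimal_connections V y0 \<and>
     is_arg_min (S V y0) (\<lambda>x. x \<in> {y0<..<y0 + 1}) (z 0) \<and>
     is_arg_max (S V y0) (\<lambda>x. x \<in> {y0<..<y0 + 1}) (zt 0) \<and>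
     (\<forall>k. y0 < zt k \<and> zt k < z k \<and> z k < zt (k + 1) \<and> zt (k + 1) < y0 + 1)"

definition peierls_barrier ::
  "(real \<Rightarrow> real \<Rightarrow> real) \<Rightarrow> (int \<Rightarrow> real) \<Rightarrow> (int \<Rightarrow> real) \<Rightarrow> real" where
  "peierls_barrier V z zt = bi_sum (\<lambda>k. V (zt k) (zt (k + 1)) - V (z k) (z (k + 1)))"


section \<open>The space of square summable sequences\<close>

definition l2 :: "(int \<Rightarrow> real) set" where
  "l2 = {h. (\<lambda>k. (h k)\<^sup>2) summable_on UNIV}"

definition l2_norm :: "(int \<Rightarrow> real) \<Rightarrow> real" where
  "l2_norm h = sqrt (\<Sum>\<^sub>\<infinity>k. (h k)\<^sup>2)"

definition l2_dist :: "(int \<Rightarrow> real) \<Rightarrow> (int \<Rightarrow> real) \<Rightarrow> real" where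
  "l2_dist g h = l2_norm (\<lambda>k. g k - h k)"

lemma l2_finite_bound:
  assumes "h \<in> l2" "finite A"
  shows "L2_set h A \<le> l2_norm h"
  using assms unfolding L2_set_def l2_def l2_norm_def
  by (auto intro!: real_sqrt_le_mono finite_sum_le_infsum)

lemma l2_add:
  assumes "g \<in> l2" "h \<in> l2"
  shows "(\<lambda>k. g k + h k) \<in> l2" and "l2_norm (\<lambda>k. g k + h k) \<le> l2_norm g + l2_norm h"
proof -
  have bound: "(\<Sum>k\<in>A. (g k + h k)\<^sup>2) \<le> (l2_norm g + l2_norm h)\<^sup>2" if "finite A" for A
  proof -
    have "L2_set (\<lambda>k. g k + h k) A \<le> L2_set g A + L2_set h A"
      by (rule L2_set_triangle_ineq)
    also have "\<dots> \<le> l2_norm g + l2_norm h"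
      using assms that by (intro add_mono l2_finite_bound)
    finally show ?thesis
      unfolding L2_set_def by (rule sqrt_le_D)
  qed
  have summ: "(\<lambda>k. (g k + h k)\<^sup>2) summable_on UNIV"
    by (rule nonneg_bdd_above_summable_on) (auto intro!: bdd_aboveI2 bound)
  then show "(\<lambda>k. g k + h k) \<in> l2"
    by (simp add: l2_def)
  have "0 \<le> l2_norm g + l2_norm h"
    by (simp add: l2_norm_def infsum_nonneg)
  then show "l2_norm (\<lambda>k. g k + h k) \<le> l2_norm g + l2_norm h"
    unfolding l2_norm_def[of "\<lambda>k. g k + h k"]
    by (intro real_le_lsqrt infsum_le_finite_sums[OF summ] bound) auto
qed

lemma l2_uminus: "h \<in> l2 \<Longrightarrow> (\<lambda>k. - h k) \<in> l2"
  by (simp add: l2_def)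

lemma l2_diff: "g \<in> l2 \<Longrightarrow> h \<in> l2 \<Longrightarrow> (\<lambda>k. g k - h k) \<in> l2"
  using l2_add(1)[of g "\<lambda>k. - h k"] l2_uminus[of h] by simp

lemma l2_norm_eq_0:
  assumes "h \<in> l2"
  shows "l2_norm h = 0 \<longleftrightarrow> h = (\<lambda>_. 0)"
proof
  assume "l2_norm h = 0"
  then have "h k = 0" for k
    using l2_finite_bound[OF assms, of "{k}"] by (simp add: L2_set_def)
  then show "h = (\<lambda>_. 0)" by auto
qed (simp add: l2_norm_def)

lemma Metric_space_l2: "Metric_space l2 l2_dist"
proof
  show "0 \<le> l2_dist g h" for g h
    by (simp add: l2_dist_def l2_norm_def infsum_nonneg)
  show "l2_dist g h = l2_dist h g" for g h
    by (simp add: l2_dist_def l2_norm_def power2_commute)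
  show "l2_dist g h = 0 \<longleftrightarrow> g = h" if "g \<in> l2" "h \<in> l2" for g h
    using l2_norm_eq_0[OF l2_diff[OF that]] by (auto simp: l2_dist_def fun_eq_iff)
  show "l2_dist g j \<le> l2_dist g h + l2_dist h j" if "g \<in> l2" "h \<in> l2" "j \<in> l2" for g h j
    using l2_add(2)[OF l2_diff[OF that(1,2)] l2_diff[OF that(2,3)]] by (simp add: l2_dist_def)
qed

abbreviation l2_topology :: "(int \<Rightarrow> real) topology" where
  "l2_topology \<equiv> Metric_space.mtopology l2 l2_dist"


section \<open>Energy, gradient and the constants\<close>

definition E ::
  "(real \<Rightarrow> real \<Rightarrow> real) \<Rightarrow> (int \<Rightarrow> real) \<Rightarrow> (int \<Rightarrow> real) \<Rightarrow> real" where
  "E V z h =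
     bi_sum (\<lambda>k. V (z k + h k) (z (k + 1) + h (k + 1)) - V (z k) (z (k + 1)))"

definition gradE ::
  "(real \<Rightarrow> real \<Rightarrow> real) \<Rightarrow> (int \<Rightarrow> real) \<Rightarrow> (int \<Rightarrow> real) \<Rightarrow> int \<Rightarrow> real" where
  "gradE V z h k =
     D2 V (z (k - 1) + h (k - 1)) (z k + h k) + D1 V (z k + h k) (z (k + 1) + h (k + 1))"

definition X2 :: "(int \<Rightarrow> real) set" where
  "X2 = {x. \<forall>j. \<bar>x j - x (j + 1)\<bar> \<le> 2}"

definition u :: "real \<Rightarrow> real \<Rightarrow> int \<Rightarrow> real" where
  "u \<kappa>1 lam j = 2 * \<kappa>1 * lam powi (- \<bar>j\<bar>)"

definition Nt ::
  "(real \<Rightarrow> real \<Rightarrow> real) \<Rightarrow> (int \<Rightarrow> real) \<Rightarrow> real \<Rightarrow> real \<Rightarrow> real \<Rightarrow> (int \<Rightarrow> real) set" where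
  "Nt V z \<kappa>1 lam e = {h \<in> l2 \<inter> X2. E V z h = e \<and> (\<forall>j. \<bar>h j\<bar> \<le> u \<kappa>1 lam j)}"

definition C ::
  "(real \<Rightarrow> real \<Rightarrow> real) \<Rightarrow> (int \<Rightarrow> real) \<Rightarrow> real \<Rightarrow> (int \<Rightarrow> real) set" where
  "C V z e =
     connected_component_of_set (subtopology l2_topology {h \<in> l2. E V z h \<le> e}) (\<lambda>_. 0)"

definition N ::
  "(real \<Rightarrow> real \<Rightarrow> real) \<Rightarrow> (int \<Rightarrow> real) \<Rightarrow> real \<Rightarrow> real \<Rightarrow> real \<Rightarrow> (int \<Rightarrow> real) set" where
  "N V z \<kappa>1 lam e = Nt V z \<kappa>1 lam e \<inter> C V z e"

text \<open>Suprema and infima are taken in the extended reals, so that the infimum of the empty set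
  is \<open>\<infinity>\<close>.\<close>

definition Delta1 ::
  "(real \<Rightarrow> real \<Rightarrow> real) \<Rightarrow> (int \<Rightarrow> real) \<Rightarrow> (int \<Rightarrow> real) \<Rightarrow> real \<Rightarrow> real \<Rightarrow> ereal" where
  "Delta1 V z zt \<kappa>1 lam =
     (SUP e \<in> {0..peierls_barrier V z zt / 2}.
        INF h \<in> N V z \<kappa>1 lam e. ereal ((l2_norm (gradE V z h))\<^sup>2))"

definition Delta1t ::
  "(real \<Rightarrow> real \<Rightarrow> real) \<Rightarrow> (int \<Rightarrow> real) \<Rightarrow> (int \<Rightarrow> real) \<Rightarrow> real \<Rightarrow> real \<Rightarrow> ereal" where
  "Delta1t V z zt \<kappa>1 lam =
     (SUP e \<in> {0..peierls_barrier V z zt / 2}.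
        INF h \<in> Nt V z \<kappa>1 lam e. ereal ((l2_norm (gradE V z h))\<^sup>2))"

end

theory Submission
  imports Defs "HOL-Complex_Analysis.Winding_Numbers"
begin

text \<open>
  The inequality between the two constants only says that an infimum grows when the set shrinks.
  For positivity, suppose that the second constant is at most \<open>0\<close>. Then for every energy \<open>e\<close>
  between \<open>0\<close> and \<open>\<Delta>\<^sub>0 / 2\<close> there are configurations \<open>z + h\<close> of energy \<open>e\<close> over \<open>z\<close>, with
  \<open>\<bar>h\<^sub>j\<bar> \<le> u\<^sub>j\<close> and with arbitrarily small gradient. Since \<open>u\<close> is summable, pointwise limits exist and
  action and gradient pass to the limit (\<open>stationary_limit_of_small_gradients\<close>); so every such \<open>e\<close>
  is the energy of a stationary configuration, that is, of an \<open>F\<close>-orbit homoclinic to the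
  hyperbolic fixed point. Because \<open>z\<close> minimizes \<open>S\<close> and \<open>zt\<close> maximizes it, \<open>\<Delta>\<^sub>0 \<ge> 0\<close>, and two cases
  remain.

  If \<open>\<Delta>\<^sub>0 > 0\<close>, an interval of energies would be attained by homoclinic orbits. This contradicts a
  one-dimensional Sard argument. Homoclinic orbits in a fixed summable envelope form a
  one-parameter family: near both ends the difference of two of them satisfies a linear recurrence
  with \<open>V\<^sub>1\<^sub>1 + V\<^sub>2\<^sub>2 > 2 \<bar>V\<^sub>1\<^sub>2\<bar>\<close>, so a discrete maximum principle makes it decay geometrically,
  and in the finite middle part the twist condition propagates it with a Lipschitz bound. Hence the
  whole difference is controlled by its value at a single index \<open>m\<close>
  (\<open>stationary_difference_decay\<close>). As both orbits are
  critical points of the action, their actions differ by at most a constant times the square of that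
  value (\<open>stationary_action_difference\<close>), and a map that is quadratically small in one bounded real
  parameter cannot cover an interval (\<open>quadratic_image_no_interval\<close>).

  If \<open>\<Delta>\<^sub>0 = 0\<close>, then \<open>S\<close> is constant on \<open>(y\<^sub>0, y\<^sub>0 + 1)\<close> and, as in Aubry's theory, minimizing
  connections pass through every point. By submodularity of \<open>V\<close> the maximum of two minimizers is
  again a minimizer, hence stationary, and ordered stationary configurations that touch coincide; so
  minimizers are totally ordered (\<open>minimizers_ordered\<close>) and \<open>\<xi>\<^sub>0 \<mapsto> \<xi>\<^sub>1\<close> is an increasing
  bijection \<open>\<phi>\<close>, in particular continuous. The graph of \<open>x \<mapsto> - V\<^sub>1 (x, \<phi> x)\<close> projects to a homotopically
  non-trivial invariant circle with rotation number \<open>0\<close> (\<open>invariant_graph_imp_not_N2\<close>), which (N2)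
  excludes.
\<close>

section \<open>Series over the integers\<close>

lemma summable_on_int_shift:
  fixes f :: "int \<Rightarrow> real"
  assumes "f summable_on UNIV"
  shows "(\<lambda>k. f (k + c)) summable_on UNIV"
proof -
  have "bij_betw (\<lambda>k::int. k + c) UNIV UNIV"
    by (rule bij_betwI[where g = "\<lambda>k. k - c"]) auto
  from summable_on_reindex_bij_betw[OF this, of f] assms show ?thesis by simp
qed

lemma infsum_int_shift:
  fixes f :: "int \<Rightarrow> real"
  shows "(\<Sum>\<^sub>\<infinity>k. f (k + c)) = infsum f UNIV"
proof -
  have "bij_betw (\<lambda>k::int. k + c) UNIV UNIV"
    by (rule bij_betwI[where g = "\<lambda>k. k - c"]) auto
  from infsum_reindex_bij_betw[OF this, of f] show ?thesis by simp
qed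

lemma summable_on_int_geometric:
  fixes q :: real
  assumes "0 \<le> q" "q < 1"
  shows "(\<lambda>k::int. q ^ nat \<bar>k\<bar>) summable_on UNIV"
proof -
  have geo: "(\<lambda>n. q ^ n) summable_on (UNIV :: nat set)"
    using assms by (intro norm_summable_imp_summable_on) (simp add: summable_geometric)
  have "inj (\<lambda>n. - int n)" by (auto simp: inj_on_def)
  then have "(\<lambda>k::int. q ^ nat \<bar>k\<bar>) summable_on range int"
    "(\<lambda>k::int. q ^ nat \<bar>k\<bar>) summable_on range (\<lambda>n. - int n)"
    using geo by (auto simp: summable_on_reindex o_def)
  then have "(\<lambda>k::int. q ^ nat \<bar>k\<bar>) summable_on (range int \<union> range (\<lambda>n. - int n))"
    by (rule summable_on_union)
  moreover have "range int \<union> range (\<lambda>n. - int n) = UNIV"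
  proof -
    have "k \<in> range int \<union> range (\<lambda>n. - int n)" for k by (cases k rule: int_cases2) auto
    then show ?thesis by blast
  qed
  ultimately show ?thesis by simp
qed

lemma summable_on_dominated:
  fixes f b :: "'a \<Rightarrow> real"
  assumes "b summable_on A" "\<And>k. k \<in> A \<Longrightarrow> \<bar>f k\<bar> \<le> b k"
  shows "f summable_on A"
proof -
  have "(\<lambda>k. norm (f k)) summable_on A"
    by (rule Infinite_Sum.abs_summable_on_comparison_test'[OF assms(1)]) (use assms(2) in auto)
  then show ?thesis using summable_on_iff_abs_summable_on_real by blast
qed

lemma infsum_abs_bound:
  fixes f b :: "'a \<Rightarrow> real"
  assumes b: "b summable_on A" and le: "\<And>k. \<bar>f k\<bar> \<le> b k"
  shows "\<bar>infsum f A\<bar> \<le> infsum b A"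
proof -
  have f: "f summable_on A" by (rule summable_on_dominated[OF b le])
  have "f k \<le> b k" "- b k \<le> f k" for k using le[of k] by linarith+
  then have "infsum f A \<le> infsum b A" "infsum (\<lambda>k. - b k) A \<le> infsum f A"
    using f b by (simp_all add: infsum_mono summable_on_uminus)
  then show ?thesis by (simp add: infsum_uminus abs_le_iff)
qed

text \<open>Outside a large finite set both series are small uniformly in \<open>n\<close>, being dominated by the tail of
  \<open>b\<close>; on the finite set the limit is taken term by term.\<close>

lemma infsum_dominated_convergence:
  fixes f :: "nat \<Rightarrow> 'a \<Rightarrow> real"
  assumes b: "b summable_on UNIV" and dom: "\<And>n k. \<bar>f n k\<bar> \<le> b k"
    and lim: "\<And>k. (\<lambda>n. f n k) \<longlonglongrightarrow> g k"
  shows "(\<lambda>n. infsum (f n) UNIV) \<longlonglongrightarrow> infsum g UNIV"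
proof -
  have domg: "\<bar>g k\<bar> \<le> b k" for k
    by (rule LIMSEQ_le_const2[OF tendsto_rabs[OF lim[of k]]]) (use dom in auto)
  have sumb: "b summable_on A" for A
    by (rule summable_on_subset_banach[OF b]) simp
  have sumf: "f n summable_on A" "g summable_on A" "b summable_on A" for n A
    by (rule summable_on_dominated[OF sumb dom] summable_on_dominated[OF sumb domg] sumb)+
  have split: "infsum h UNIV = sum h F + infsum h (- F)"
    if "finite F" "\<And>A. h summable_on A" for F and h :: "'a \<Rightarrow> real"
  proof -
    have "infsum h (F \<union> - F) = infsum h F + infsum h (- F)"
      by (rule infsum_Un_disjoint) (use that in auto)
    then show ?thesis using that by simp
  qed
  show ?thesis
  proof (rule LIMSEQ_I)
    fix r :: real assume r: "0 < r"
    have "(sum b \<longlongrightarrow> infsum b UNIV) (finite_subsets_at_top UNIV)"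
      using b infsum_tendsto by blast
    then have "\<forall>\<^sub>F F in finite_subsets_at_top UNIV. dist (sum b F) (infsum b UNIV) < r / 3"
      using r by (intro tendstoD) auto
    then obtain F where F: "finite F" "\<And>Y. finite Y \<Longrightarrow> F \<subseteq> Y \<Longrightarrow> dist (sum b Y) (infsum b UNIV) < r / 3"
      unfolding eventually_finite_subsets_at_top by auto
    from F(2)[OF F(1) subset_refl] have bt: "infsum b (- F) < r / 3"
      using split[OF F(1), of b] sumb by (auto simp: dist_real_def)
    have conv: "(\<lambda>n. sum (f n) F) \<longlonglongrightarrow> sum g F"
      by (intro tendsto_sum lim)
    then obtain n0 where n0: "\<And>n. n \<ge> n0 \<Longrightarrow> \<bar>sum (f n) F - sum g F\<bar> < r / 3"
      using LIMSEQ_D[OF conv, of "r/3"] r by auto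
    show "\<exists>n0. \<forall>n\<ge>n0. norm (infsum (f n) UNIV - infsum g UNIV) < r"
    proof (intro exI allI impI)
      fix n assume "n \<ge> n0"
      note 1 = n0[OF this]
      have 2: "\<bar>infsum (f n) (- F)\<bar> \<le> infsum b (- F)" "\<bar>infsum g (- F)\<bar> \<le> infsum b (- F)"
        by (rule infsum_abs_bound[OF sumb], fact dom) (rule infsum_abs_bound[OF sumb], fact domg)
      have 3: "infsum (f n) UNIV = sum (f n) F + infsum (f n) (- F)"
        "infsum g UNIV = sum g F + infsum g (- F)"
        by (rule split[OF F(1)], rule sumf)+
      from 1 2 3 bt show "norm (infsum (f n) UNIV - infsum g UNIV) < r"
        unfolding real_norm_def by linarith
    qed
  qed
qed

text \<open>Absolute convergence makes the order of summation irrelevant: the windows \<open>{-m..n}\<close> exhaust the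
  finite subsets of the integers.\<close>

lemma bi_partial_sum_tendsto_infsum:
  assumes "a summable_on UNIV"
  shows "(bi_partial_sum a \<longlongrightarrow> infsum a UNIV) (sequentially \<times>\<^sub>F sequentially)"
proof -
  have lim: "(sum a \<longlongrightarrow> infsum a UNIV) (finite_subsets_at_top UNIV)"
    using assms infsum_tendsto by blast
  have "filterlim (\<lambda>(m, n). {- int m..int n}) (finite_subsets_at_top UNIV)
          (sequentially \<times>\<^sub>F sequentially)"
    unfolding filterlim_iff
  proof (intro allI impI)
    fix P assume "eventually P (finite_subsets_at_top (UNIV :: int set))"
    then obtain X where X: "finite X" "\<And>Y. finite Y \<Longrightarrow> X \<subseteq> Y \<Longrightarrow> P Y"
      unfolding eventually_finite_subsets_at_top by auto
    define N where "N = nat (Max (insert 0 (abs ` X)))"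
    have N: "\<bar>k\<bar> \<le> int N" if "k \<in> X" for k
    proof -
      have "\<bar>k\<bar> \<le> Max (insert 0 (abs ` X))" using X(1) that by (intro Max_ge) auto
      then show ?thesis unfolding N_def by linarith
    qed
    have "P {- int m..int n}" if "m \<ge> N" "n \<ge> N" for m n
    proof (rule X(2))
      show "X \<subseteq> {- int m..int n}"
      proof
        fix k assume "k \<in> X"
        from N[OF this] that show "k \<in> {- int m..int n}" by auto
      qed
    qed simp
    then show "\<forall>\<^sub>F x in sequentially \<times>\<^sub>F sequentially. P (case x of (m, n) \<Rightarrow> {- int m..int n})"
      unfolding eventually_prod_sequentially by auto
  qed
  from filterlim_compose[OF lim this] show ?thesis
    by (simp add: bi_partial_sum_def case_prod_unfold)
qed

lemma bi_sum_eq_infsum: "a summable_on UNIV \<Longrightarrow> bi_sum a = infsum a UNIV"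
  unfolding bi_sum_def
  by (intro tendsto_Lim bi_partial_sum_tendsto_infsum) (simp add: prod_filter_eq_bot)

lemma has_bi_sum_infsum: "a summable_on UNIV \<Longrightarrow> has_bi_sum a (ereal (infsum a UNIV))"
  unfolding has_bi_sum_def
  by (intro tendsto_ereal bi_partial_sum_tendsto_infsum)

lemma has_bi_sum_unique: "has_bi_sum a s \<Longrightarrow> has_bi_sum a t \<Longrightarrow> s = t"
  unfolding has_bi_sum_def
  by (rule tendsto_unique[of "sequentially \<times>\<^sub>F sequentially"]) (simp_all add: prod_filter_eq_bot)

lemma summable_on_int_tendsto_0:
  fixes a :: "int \<Rightarrow> real"
  assumes "a summable_on UNIV"
  shows "(a \<longlongrightarrow> 0) at_top" "(a \<longlongrightarrow> 0) at_bot"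
proof -
  have "(\<exists>N. \<forall>k. \<bar>k\<bar> > N \<longrightarrow> \<bar>a k\<bar> < e)" if "e > 0" for e
  proof -
    have lim: "(sum a \<longlongrightarrow> infsum a UNIV) (finite_subsets_at_top UNIV)"
      using assms infsum_tendsto by blast
    then have "\<forall>\<^sub>F F in finite_subsets_at_top UNIV. dist (sum a F) (infsum a UNIV) < e / 2"
      using that by (intro tendstoD) auto
    then obtain F where F: "finite F"
      "\<And>Y. finite Y \<Longrightarrow> F \<subseteq> Y \<Longrightarrow> dist (sum a Y) (infsum a UNIV) < e / 2"
      unfolding eventually_finite_subsets_at_top by auto
    have "\<bar>a k\<bar> < e" if "k \<notin> F" for k
    proof -
      have "\<bar>sum a F - infsum a UNIV\<bar> < e / 2" "\<bar>a k + sum a F - infsum a UNIV\<bar> < e / 2"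
        using F(2)[OF F(1)] F(2)[of "insert k F"] F(1) that by (auto simp: dist_real_def)
      then show ?thesis by linarith
    qed
    moreover obtain N where "\<forall>k\<in>F. \<bar>k\<bar> \<le> N"
    proof
      show "\<forall>k\<in>F. \<bar>k\<bar> \<le> Max (insert 0 (abs ` F))" using F(1) by auto
    qed
    ultimately show ?thesis by (meson linorder_not_less)
  qed
  note N = this
  show "(a \<longlongrightarrow> 0) at_top"
  proof (rule tendstoI)
    fix e :: real assume "0 < e"
    from N[OF this] obtain N where "\<forall>k. \<bar>k\<bar> > N \<longrightarrow> \<bar>a k\<bar> < e" by auto
    then show "\<forall>\<^sub>F x in at_top. dist (a x) 0 < e"
      unfolding eventually_at_top_linorder by (intro exI[of _ "\<bar>N\<bar> + 1"]) auto
  qed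
  show "(a \<longlongrightarrow> 0) at_bot"
  proof (rule tendstoI)
    fix e :: real assume "0 < e"
    from N[OF this] obtain N where "\<forall>k. \<bar>k\<bar> > N \<longrightarrow> \<bar>a k\<bar> < e" by auto
    then show "\<forall>\<^sub>F x in at_bot. dist (a x) 0 < e"
      unfolding eventually_at_bot_linorder by (intro exI[of _ "- \<bar>N\<bar> - 1"]) auto
  qed
qed

lemma summable_on_finite_support:
  fixes a :: "'a \<Rightarrow> real"
  assumes "finite F" "\<And>k. k \<notin> F \<Longrightarrow> a k = 0"
  shows "a summable_on UNIV" "infsum a UNIV = sum a F"
proof -
  have "(a has_sum (sum a F)) UNIV"
    by (rule has_sum_finite_neutralI) (use assms in auto)
  then show "a summable_on UNIV" "infsum a UNIV = sum a F"
    by (auto simp: has_sum_imp_summable infsumI)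
qed

text \<open>Tychonoff's theorem for a product of compact intervals; the product topology on a countable
  product is metrizable, so compactness yields subsequences.\<close>

lemma pointwise_convergent_subsequence:
  fixes f :: "nat \<Rightarrow> int \<Rightarrow> real"
  assumes "\<And>n k. \<bar>f n k - c k\<bar> \<le> v k"
  obtains r g where "strict_mono r" "\<And>k. (\<lambda>n. f (r n) k) \<longlonglongrightarrow> g k" "\<And>k. \<bar>g k - c k\<bar> \<le> v k"
proof -
  define K where "K = PiE (UNIV :: int set) (\<lambda>k. {c k - v k..c k + v k})"
  have "compactin (product_topology (\<lambda>_. euclidean) UNIV) K"
    unfolding K_def compactin_PiE by auto
  then have "compact K" by (simp add: euclidean_product_topology)
  moreover have "f n \<in> K" for n
    using assms by (auto simp: K_def PiE_UNIV_domain abs_le_iff algebra_simps)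
  ultimately obtain g r where gr: "g \<in> K" "strict_mono r" "(f \<circ> r) \<longlonglongrightarrow> g"
    unfolding compact_def by blast
  have "(\<lambda>n. f (r n) k) \<longlonglongrightarrow> g k" for k
  proof -
    have "continuous_on UNIV (\<lambda>x::int \<Rightarrow> real. x k)" by (rule continuous_on_product_coordinates)
    from continuous_on_tendsto_compose[OF this gr(3)] show ?thesis by (simp add: o_def)
  qed
  moreover have "\<bar>g k - c k\<bar> \<le> v k" for k
  proof -
    have "g k \<in> {c k - v k..c k + v k}" using gr(1) by (auto simp: K_def PiE_UNIV_domain)
    then show ?thesis by (simp add: abs_le_iff)
  qed
  ultimately show ?thesis using that gr(2) by blast
qed

section \<open>Calculus of the generating function\<close>

lemma MVT_segment:
  fixes f :: "real \<Rightarrow> real"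
  assumes "\<And>x. (f has_real_derivative f' x) (at x)"
  shows "\<exists>\<xi>\<in>closed_segment a b. f b - f a = f' \<xi> * (b - a)"
proof (cases a b rule: linorder_cases)
  case less
  from MVT2[OF this, of f f'] assms show ?thesis
    by (auto simp: closed_segment_eq_real_ivl algebra_simps intro!: bexI)
next
  case greater
  from MVT2[OF this, of f f'] assms obtain z where "b < z" "z < a" "f a - f b = (a - b) * f' z"
    by auto
  then show ?thesis
    by (intro bexI[of _ z]) (auto simp: closed_segment_eq_real_ivl algebra_simps)
qed auto

lemma C1_plane_partials:
  assumes "C1_plane G"
  shows "((\<lambda>t. G t y) has_real_derivative D1 G x y) (at x)"
    and "((\<lambda>t. G x t) has_real_derivative D2 G x y) (at y)"
  using assms unfolding C1_plane_def D1_def D2_def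
  by (auto simp: DERIV_deriv_iff_field_differentiable)

lemma C1_plane_has_derivative:
  assumes "C1_plane G"
  shows "((\<lambda>(x, y). G x y) has_derivative (\<lambda>(s, t). D1 G x y * s + D2 G x y * t)) (at (x, y))"
proof -
  have "continuous_on UNIV (\<lambda>(x, y). blinfun_scaleR_left (D2 G x y))"
    using assms unfolding C1_plane_def case_prod_unfold by (intro continuous_intros) auto
  then have cont: "continuous (at (x, y) within UNIV \<times> UNIV)
      (\<lambda>(x, y). blinfun_scaleR_left (D2 G x y))"
    by (auto simp: continuous_on_eq_continuous_within)
  have "((\<lambda>(x, y). G x y) has_derivative
      (\<lambda>(s, t). D1 G x y * s + blinfun_scaleR_left (D2 G x y) t)) (at (x, y) within UNIV \<times> UNIV)"
  proof (rule has_derivative_partialsI[OF _ _ cont])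
    show "((\<lambda>x. G x y) has_derivative (\<lambda>s. D1 G x y * s)) (at x within UNIV)"
      using C1_plane_partials(1)[OF assms] by (simp add: has_field_derivative_def)
    show "((\<lambda>y. G x y) has_derivative blinfun_apply (blinfun_scaleR_left (D2 G x y)))
        (at y within UNIV)" for x y
    proof -
      have "blinfun_apply (blinfun_scaleR_left (D2 G x y)) = (*) (D2 G x y)"
        by (auto simp: fun_eq_iff mult.commute)
      then show ?thesis
        using C1_plane_partials(2)[OF assms] by (simp add: has_field_derivative_def)
    qed
  qed auto
  then show ?thesis by (simp add: mult.commute)
qed

lemma C1_plane_continuous:
  assumes "C1_plane G"
  shows "continuous_on X (\<lambda>(x, y). G x y)"
proof -
  have "isCont (\<lambda>(x, y). G x y) (x, y)" for x y
    using C1_plane_has_derivative[OF assms] by (rule has_derivative_continuous)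
  then show ?thesis by (auto intro!: continuous_at_imp_continuous_on)
qed

lemma C1_plane_curve:
  assumes "C1_plane G" "(a has_real_derivative a') (at t)" "(b has_real_derivative b') (at t)"
  shows "((\<lambda>t. G (a t) (b t)) has_real_derivative
           (D1 G (a t) (b t) * a' + D2 G (a t) (b t) * b')) (at t)"
proof -
  have "((\<lambda>t. (a t, b t)) has_derivative (\<lambda>s. (a' * s, b' * s))) (at t)"
    using assms(2,3) unfolding has_field_derivative_def by (rule has_derivative_Pair)
  from has_derivative_compose[OF this C1_plane_has_derivative[OF assms(1)]]
  have "((\<lambda>t. G (a t) (b t)) has_derivative
      (\<lambda>s. D1 G (a t) (b t) * (a' * s) + D2 G (a t) (b t) * (b' * s))) (at t)" by simp
  then show ?thesis unfolding has_field_derivative_def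
    by (rule has_derivative_eq_rhs) (auto simp: fun_eq_iff algebra_simps)
qed

text \<open>Schwarz' theorem: the double difference quotient of \<open>G\<close> is a value of either mixed derivative at a
  nearby point.\<close>

lemma C2_plane_mixed_partials:
  assumes "C2_plane G"
  shows "D1 (D2 G) x y = D2 (D1 G) x y"
proof -
  have C: "C1_plane G" "C1_plane (D1 G)" "C1_plane (D2 G)"
    using assms by (auto simp: C2_plane_def)
  have ex: "\<exists>p q. D2 (D1 G) (fst p) (snd p) = D1 (D2 G) (fst q) (snd q) \<and>
      dist p (x, y) \<le> 2 * h \<and> dist q (x, y) \<le> 2 * h" if "h > 0" for h
  proof -
    have cl: "dist (\<xi>, \<eta>) (x, y) \<le> 2 * h"
      if "\<xi> \<in> closed_segment x (x + h)" "\<eta> \<in> closed_segment y (y + h)" for \<xi> \<eta>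
    proof -
      have "dist (\<xi>, \<eta>) (x, y) \<le> dist \<xi> x + dist \<eta> y"
        by (simp add: dist_Pair_Pair sqrt_sum_squares_le_sum)
      then show ?thesis using that \<open>h > 0\<close>
        by (auto simp: closed_segment_eq_real_ivl dist_real_def)
    qed
    let ?D = "(G (x + h) (y + h) - G (x + h) y) - (G x (y + h) - G x y)"
    have "((\<lambda>t. G t (y + h) - G t y) has_real_derivative (D1 G t (y + h) - D1 G t y)) (at t)" for t
      by (intro derivative_intros C1_plane_partials C)
    from MVT_segment[OF this, of x "x + h"] obtain \<xi> where
      \<xi>: "\<xi> \<in> closed_segment x (x + h)" "?D = (D1 G \<xi> (y + h) - D1 G \<xi> y) * h" by auto
    from MVT_segment[OF C1_plane_partials(2)[OF C(2)], of y "y + h"] obtain \<eta> where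
      \<eta>: "\<eta> \<in> closed_segment y (y + h)" "D1 G \<xi> (y + h) - D1 G \<xi> y = D2 (D1 G) \<xi> \<eta> * h" by auto
    have "((\<lambda>t. G (x + h) t - G x t) has_real_derivative (D2 G (x + h) t - D2 G x t)) (at t)" for t
      by (intro derivative_intros C1_plane_partials C)
    from MVT_segment[OF this, of y "y + h"] obtain \<eta>' where
      \<eta>': "\<eta>' \<in> closed_segment y (y + h)" "?D = (D2 G (x + h) \<eta>' - D2 G x \<eta>') * h"
      by (auto simp: algebra_simps)
    from MVT_segment[OF C1_plane_partials(1)[OF C(3)], of x "x + h"] obtain \<xi>' where
      \<xi>': "\<xi>' \<in> closed_segment x (x + h)" "D2 G (x + h) \<eta>' - D2 G x \<eta>' = D1 (D2 G) \<xi>' \<eta>' * h" by auto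
    have "D2 (D1 G) \<xi> \<eta> * h * h = D1 (D2 G) \<xi>' \<eta>' * h * h"
      using \<xi>(2)[unfolded \<eta>(2)] \<eta>'(2)[unfolded \<xi>'(2)] by (rule trans[OF sym])
    then have "D2 (D1 G) \<xi> \<eta> = D1 (D2 G) \<xi>' \<eta>'" using that by simp
    with cl \<xi>(1) \<eta>(1) \<xi>'(1) \<eta>'(1) show ?thesis
      by (intro exI[of _ "(\<xi>, \<eta>)"] exI[of _ "(\<xi>', \<eta>')"]) auto
  qed
  have "\<forall>n. \<exists>p q. D2 (D1 G) (fst p) (snd p) = D1 (D2 G) (fst q) (snd q) \<and>
      dist p (x, y) \<le> 2 * (1 / real (Suc n)) \<and> dist q (x, y) \<le> 2 * (1 / real (Suc n))"
    by (intro allI ex) simp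
  then obtain p q where pq: "\<And>n. D2 (D1 G) (fst (p n)) (snd (p n)) = D1 (D2 G) (fst (q n)) (snd (q n))"
      "\<And>n. dist (p n) (x, y) \<le> 2 * (1 / real (Suc n))" "\<And>n. dist (q n) (x, y) \<le> 2 * (1 / real (Suc n))"
    by metis
  have "(\<lambda>n. 2 * (1 / real (Suc n))) \<longlonglongrightarrow> 2 * 0"
    by (intro tendsto_mult tendsto_const LIMSEQ_Suc lim_1_over_n)
  then have lim0: "(\<lambda>n. 2 * (1 / real (Suc n))) \<longlonglongrightarrow> 0" by simp
  have squeeze: "s \<longlonglongrightarrow> (x, y)" if "\<And>n. dist (s n) (x, y) \<le> 2 * (1 / real (Suc n))" for s
    unfolding tendsto_dist_iff[of s]
    by (rule tendsto_sandwich[OF _ _ tendsto_const lim0]) (intro always_eventually allI zero_le_dist that)+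
  have p: "p \<longlonglongrightarrow> (x, y)" and q: "q \<longlonglongrightarrow> (x, y)"
    by (rule squeeze, rule pq)+
  have c: "continuous_on UNIV (\<lambda>(x, y). D2 (D1 G) x y)" "continuous_on UNIV (\<lambda>(x, y). D1 (D2 G) x y)"
    using C by (auto simp: C1_plane_def)
  have "(\<lambda>n. D2 (D1 G) (fst (p n)) (snd (p n))) \<longlonglongrightarrow> D2 (D1 G) x y"
    using continuous_on_tendsto_compose[OF c(1) p] by (simp add: case_prod_unfold)
  moreover have "(\<lambda>n. D2 (D1 G) (fst (p n)) (snd (p n))) \<longlonglongrightarrow> D1 (D2 G) x y"
    using continuous_on_tendsto_compose[OF c(2) q] pq(1) by (simp add: case_prod_unfold)
  ultimately show ?thesis using LIMSEQ_unique by blast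
qed

text \<open>The constants \<open>\<delta>\<close> and \<open>M\<close> fix witnesses for the existential bounds in (A2) and (A3), so that
  quantitative estimates can refer to them.\<close>

locale twist_generating =
  fixes V :: "real \<Rightarrow> real \<Rightarrow> real" and \<delta> M :: real
  assumes C2: "C2_plane V"
    and periodic: "V (x + 1) (x' + 1) = V x x'"
    and \<delta>: "0 < \<delta>" and twist: "D2 (D1 V) x x' \<le> - \<delta>"
    and M11: "\<bar>D1 (D1 V) x x'\<bar> \<le> M" and M12: "\<bar>D2 (D1 V) x x'\<bar> \<le> M"
    and M22: "\<bar>D2 (D2 V) x x'\<bar> \<le> M"

lemma twist_generatingI:
  assumes "A1 V" "A2 V" "A3 V"
  obtains \<delta> M where "twist_generating V \<delta> M"
proof -
  from assms(2) obtain \<delta> where \<delta>: "\<delta> > 0" "\<And>x x'. D2 (D1 V) x x' \<le> - \<delta>"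
    by (auto simp: A2_def)
  have "\<exists>B. \<forall>x x'. \<bar>G x x'\<bar> \<le> B" if "G \<in> {D1 (D1 V), D2 (D1 V), D2 (D2 V)}" for G
  proof -
    have "bounded (range (\<lambda>(x, x'). G x x'))" using assms(3) that by (auto simp: A3_def)
    then obtain B where "\<forall>p\<in>range (\<lambda>(x, x'). G x x'). norm p \<le> B" by (auto simp: bounded_iff)
    then show ?thesis by (intro exI[of _ B]) auto
  qed
  from this[of "D1 (D1 V)"] this[of "D2 (D1 V)"] this[of "D2 (D2 V)"]
  obtain B1 B2 B3 where B: "\<And>x x'. \<bar>D1 (D1 V) x x'\<bar> \<le> B1" "\<And>x x'. \<bar>D2 (D1 V) x x'\<bar> \<le> B2"
    "\<And>x x'. \<bar>D2 (D2 V) x x'\<bar> \<le> B3" by auto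
  have "twist_generating V \<delta> (max B1 (max B2 B3))"
    using assms(1) \<delta> B by unfold_locales (auto simp: A1_def le_max_iff_disj)
  then show ?thesis using that by blast
qed

context twist_generating
begin

lemma C1s: "C1_plane V" "C1_plane (D1 V)" "C1_plane (D2 V)"
  using C2 by (auto simp: C2_plane_def)

lemma M_ge: "\<delta> \<le> M" "0 < M"
  using M12[of 0 0] twist[of 0 0] \<delta> by auto

lemmas partials = C1_plane_partials[OF C1s(1)] C1_plane_partials[OF C1s(2)]
  C1_plane_partials[OF C1s(3)]

lemma mixed: "D1 (D2 V) x y = D2 (D1 V) x y"
  by (rule C2_plane_mixed_partials[OF C2])

lemma periodic_int: "V (x + of_int n) (x' + of_int n) = V x x'"
proof (induction n rule: int_induct[where k = 0])
  case (step1 i) then show ?case using periodic[of "x + of_int i" "x' + of_int i"] by (simp add: add_ac)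
next
  case (step2 i)
  have "x + of_int i = x + of_int (i - 1) + 1" "x' + of_int i = x' + of_int (i - 1) + 1" by simp_all
  then show ?case
    using step2 periodic[of "x + of_int (i - 1)" "x' + of_int (i - 1)"] by metis
qed simp

lemma D_periodic_int:
  "D1 V (x + of_int n) (x' + of_int n) = D1 V x x'" "D2 V (x + of_int n) (x' + of_int n) = D2 V x x'"
proof -
  have "((\<lambda>t. V (t + of_int n) (x' + of_int n)) has_real_derivative D1 V (x + of_int n) (x' + of_int n)) (at x)"
    using partials(1)[of "x' + of_int n" "x + of_int n"] unfolding DERIV_shift .
  then show "D1 V (x + of_int n) (x' + of_int n) = D1 V x x'"
    unfolding periodic_int by (rule DERIV_unique[OF _ partials(1)])
  have "((\<lambda>t. V (x + of_int n) (t + of_int n)) has_real_derivative D2 V (x + of_int n) (x' + of_int n)) (at x')"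
    using partials(2)[of "x + of_int n" "x' + of_int n"] unfolding DERIV_shift .
  then show "D2 V (x + of_int n) (x' + of_int n) = D2 V x x'"
    unfolding periodic_int by (rule DERIV_unique[OF _ partials(2)])
qed

lemma D_periodic: "D1 V (x + 1) (x' + 1) = D1 V x x'" "D2 V (x + 1) (x' + 1) = D2 V x x'"
  using D_periodic_int[of x 1 x'] by simp_all

text \<open>Mean value forms of the increments of \<open>V\<^sub>1\<close> and \<open>V\<^sub>2\<close>. The third uses the symmetry of the mixed
  derivatives, so that the twist condition applies to \<open>V\<^sub>2\<close> as well.\<close>

lemma D_increment:
  "\<exists>\<xi>\<in>closed_segment x x'. D1 V x' y - D1 V x y = D1 (D1 V) \<xi> y * (x' - x)"
  "\<exists>\<xi>\<in>closed_segment y y'. D1 V x y' - D1 V x y = D2 (D1 V) x \<xi> * (y' - y)"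
  "\<exists>\<xi>\<in>closed_segment x x'. D2 V x' y - D2 V x y = D2 (D1 V) \<xi> y * (x' - x)"
  "\<exists>\<xi>\<in>closed_segment y y'. D2 V x y' - D2 V x y = D2 (D2 V) x \<xi> * (y' - y)"
  by (rule MVT_segment[OF partials(3)], rule MVT_segment[OF partials(4)],
      rule MVT_segment[OF partials(5)[unfolded mixed]], rule MVT_segment[OF partials(6)])

lemma D_Lipschitz:
  "\<bar>D1 V x' y' - D1 V x y\<bar> \<le> M * (\<bar>x' - x\<bar> + \<bar>y' - y\<bar>)"
  "\<bar>D2 V x' y' - D2 V x y\<bar> \<le> M * (\<bar>x' - x\<bar> + \<bar>y' - y\<bar>)"
proof -
  have *: "\<bar>c * t\<bar> \<le> M * \<bar>t\<bar>" if "\<bar>c\<bar> \<le> M" for c t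
    using that by (simp add: abs_mult mult_right_mono)
  from D_increment(1)[of x x' y'] D_increment(2)[of y y' x] D_increment(3)[of x x' y']
    D_increment(4)[of y y' x]
  obtain a b c d where
    "D1 V x' y' - D1 V x y' = D1 (D1 V) a y' * (x' - x)"
    "D1 V x y' - D1 V x y = D2 (D1 V) x b * (y' - y)"
    "D2 V x' y' - D2 V x y' = D2 (D1 V) c y' * (x' - x)"
    "D2 V x y' - D2 V x y = D2 (D2 V) x d * (y' - y)"
    by blast
  then have "\<bar>D1 V x' y' - D1 V x y'\<bar> \<le> M * \<bar>x' - x\<bar>" "\<bar>D1 V x y' - D1 V x y\<bar> \<le> M * \<bar>y' - y\<bar>"
    "\<bar>D2 V x' y' - D2 V x y'\<bar> \<le> M * \<bar>x' - x\<bar>" "\<bar>D2 V x y' - D2 V x y\<bar> \<le> M * \<bar>y' - y\<bar>"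
    using M11 M12 M22 * by simp_all
  then show "\<bar>D1 V x' y' - D1 V x y\<bar> \<le> M * (\<bar>x' - x\<bar> + \<bar>y' - y\<bar>)"
    "\<bar>D2 V x' y' - D2 V x y\<bar> \<le> M * (\<bar>x' - x\<bar> + \<bar>y' - y\<bar>)"
    unfolding distrib_left by linarith+
qed

lemma D_strict_antimono:
  "y < y' \<Longrightarrow> D1 V x y' < D1 V x y" "x < x' \<Longrightarrow> D2 V x' y < D2 V x y"
proof -
  have *: "c * t < 0" if "c \<le> - \<delta>" "t > 0" for c t
    using that \<delta> by (intro mult_neg_pos) auto
  from D_increment(2)[of y y' x] D_increment(3)[of x x' y] obtain a b where
    "D1 V x y' - D1 V x y = D2 (D1 V) x a * (y' - y)" "D2 V x' y - D2 V x y = D2 (D1 V) b y * (x' - x)"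
    by blast
  then show "y < y' \<Longrightarrow> D1 V x y' < D1 V x y" "x < x' \<Longrightarrow> D2 V x' y < D2 V x y"
    using *[OF twist[of x a], of "y' - y"] *[OF twist[of b y], of "x' - x"] by auto
qed

lemma D_expanding:
  "\<delta> * \<bar>y' - y\<bar> \<le> \<bar>D1 V x y' - D1 V x y\<bar>"
proof -
  from D_increment(2)[of y y' x] obtain a where "D1 V x y' - D1 V x y = D2 (D1 V) x a * (y' - y)"
    by blast
  moreover have "\<delta> \<le> \<bar>D2 (D1 V) x a\<bar>" using twist[of x a] by linarith
  ultimately show ?thesis by (simp add: abs_mult mult_right_mono)
qed

lemma D_inj: "D1 V x y' = D1 V x y \<longleftrightarrow> y' = y" "D2 V x' y = D2 V x y \<longleftrightarrow> x' = x"
proof -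
  show "D1 V x y' = D1 V x y \<longleftrightarrow> y' = y"
    using D_strict_antimono(1)[of y y' x] D_strict_antimono(1)[of y' y x]
    by (cases y y' rule: linorder_cases) auto
  show "D2 V x' y = D2 V x y \<longleftrightarrow> x' = x"
    using D_strict_antimono(2)[of x x' y] D_strict_antimono(2)[of x' x y]
    by (cases x x' rule: linorder_cases) auto
qed

text \<open>The mixed second difference of \<open>V\<close> over a rectangle is an integral of \<open>V\<^sub>1\<^sub>2 < 0\<close>. If the two
  segments are ordered there is nothing to do; if they cross, uncrossing them lowers the sum.\<close>

lemma V_submodular: "V (max a c) (max b d) + V (min a c) (min b d) \<le> V a b + V c d"
proof -
  have "V a b + V c d - V a d - V c b \<le> 0" if "a \<le> c" "b \<le> d" for a b c d
  proof -
    have "((\<lambda>t. V t d - V t b) has_real_derivative (D1 V t d - D1 V t b)) (at t)" for t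
      by (intro derivative_intros partials)
    from MVT_segment[OF this, of a c] obtain \<xi> where
      "(V c d - V c b) - (V a d - V a b) = (D1 V \<xi> d - D1 V \<xi> b) * (c - a)" by auto
    moreover have "D1 V \<xi> d - D1 V \<xi> b \<le> 0"
      using D_strict_antimono(1)[of b d \<xi>] that by (cases "b = d") auto
    ultimately have "(V c d - V c b) - (V a d - V a b) \<le> 0"
      using that by (simp only:) (rule mult_nonpos_nonneg; simp)
    then show ?thesis by linarith
  qed
  from this[of a c d b] this[of c a b d] show ?thesis
    by (cases "a \<le> c"; cases "b \<le> d") (auto simp: max_def min_def)
qed

text \<open>The constant of the quadratic remainder is uniform over the plane because the second derivatives
  are globally bounded.\<close>

lemma V_Taylor:
  "\<bar>V x' y' - V x y - D1 V x y * (x' - x) - D2 V x y * (y' - y)\<bar> \<le> 2 * M * ((x' - x)\<^sup>2 + (y' - y)\<^sup>2)"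
proof -
  from MVT_segment[OF partials(1), of x x' y'] MVT_segment[OF partials(2), of y y' x]
  obtain a b where a: "a \<in> closed_segment x x'" "V x' y' - V x y' = D1 V a y' * (x' - x)"
    and b: "b \<in> closed_segment y y'" "V x y' - V x y = D2 V x b * (y' - y)"
    by blast
  have ab: "\<bar>a - x\<bar> \<le> \<bar>x' - x\<bar>" "\<bar>b - y\<bar> \<le> \<bar>y' - y\<bar>"
    using a b by (auto simp: closed_segment_eq_real_ivl split: if_splits)
  have "\<bar>D1 V a y' - D1 V x y\<bar> \<le> M * (\<bar>a - x\<bar> + \<bar>y' - y\<bar>)" by (rule D_Lipschitz)
  also have "\<dots> \<le> M * (\<bar>x' - x\<bar> + \<bar>y' - y\<bar>)"
    using ab M_ge by (intro mult_left_mono) auto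
  finally have 1: "\<bar>(D1 V a y' - D1 V x y) * (x' - x)\<bar> \<le> M * (\<bar>x' - x\<bar> + \<bar>y' - y\<bar>) * \<bar>x' - x\<bar>"
    unfolding abs_mult by (rule mult_right_mono) simp
  have "\<bar>D2 V x b - D2 V x y\<bar> \<le> M * (\<bar>x - x\<bar> + \<bar>b - y\<bar>)" by (rule D_Lipschitz)
  also have "\<dots> \<le> M * \<bar>y' - y\<bar>"
    using ab M_ge by (intro mult_left_mono) auto
  finally have 2: "\<bar>(D2 V x b - D2 V x y) * (y' - y)\<bar> \<le> M * \<bar>y' - y\<bar> * \<bar>y' - y\<bar>"
    unfolding abs_mult by (rule mult_right_mono) simp
  have eq: "V x' y' - V x y - D1 V x y * (x' - x) - D2 V x y * (y' - y) =
      (D1 V a y' - D1 V x y) * (x' - x) + (D2 V x b - D2 V x y) * (y' - y)"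
    using a(2) b(2) by (simp add: algebra_simps)
  have 3: "(p + q) * p + q * q \<le> 2 * (p\<^sup>2 + q\<^sup>2)" for p q :: real
  proof -
    have "0 \<le> (p - q)\<^sup>2 + p * p + q * q" by simp
    moreover have "2 * (2 * (p\<^sup>2 + q\<^sup>2) - ((p + q) * p + q * q)) = (p - q)\<^sup>2 + p * p + q * q"
      by (simp add: power2_eq_square algebra_simps)
    ultimately have "0 \<le> 2 * (2 * (p\<^sup>2 + q\<^sup>2) - ((p + q) * p + q * q))" by (simp only:)
    then have "0 \<le> 2 * (p\<^sup>2 + q\<^sup>2) - ((p + q) * p + q * q)" by (simp only: zero_le_mult_iff) simp
    then show ?thesis by (simp only: diff_ge_0_iff_ge)
  qed
  have "\<bar>V x' y' - V x y - D1 V x y * (x' - x) - D2 V x y * (y' - y)\<bar>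
      \<le> M * ((\<bar>x' - x\<bar> + \<bar>y' - y\<bar>) * \<bar>x' - x\<bar> + \<bar>y' - y\<bar> * \<bar>y' - y\<bar>)"
    unfolding eq using 1 2 by (simp add: algebra_simps)
  also have "\<dots> \<le> M * (2 * (\<bar>x' - x\<bar>\<^sup>2 + \<bar>y' - y\<bar>\<^sup>2))"
    by (intro mult_left_mono 3) (use M_ge in simp)
  finally show ?thesis by (simp add: algebra_simps)
qed

lemma V_locally_Lipschitz:
  obtains K where "0 \<le> K" "\<And>x y x' y'. \<lbrakk>x \<in> {a..b}; y \<in> {a..b}; x' \<in> {a..b}; y' \<in> {a..b}\<rbrakk> \<Longrightarrow>
    \<bar>V x' y' - V x y\<bar> \<le> K * (\<bar>x' - x\<bar> + \<bar>y' - y\<bar>)"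
proof -
  have "\<exists>B. \<forall>p\<in>{a..b} \<times> {a..b}. norm ((\<lambda>(x, y). G x y) p) \<le> B" if "C1_plane G" for G
  proof -
    have "compact ((\<lambda>(x, y). G x y) ` ({a..b} \<times> {a..b}))"
      by (intro compact_continuous_image C1_plane_continuous that compact_Times) auto
    from compact_imp_bounded[OF this] show ?thesis by (auto simp: bounded_iff)
  qed
  from this[OF C1s(2)] this[OF C1s(3)] obtain B1 B2 where
    B: "\<And>x y. x \<in> {a..b} \<Longrightarrow> y \<in> {a..b} \<Longrightarrow> \<bar>D1 V x y\<bar> \<le> B1"
      "\<And>x y. x \<in> {a..b} \<Longrightarrow> y \<in> {a..b} \<Longrightarrow> \<bar>D2 V x y\<bar> \<le> B2"
    by fastforce
  define K where "K = \<bar>B1\<bar> + \<bar>B2\<bar>"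
  have "\<bar>V x' y' - V x y\<bar> \<le> K * (\<bar>x' - x\<bar> + \<bar>y' - y\<bar>)"
    if "x \<in> {a..b}" "y \<in> {a..b}" "x' \<in> {a..b}" "y' \<in> {a..b}" for x y x' y'
  proof -
    from MVT_segment[OF partials(1), of x x' y'] MVT_segment[OF partials(2), of y y' x]
    obtain c d where c: "c \<in> closed_segment x x'" "V x' y' - V x y' = D1 V c y' * (x' - x)"
      and d: "d \<in> closed_segment y y'" "V x y' - V x y = D2 V x d * (y' - y)"
      by blast
    have "c \<in> {a..b}" "d \<in> {a..b}"
      using c(1) d(1) that by (auto simp: closed_segment_eq_real_ivl split: if_splits)
    then have "\<bar>D1 V c y'\<bar> \<le> K" "\<bar>D2 V x d\<bar> \<le> K"
      using B(1)[of c y'] B(2)[of x d] that unfolding K_def by linarith+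
    then have "\<bar>V x' y' - V x y'\<bar> \<le> K * \<bar>x' - x\<bar>" "\<bar>V x y' - V x y\<bar> \<le> K * \<bar>y' - y\<bar>"
      unfolding c(2) d(2) abs_mult by (auto intro: mult_right_mono)
    then show ?thesis unfolding distrib_left by linarith
  qed
  moreover have "0 \<le> K" by (simp add: K_def)
  ultimately show ?thesis using that by blast
qed

text \<open>Uniqueness in the implicit definition of \<open>F\<close> is strict monotonicity of \<open>V\<^sub>1 (x, \<cdot>)\<close>.\<close>

lemma twist_lift_eq: "p = - D1 V x x' \<Longrightarrow> twist_lift V (x, p) = (x', D2 V x x')"
  unfolding twist_lift_def by (auto intro!: the_equality simp: D_inj)

lemma twist_lift_translate:
  "twist_lift V (x + of_int n, - D1 V x x') = (x' + of_int n, D2 V x x')"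
  using twist_lift_eq[of "- D1 V x x'" "x + of_int n" "x' + of_int n"] by (simp add: D_periodic_int)

end

section \<open>The action of summable connections\<close>

text \<open>The reference configuration that jumps from \<open>y0\<close> to \<open>y0 + 1\<close>; deviations from it measure how fast
  a connection approaches its limits.\<close>

definition step_profile :: "real \<Rightarrow> int \<Rightarrow> real" where
  "step_profile y0 k = (if k \<le> 0 then y0 else y0 + 1)"

text \<open>On this class the action converges absolutely, which makes sums, limits and rearrangements
  harmless; the homoclinics of the theorem belong to it because of their exponential decay.\<close>

definition summable_connections :: "real \<Rightarrow> (int \<Rightarrow> real) set" where
  "summable_connections y0 = {\<xi>. (\<lambda>k. \<bar>\<xi> k - step_profile y0 k\<bar>) summable_on UNIV}"

definition excess :: "(real \<Rightarrow> real \<Rightarrow> real) \<Rightarrow> real \<Rightarrow> (int \<Rightarrow> real) \<Rightarrow> int \<Rightarrow> real" where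
  "excess V y0 \<xi> k = V (\<xi> k) (\<xi> (k + 1)) - V y0 y0"

definition action :: "(real \<Rightarrow> real \<Rightarrow> real) \<Rightarrow> real \<Rightarrow> (int \<Rightarrow> real) \<Rightarrow> real" where
  "action V y0 \<xi> = (\<Sum>\<^sub>\<infinity>k. excess V y0 \<xi> k)"

text \<open>Equivalently, \<open>k \<mapsto> (\<xi> k, - V\<^sub>1 (\<xi> k, \<xi> (k + 1)))\<close> is an orbit of \<open>F\<close>.\<close>

definition stationary :: "(real \<Rightarrow> real \<Rightarrow> real) \<Rightarrow> (int \<Rightarrow> real) \<Rightarrow> bool" where
  "stationary V \<xi> \<longleftrightarrow> (\<forall>k. D2 V (\<xi> (k - 1)) (\<xi> k) + D1 V (\<xi> k) (\<xi> (k + 1)) = 0)"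

lemma summable_on_int_point: "(\<lambda>k::int. if k = a then c else (0::real)) summable_on UNIV"
  by (rule summable_on_finite_support(1)[of "{a}"]) auto

lemma summable_nonneg_bounded:
  fixes v :: "'a \<Rightarrow> real"
  assumes "v summable_on UNIV" "\<And>k. 0 \<le> v k"
  shows "v k \<le> infsum v UNIV"
  using finite_sum_le_infsum[OF assms(1), of "{k}"] assms(2) by simp

lemma summable_connections_max_min:
  assumes "\<xi> \<in> summable_connections y0" "\<eta> \<in> summable_connections y0"
  shows "(\<lambda>k. max (\<xi> k) (\<eta> k)) \<in> summable_connections y0"
    and "(\<lambda>k. min (\<xi> k) (\<eta> k)) \<in> summable_connections y0"
proof -
  have s: "(\<lambda>k. \<bar>\<xi> k - step_profile y0 k\<bar> + \<bar>\<eta> k - step_profile y0 k\<bar>) summable_on UNIV"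
    using assms by (auto simp: summable_connections_def intro: summable_on_add)
  show "(\<lambda>k. max (\<xi> k) (\<eta> k)) \<in> summable_connections y0"
    unfolding summable_connections_def mem_Collect_eq
    by (rule summable_on_dominated[OF s]) (auto simp: max_def)
  show "(\<lambda>k. min (\<xi> k) (\<eta> k)) \<in> summable_connections y0"
    unfolding summable_connections_def mem_Collect_eq
    by (rule summable_on_dominated[OF s]) (auto simp: min_def)
qed

lemma summable_connections_shift:
  assumes "\<xi> \<in> summable_connections y0"
  shows "(\<lambda>k. \<xi> (k + c)) \<in> summable_connections y0"
proof -
  have 1: "(\<lambda>k. \<bar>\<xi> (k + c) - step_profile y0 (k + c)\<bar>) summable_on UNIV"
    using assms summable_on_int_shift[of "\<lambda>k. \<bar>\<xi> k - step_profile y0 k\<bar>" c]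
    by (simp add: summable_connections_def)
  have 2: "(\<lambda>k. \<bar>step_profile y0 (k + c) - step_profile y0 k\<bar>) summable_on UNIV"
    by (rule summable_on_finite_support(1)[of "{- \<bar>c\<bar>..\<bar>c\<bar>}"]) (auto simp: step_profile_def)
  show ?thesis
    unfolding summable_connections_def mem_Collect_eq
    by (rule summable_on_dominated[OF summable_on_add[OF 1 2]]) auto
qed

lemma summable_connections_tendsto:
  assumes "\<xi> \<in> summable_connections y0"
  shows "(\<xi> \<longlongrightarrow> y0) at_bot" "(\<xi> \<longlongrightarrow> y0 + 1) at_top"
proof -
  have s: "(\<lambda>k. \<bar>\<xi> k - step_profile y0 k\<bar>) summable_on UNIV"
    using assms by (simp add: summable_connections_def)
  note t = summable_on_int_tendsto_0[OF s]
  have "\<forall>\<^sub>F k in at_bot. \<bar>\<xi> k - step_profile y0 k\<bar> = \<bar>\<xi> k - y0\<bar>"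
    unfolding eventually_at_bot_linorder by (intro exI[of _ 0]) (simp add: step_profile_def)
  from tendsto_rabs_zero_cancel[OF Lim_transform_eventually[OF t(2) this]]
  have "((\<lambda>k. \<xi> k - y0) \<longlongrightarrow> 0) at_bot" .
  then show "(\<xi> \<longlongrightarrow> y0) at_bot" by (simp add: LIM_zero_iff)
  have "\<forall>\<^sub>F k in at_top. \<bar>\<xi> k - step_profile y0 k\<bar> = \<bar>\<xi> k - (y0 + 1)\<bar>"
    unfolding eventually_at_top_linorder by (intro exI[of _ 1]) (simp add: step_profile_def)
  from tendsto_rabs_zero_cancel[OF Lim_transform_eventually[OF t(1) this]]
  have "((\<lambda>k. \<xi> k - (y0 + 1)) \<longlongrightarrow> 0) at_top" .
  then show "(\<xi> \<longlongrightarrow> y0 + 1) at_top" by (simp add: LIM_zero_iff)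
qed

context twist_generating
begin

text \<open>\<open>V\<close> is Lipschitz on the compact square containing all configurations within distance \<open>v\<close> of the
  step profile, and the step profile itself has zero excess away from the jump at \<open>k = 0\<close>. The
  majorant is therefore uniform over the envelope, as dominated convergence requires.\<close>

lemma excess_dominated:
  assumes v: "v summable_on UNIV" "\<And>k. 0 \<le> v k"
  obtains w where "w summable_on UNIV"
    "\<And>\<xi> k. (\<And>k. \<bar>\<xi> k - step_profile y0 k\<bar> \<le> v k) \<Longrightarrow> \<bar>excess V y0 \<xi> k\<bar> \<le> w k"
proof -
  define R where "R = infsum v UNIV"
  have R: "v k \<le> R" "0 \<le> R" for k
    using summable_nonneg_bounded[OF v, of k] v(2)[of k] by (auto simp: R_def)
  obtain K where K: "0 \<le> K" "\<And>x y x' y'. \<lbrakk>x \<in> {y0 - R..y0 + 1 + R}; y \<in> {y0 - R..y0 + 1 + R};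
      x' \<in> {y0 - R..y0 + 1 + R}; y' \<in> {y0 - R..y0 + 1 + R}\<rbrakk> \<Longrightarrow>
    \<bar>V x' y' - V x y\<bar> \<le> K * (\<bar>x' - x\<bar> + \<bar>y' - y\<bar>)"
    using V_locally_Lipschitz[of "y0 - R" "y0 + 1 + R"] by blast
  define w where "w k = K * (v k + v (k + 1)) + (if k = 0 then \<bar>V y0 (y0 + 1) - V y0 y0\<bar> else 0)" for k
  have "w summable_on UNIV"
    unfolding w_def
    by (intro summable_on_add summable_on_cmult_right summable_on_int_point v summable_on_int_shift)
  moreover have "\<bar>excess V y0 \<xi> k\<bar> \<le> w k" if \<xi>: "\<And>k. \<bar>\<xi> k - step_profile y0 k\<bar> \<le> v k" for \<xi> k
  proof -
    have box: "step_profile y0 j \<in> {y0 - R..y0 + 1 + R}" "\<xi> j \<in> {y0 - R..y0 + 1 + R}" for j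
      using R(1)[of j] R(2) \<xi>[of j] by (auto simp: step_profile_def abs_le_iff split: if_splits)
    have "\<bar>V (\<xi> k) (\<xi> (k + 1)) - V (step_profile y0 k) (step_profile y0 (k + 1))\<bar>
        \<le> K * (\<bar>\<xi> k - step_profile y0 k\<bar> + \<bar>\<xi> (k + 1) - step_profile y0 (k + 1)\<bar>)"
      by (rule K(2)) (rule box)+
    also have "\<dots> \<le> K * (v k + v (k + 1))"
      using K(1) \<xi> by (intro mult_left_mono add_mono) auto
    finally have "\<bar>V (\<xi> k) (\<xi> (k + 1)) - V (step_profile y0 k) (step_profile y0 (k + 1))\<bar> \<le> K * (v k + v (k + 1))" .
    moreover have "\<bar>V (step_profile y0 k) (step_profile y0 (k + 1)) - V y0 y0\<bar>
        \<le> (if k = 0 then \<bar>V y0 (y0 + 1) - V y0 y0\<bar> else 0)"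
      using periodic[of y0 y0] by (auto simp: step_profile_def)
    ultimately show ?thesis unfolding w_def excess_def by linarith
  qed
  ultimately show ?thesis using that by blast
qed

lemma excess_summable:
  assumes "\<xi> \<in> summable_connections y0"
  shows "excess V y0 \<xi> summable_on UNIV"
proof -
  obtain w where w: "w summable_on UNIV"
    "\<And>\<eta> k. (\<And>k. \<bar>\<eta> k - step_profile y0 k\<bar> \<le> \<bar>\<xi> k - step_profile y0 k\<bar>) \<Longrightarrow> \<bar>excess V y0 \<eta> k\<bar> \<le> w k"
    by (rule excess_dominated[of "\<lambda>k. \<bar>\<xi> k - step_profile y0 k\<bar>" y0])
      (use assms in \<open>auto simp: summable_connections_def\<close>)
  show ?thesis by (rule summable_on_dominated[OF w(1)]) (rule w(2), simp)
qed

lemma has_bi_sum_action: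
  assumes "\<xi> \<in> summable_connections y0"
  shows "has_bi_sum (\<lambda>k. V (\<xi> k) (\<xi> (k + 1)) - V y0 y0) (ereal (action V y0 \<xi>))"
proof -
  have "excess V y0 \<xi> = (\<lambda>k. V (\<xi> k) (\<xi> (k + 1)) - V y0 y0)" by (simp add: excess_def fun_eq_iff)
  then show ?thesis using has_bi_sum_infsum[OF excess_summable[OF assms]] by (simp add: action_def)
qed

lemma V_continuous: "(f \<longlongrightarrow> a) F \<Longrightarrow> (g \<longlongrightarrow> b) F \<Longrightarrow> ((\<lambda>x. V (f x) (g x)) \<longlongrightarrow> V a b) F"
  using continuous_on_tendsto_compose[OF C1_plane_continuous[OF C1s(1), of UNIV] tendsto_Pair]
  by (simp add: case_prod_unfold)

lemma DV_continuous:
  assumes "(f \<longlongrightarrow> a) F" "(g \<longlongrightarrow> b) F"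
  shows "((\<lambda>x. D1 V (f x) (g x)) \<longlongrightarrow> D1 V a b) F" "((\<lambda>x. D2 V (f x) (g x)) \<longlongrightarrow> D2 V a b) F"
  using continuous_on_tendsto_compose[OF C1_plane_continuous[OF C1s(2), of UNIV] tendsto_Pair[OF assms]]
    continuous_on_tendsto_compose[OF C1_plane_continuous[OF C1s(3), of UNIV] tendsto_Pair[OF assms]]
  by (simp_all add: case_prod_unfold)

lemma action_tendsto:
  assumes v: "v summable_on UNIV" "\<And>k. 0 \<le> v k"
    and \<xi>: "\<And>n k. \<bar>\<xi> n k - step_profile y0 k\<bar> \<le> v k"
    and lim: "\<And>k. (\<lambda>n. \<xi> n k) \<longlonglongrightarrow> \<eta> k"
  shows "(\<lambda>n. action V y0 (\<xi> n)) \<longlonglongrightarrow> action V y0 \<eta>"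
proof -
  obtain w where w: "w summable_on UNIV"
    "\<And>\<xi> k. (\<And>k. \<bar>\<xi> k - step_profile y0 k\<bar> \<le> v k) \<Longrightarrow> \<bar>excess V y0 \<xi> k\<bar> \<le> w k"
    using excess_dominated[OF v, of y0] by blast
  show ?thesis unfolding action_def
  proof (rule infsum_dominated_convergence[OF w(1)])
    show "\<bar>excess V y0 (\<xi> n) k\<bar> \<le> w k" for n k by (rule w(2)) (rule \<xi>)
    show "(\<lambda>n. excess V y0 (\<xi> n) k) \<longlonglongrightarrow> excess V y0 \<eta> k" for k
      unfolding excess_def by (intro tendsto_intros V_continuous lim)
  qed
qed

lemma action_shift: "action V y0 (\<lambda>k. \<xi> (k + c)) = action V y0 \<xi>"
proof -
  have "excess V y0 (\<lambda>k. \<xi> (k + c)) = (\<lambda>k. excess V y0 \<xi> (k + c))"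
    by (auto simp: excess_def fun_eq_iff add_ac)
  then show ?thesis by (simp add: action_def infsum_int_shift)
qed

lemma action_max_min:
  assumes "\<xi> \<in> summable_connections y0" "\<eta> \<in> summable_connections y0"
  shows "action V y0 (\<lambda>k. max (\<xi> k) (\<eta> k)) + action V y0 (\<lambda>k. min (\<xi> k) (\<eta> k))
    \<le> action V y0 \<xi> + action V y0 \<eta>"
proof -
  note s = excess_summable[OF assms(1)] excess_summable[OF assms(2)]
    excess_summable[OF summable_connections_max_min(1)[OF assms]]
    excess_summable[OF summable_connections_max_min(2)[OF assms]]
  have "(\<Sum>\<^sub>\<infinity>k. excess V y0 (\<lambda>k. max (\<xi> k) (\<eta> k)) k + excess V y0 (\<lambda>k. min (\<xi> k) (\<eta> k)) k)
    \<le> (\<Sum>\<^sub>\<infinity>k. excess V y0 \<xi> k + excess V y0 \<eta> k)"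
  proof (intro infsum_mono summable_on_add s)
    show "excess V y0 (\<lambda>k. max (\<xi> k) (\<eta> k)) k + excess V y0 (\<lambda>k. min (\<xi> k) (\<eta> k)) k
        \<le> excess V y0 \<xi> k + excess V y0 \<eta> k" for k
      using V_submodular[of "\<xi> k" "\<eta> k" "\<xi> (k + 1)" "\<eta> (k + 1)"] by (simp add: excess_def)
  qed
  then show ?thesis unfolding action_def by (simp add: infsum_add s)
qed

lemma action_update:
  assumes "\<xi> \<in> summable_connections y0"
  shows "\<xi>(j := t) \<in> summable_connections y0"
    and "action V y0 (\<xi>(j := t)) - action V y0 \<xi>
      = (V (\<xi> (j - 1)) t + V t (\<xi> (j + 1))) - (V (\<xi> (j - 1)) (\<xi> j) + V (\<xi> j) (\<xi> (j + 1)))"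
proof -
  have "(\<lambda>k. \<bar>\<xi> k - step_profile y0 k\<bar> + (if k = j then \<bar>t - step_profile y0 j\<bar> else 0)) summable_on UNIV"
    using assms by (intro summable_on_add summable_on_int_point) (simp add: summable_connections_def)
  then show mem: "\<xi>(j := t) \<in> summable_connections y0"
    unfolding summable_connections_def mem_Collect_eq
    by (rule summable_on_dominated) auto
  let ?d = "\<lambda>k. excess V y0 (\<xi>(j := t)) k - excess V y0 \<xi> k"
  have supp: "?d k = 0" if "k \<notin> {j - 1, j}" for k using that by (auto simp: excess_def)
  have d: "?d summable_on UNIV" "infsum ?d UNIV = sum ?d {j - 1, j}"
    by (rule summable_on_finite_support[of "{j - 1, j}"], simp, erule supp)+
  have "action V y0 (\<xi>(j := t)) = (\<Sum>\<^sub>\<infinity>k. ?d k + excess V y0 \<xi> k)" by (simp add: action_def)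
  also have "\<dots> = infsum ?d UNIV + action V y0 \<xi>"
    unfolding action_def by (intro infsum_add d excess_summable assms)
  finally have "action V y0 (\<xi>(j := t)) - action V y0 \<xi> = sum ?d {j - 1, j}"
    using d(2) by simp
  then show "action V y0 (\<xi>(j := t)) - action V y0 \<xi>
      = (V (\<xi> (j - 1)) t + V t (\<xi> (j + 1))) - (V (\<xi> (j - 1)) (\<xi> j) + V (\<xi> j) (\<xi> (j + 1)))"
    by (simp add: excess_def)
qed

lemma locally_minimal_imp_stationary:
  assumes \<xi>: "\<xi> \<in> summable_connections y0"
    and min: "\<And>j. \<forall>\<^sub>F t in nhds (\<xi> j). action V y0 \<xi> \<le> action V y0 (\<xi>(j := t))"
  shows "stationary V \<xi>"
  unfolding stationary_def
proof
  fix j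
  let ?g = "\<lambda>t. V (\<xi> (j - 1)) t + V t (\<xi> (j + 1))"
  have der: "(?g has_real_derivative D2 V (\<xi> (j - 1)) (\<xi> j) + D1 V (\<xi> j) (\<xi> (j + 1))) (at (\<xi> j))"
    by (intro derivative_intros partials)
  from min[of j] obtain d where d: "d > 0" "\<And>t. dist t (\<xi> j) < d \<Longrightarrow> action V y0 \<xi> \<le> action V y0 (\<xi>(j := t))"
    unfolding eventually_nhds_metric by blast
  have "\<forall>t. \<bar>\<xi> j - t\<bar> < d \<longrightarrow> ?g (\<xi> j) \<le> ?g t"
  proof (intro allI impI)
    fix t assume "\<bar>\<xi> j - t\<bar> < d"
    then have "action V y0 \<xi> \<le> action V y0 (\<xi>(j := t))"
      by (intro d(2)) (simp add: dist_real_def abs_minus_commute)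
    with action_update(2)[OF \<xi>, of j t] show "?g (\<xi> j) \<le> ?g t" by linarith
  qed
  from DERIV_local_min[OF der d(1) this]
  show "D2 V (\<xi> (j - 1)) (\<xi> j) + D1 V (\<xi> j) (\<xi> (j + 1)) = 0" .
qed

end

section \<open>Energies of stationary connections\<close>

text \<open>Compare \<open>a\<close> with \<open>\<theta>\<^sup>j a\<^sub>0\<close>, which is a supersolution since \<open>\<theta> / 2 (1 + \<theta>\<^sup>2) \<le> \<theta>\<close>. The difference
  vanishes at \<open>0\<close> and has limit at most \<open>0\<close>, so a positive value would force a positive interior
  maximum, which the factor \<open>\<theta> < 1\<close> forbids.\<close>

lemma discrete_maximum_principle_decay:
  fixes a :: "nat \<Rightarrow> real"
  assumes \<theta>: "0 \<le> \<theta>" "\<theta> < 1"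
    and rec: "\<And>j. a (Suc j) \<le> \<theta> / 2 * (a j + a (Suc (Suc j)))"
    and nonneg: "\<And>j. 0 \<le> a j" and lim: "a \<longlonglongrightarrow> 0"
  shows "a i \<le> \<theta> ^ i * a 0"
proof (rule ccontr)
  define b where "b j = a j - \<theta> ^ j * a 0" for j
  assume "\<not> ?thesis"
  then have i: "b i > 0" by (simp add: b_def)
  have b_le: "b j \<le> a j" for j using nonneg[of 0] \<theta> by (simp add: b_def)
  have b_rec: "b (Suc j) \<le> \<theta> / 2 * (b j + b (Suc (Suc j)))" for j
  proof -
    have "\<theta> ^ Suc (Suc j) \<le> \<theta> ^ j"
      using \<theta> by (intro power_decreasing) auto
    then have "\<theta> / 2 * ((\<theta> ^ j + \<theta> ^ Suc (Suc j)) * a 0) \<le> \<theta> / 2 * ((2 * \<theta> ^ j) * a 0)"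
      using \<theta> nonneg[of 0] by (intro mult_left_mono mult_right_mono) auto
    also have "\<dots> = \<theta> ^ Suc j * a 0" by simp
    finally have "\<theta> / 2 * ((\<theta> ^ j + \<theta> ^ Suc (Suc j)) * a 0) \<le> \<theta> ^ Suc j * a 0" .
    moreover have "\<theta> / 2 * (b j + b (Suc (Suc j))) =
        \<theta> / 2 * (a j + a (Suc (Suc j))) - \<theta> / 2 * ((\<theta> ^ j + \<theta> ^ Suc (Suc j)) * a 0)"
      unfolding b_def by (simp only: algebra_simps)
    ultimately show ?thesis using rec[of j] unfolding b_def[of "Suc j"] by linarith
  qed
  obtain n0 where n0: "\<And>n. n \<ge> n0 \<Longrightarrow> a n < b i"
    using LIMSEQ_D[OF lim i] by (auto simp: abs_less_iff)
  define X where "X = b ` {..n0 + i}"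
  have X: "finite X" "X \<noteq> {}" by (auto simp: X_def)
  obtain k where k: "b k = Max X"
  proof -
    have "Max X \<in> b ` {..n0 + i}" using Max_in[OF X] by (simp only: X_def)
    then show ?thesis using that by force
  qed
  have "b i \<in> X" by (auto simp: X_def)
  then have pos: "0 < Max X" using Max_ge[OF X(1), of "b i"] i by simp
  have ub: "b n \<le> Max X" for n
  proof (cases "n \<le> n0 + i")
    case True then show ?thesis using X by (intro Max_ge) (auto simp: X_def)
  next
    case False
    then have "b n < b i" using n0[of n] b_le[of n] by simp
    also have "b i \<le> Max X" using X by (intro Max_ge) (auto simp: X_def)
    finally show ?thesis by simp
  qed
  have "b 0 = 0" by (simp add: b_def)
  then have "k \<noteq> 0" using pos k by (intro notI) simp
  then obtain j where j: "k = Suc j" using not0_implies_Suc by blast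
  have "Max X \<le> \<theta> / 2 * (b j + b (Suc (Suc j)))" using b_rec[of j] k j by simp
  also have "\<dots> \<le> \<theta> / 2 * (Max X + Max X)"
    using \<theta> by (intro mult_left_mono add_mono ub) auto
  also have "\<dots> = \<theta> * Max X" by simp
  also have "\<dots> < 1 * Max X" using \<theta> pos by (intro mult_strict_right_mono) auto
  finally show False by simp
qed

text \<open>Pigeonhole: among \<open>n + 1\<close> equally spaced values two have parameters within \<open>O(1/n)\<close>, so they would
  be within \<open>O(1/n\<^sup>2)\<close> of each other, although their spacing is at least \<open>d / n\<close>.\<close>

lemma quadratic_image_no_interval:
  fixes \<phi> s :: "'a \<Rightarrow> real"
  assumes quad: "\<And>x y. x \<in> K \<Longrightarrow> y \<in> K \<Longrightarrow> \<bar>\<phi> y - \<phi> x\<bar> \<le> Q * (s y - s x)\<^sup>2"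
    and bd: "\<And>x. x \<in> K \<Longrightarrow> \<bar>s x - s0\<bar> \<le> R"
    and d: "0 < d"
  shows "\<exists>e\<in>{c..c + d}. e \<notin> \<phi> ` K"
proof (rule ccontr)
  assume "\<not> ?thesis"
  then have "\<forall>e\<in>{c..c + d}. \<exists>x\<in>K. \<phi> x = e" by auto
  then obtain g where g: "\<And>e. e \<in> {c..c + d} \<Longrightarrow> g e \<in> K \<and> \<phi> (g e) = e" by metis
  \<comment> \<open>A length strictly larger than the parameter range, so that the index of a box stays strictly below \<open>n\<close>.\<close>
  define W where "W = 2 * \<bar>R\<bar> + 1"
  obtain n :: nat where n: "real n > \<bar>Q\<bar> * W\<^sup>2 / d" "n > 0"
  proof -
    obtain n :: nat where "real n > \<bar>Q\<bar> * W\<^sup>2 / d" using reals_Archimedean2 by blast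
    then show ?thesis using that[of "Suc n"] by simp
  qed
  define h where "h i = c + d * (real i / real n)" for i :: nat
  have h: "h i \<in> {c..c + d}" if "i \<le> n" for i
    using that d n(2) by (auto simp: h_def divide_le_eq)
  define x where "x i = g (h i)" for i
  have x: "x i \<in> K" "\<phi> (x i) = h i" if "i \<le> n" for i
    using g[OF h[OF that]] by (auto simp: x_def)
  define f where "f i = nat \<lfloor>(s (x i) - s0 + \<bar>R\<bar>) * real n / W\<rfloor>" for i
  have Wpos: "W > 0" by (simp add: W_def)
  have fval: "0 \<le> (s (x i) - s0 + \<bar>R\<bar>) * real n / W" "(s (x i) - s0 + \<bar>R\<bar>) * real n / W < real n"
    if "i \<le> n" for i
  proof -
    have b: "\<bar>s (x i) - s0\<bar> \<le> R" using bd[OF x(1)[OF that]] .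
    then show "0 \<le> (s (x i) - s0 + \<bar>R\<bar>) * real n / W" using Wpos by auto
    have "(s (x i) - s0 + \<bar>R\<bar>) * real n < W * real n"
      using b n(2) by (intro mult_strict_right_mono) (auto simp: W_def)
    then show "(s (x i) - s0 + \<bar>R\<bar>) * real n / W < real n"
      using Wpos by (simp add: divide_less_eq mult.commute)
  qed
  have "f ` {..n} \<subseteq> {..<n}"
  proof clarsimp
    fix i assume "i \<le> n"
    from fval[OF this] show "f i < n" unfolding f_def by linarith
  qed
  then have "card (f ` {..n}) \<le> n" using card_mono[of "{..<n}"] by fastforce
  then have "\<not> inj_on f {..n}" using card_image[of f "{..n}"] by auto
  then obtain i j where ij: "i \<le> n" "j \<le> n" "i \<noteq> j" "f i = f j" by (auto simp: inj_on_def)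
  have "\<bar>(s (x i) - s0 + \<bar>R\<bar>) * real n / W - (s (x j) - s0 + \<bar>R\<bar>) * real n / W\<bar> \<le> 1"
    using ij(4) fval(1)[OF ij(1)] fval(1)[OF ij(2)] unfolding f_def by linarith
  also have "(s (x i) - s0 + \<bar>R\<bar>) * real n / W - (s (x j) - s0 + \<bar>R\<bar>) * real n / W
      = (s (x i) - s (x j)) * (real n / W)"
    by (simp add: diff_divide_distrib[symmetric] left_diff_distrib[symmetric])
  finally have "\<bar>s (x i) - s (x j)\<bar> * (real n / W) \<le> 1"
    using Wpos by (simp add: abs_mult)
  then have "\<bar>s (x i) - s (x j)\<bar> \<le> W / real n"
    using Wpos n(2) by (simp add: field_simps)
  then have "\<bar>s (x i) - s (x j)\<bar>\<^sup>2 \<le> (W / real n)\<^sup>2" by (intro power_mono) auto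
  then have sq: "(s (x i) - s (x j))\<^sup>2 \<le> (W / real n)\<^sup>2" by simp
  have "1 \<le> \<bar>real i - real j\<bar>" using ij(3) by linarith
  then have "d / real n \<le> d * \<bar>real i - real j\<bar> / real n"
    using d n(2) by (intro divide_right_mono) auto
  also have "\<dots> = \<bar>\<phi> (x i) - \<phi> (x j)\<bar>"
  proof -
    have "\<phi> (x i) - \<phi> (x j) = d * (real i - real j) / real n"
      using x(2)[OF ij(1)] x(2)[OF ij(2)] by (simp add: h_def diff_divide_distrib algebra_simps)
    then show ?thesis using d by (simp add: abs_mult)
  qed
  also have "\<dots> \<le> Q * (s (x i) - s (x j))\<^sup>2" by (rule quad) (use x ij in auto)
  also have "\<dots> \<le> \<bar>Q\<bar> * (W / real n)\<^sup>2"
    by (intro mult_mono sq) auto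
  finally have "d / real n \<le> \<bar>Q\<bar> * W\<^sup>2 / (real n * real n)"
    by (simp add: power_divide power2_eq_square)
  then have "d * real n \<le> \<bar>Q\<bar> * W\<^sup>2"
    using n(2) by (simp add: field_simps)
  moreover have "\<bar>Q\<bar> * W\<^sup>2 < d * real n" using n(1) d by (simp add: divide_less_eq mult.commute)
  ultimately show False by simp
qed

definition confined :: "real \<Rightarrow> (int \<Rightarrow> real) \<Rightarrow> (int \<Rightarrow> real) set" where
  "confined y0 v = {\<xi>. \<forall>k. \<bar>\<xi> k - step_profile y0 k\<bar> \<le> v k}"

text \<open>The extra assumption says that \<open>x \<mapsto> V(x, x)\<close> has positive second derivative at \<open>y0\<close>. Together with
  \<open>V\<^sub>1\<^sub>2 < 0\<close> it makes the linearised recurrence at the fixed point diagonally dominant, which is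
  hyperbolicity with positive eigenvalues.\<close>

locale hyperbolic_generating = twist_generating +
  fixes y0 :: real
  assumes hyperbolic: "0 < D1 (D1 V) y0 y0 + 2 * D2 (D1 V) y0 y0 + D2 (D2 V) y0 y0"
begin

text \<open>Subtracting the two stationarity equations gives \<open>b w\<^sub>0 = - a w\<^sub>- - a' w\<^sub>+\<close> with \<open>b\<close> near
  \<open>V\<^sub>1\<^sub>1 + V\<^sub>2\<^sub>2\<close> and \<open>a, a'\<close> near \<open>V\<^sub>1\<^sub>2\<close>, where \<open>V\<^sub>1\<^sub>1 + V\<^sub>2\<^sub>2 > 2 \<bar>V\<^sub>1\<^sub>2\<bar>\<close>. By continuity the strict
  inequality persists in a neighbourhood of the fixed point.\<close>

lemma hyperbolic_contraction:
  obtains r \<theta> where "0 < r" "0 < \<theta>" "\<theta> < 1"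
    "\<And>p q s p' q' s'. \<lbrakk>\<bar>p - y0\<bar> \<le> r; \<bar>q - y0\<bar> \<le> r; \<bar>s - y0\<bar> \<le> r; \<bar>p' - y0\<bar> \<le> r; \<bar>q' - y0\<bar> \<le> r;
        \<bar>s' - y0\<bar> \<le> r; D2 V p q + D1 V q s = 0; D2 V p' q' + D1 V q' s' = 0\<rbrakk>
      \<Longrightarrow> \<bar>q' - q\<bar> \<le> \<theta> / 2 * (\<bar>p' - p\<bar> + \<bar>s' - s\<bar>)"
proof -
  \<comment> \<open>With \<open>\<epsilon> = B / 8\<close> the perturbed dominance \<open>2 (a0 + \<epsilon>) < b0 - 2 \<epsilon>\<close> still holds, since \<open>4 \<epsilon> < B = b0 - 2 a0\<close>.\<close>
  define B a0 b0 \<epsilon> where "B = D1 (D1 V) y0 y0 + 2 * D2 (D1 V) y0 y0 + D2 (D2 V) y0 y0"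
    and "a0 = - D2 (D1 V) y0 y0" and "b0 = D1 (D1 V) y0 y0 + D2 (D2 V) y0 y0" and "\<epsilon> = B / 8"
  have B: "0 < B" "b0 = 2 * a0 + B" "0 < \<epsilon>"
    using hyperbolic by (auto simp: B_def a0_def b0_def \<epsilon>_def)
  have a0: "0 < a0" using twist[of y0 y0] \<delta> by (simp add: a0_def)
  have near: "\<exists>r>0. \<forall>x y. \<bar>x - y0\<bar> \<le> r \<longrightarrow> \<bar>y - y0\<bar> \<le> r \<longrightarrow> \<bar>G x y - G y0 y0\<bar> \<le> \<epsilon>"
    if "continuous_on UNIV (\<lambda>(x, y). G x y)" for G :: "real \<Rightarrow> real \<Rightarrow> real"
  proof -
    have "isCont (\<lambda>(x, y). G x y) (y0, y0)"
      using that continuous_on_eq_continuous_at by blast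
    then obtain d where d: "d > 0"
      "\<And>p. dist p (y0, y0) < d \<Longrightarrow> dist ((\<lambda>(x, y). G x y) p) (G y0 y0) < \<epsilon>"
      using B(3) unfolding continuous_at_eps_delta by (metis case_prod_conv)
    have "\<bar>G x y - G y0 y0\<bar> \<le> \<epsilon>" if "\<bar>x - y0\<bar> \<le> d / 3" "\<bar>y - y0\<bar> \<le> d / 3" for x y
    proof -
      have "dist (x, y) (y0, y0) \<le> dist x y0 + dist y y0"
        by (simp add: dist_Pair_Pair sqrt_sum_squares_le_sum)
      also have "\<dots> < d" using that d(1) by (simp add: dist_real_def)
      finally show ?thesis using d(2)[of "(x, y)"] by (simp add: dist_real_def)
    qed
    then show ?thesis using d(1) by (intro exI[of _ "d / 3"]) auto
  qed
  have c: "continuous_on UNIV (\<lambda>(x, y). D1 (D1 V) x y)" "continuous_on UNIV (\<lambda>(x, y). D2 (D1 V) x y)"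
    "continuous_on UNIV (\<lambda>(x, y). D2 (D2 V) x y)"
    using C1s by (auto simp: C1_plane_def)
  obtain r1 r2 r3 where r:
    "r1 > 0" "\<And>x y. \<bar>x - y0\<bar> \<le> r1 \<Longrightarrow> \<bar>y - y0\<bar> \<le> r1 \<Longrightarrow> \<bar>D1 (D1 V) x y - D1 (D1 V) y0 y0\<bar> \<le> \<epsilon>"
    "r2 > 0" "\<And>x y. \<bar>x - y0\<bar> \<le> r2 \<Longrightarrow> \<bar>y - y0\<bar> \<le> r2 \<Longrightarrow> \<bar>D2 (D1 V) x y - D2 (D1 V) y0 y0\<bar> \<le> \<epsilon>"
    "r3 > 0" "\<And>x y. \<bar>x - y0\<bar> \<le> r3 \<Longrightarrow> \<bar>y - y0\<bar> \<le> r3 \<Longrightarrow> \<bar>D2 (D2 V) x y - D2 (D2 V) y0 y0\<bar> \<le> \<epsilon>"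
    using near[OF c(1)] near[OF c(2)] near[OF c(3)] by blast
  define r where "r = min r1 (min r2 r3)"
  have near_r: "\<bar>D1 (D1 V) x y - D1 (D1 V) y0 y0\<bar> \<le> \<epsilon>"
    "\<bar>D2 (D1 V) x y - D2 (D1 V) y0 y0\<bar> \<le> \<epsilon>" "\<bar>D2 (D2 V) x y - D2 (D2 V) y0 y0\<bar> \<le> \<epsilon>"
    if "\<bar>x - y0\<bar> \<le> r" "\<bar>y - y0\<bar> \<le> r" for x y
    using r(2)[of x y] r(4)[of x y] r(6)[of x y] that by (simp_all add: r_def)
  have seg: "\<bar>c - y0\<bar> \<le> r" if "c \<in> closed_segment a b" "\<bar>a - y0\<bar> \<le> r" "\<bar>b - y0\<bar> \<le> r" for a b c
  proof -
    have "closed_segment a b \<subseteq> cball y0 r"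
      using that(2,3) by (intro closed_segment_subset) (simp_all add: dist_real_def abs_minus_commute)
    then have "c \<in> cball y0 r" using that(1) by blast
    then show ?thesis by (simp add: dist_real_def abs_minus_commute)
  qed
  define \<theta> where "\<theta> = 2 * (a0 + \<epsilon>) / (b0 - 2 * \<epsilon>)"
  have den: "0 < b0 - 2 * \<epsilon>" "2 * (a0 + \<epsilon>) < b0 - 2 * \<epsilon>" using B a0 by (auto simp: \<epsilon>_def)
  have "0 < r" using r by (simp add: r_def)
  moreover have "0 < \<theta>" "\<theta> < 1" using den a0 B(3) by (auto simp: \<theta>_def)
  moreover have "\<bar>q' - q\<bar> \<le> \<theta> / 2 * (\<bar>p' - p\<bar> + \<bar>s' - s\<bar>)"
    if "\<bar>p - y0\<bar> \<le> r" "\<bar>q - y0\<bar> \<le> r" "\<bar>s - y0\<bar> \<le> r" "\<bar>p' - y0\<bar> \<le> r" "\<bar>q' - y0\<bar> \<le> r"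
        "\<bar>s' - y0\<bar> \<le> r" "D2 V p q + D1 V q s = 0" "D2 V p' q' + D1 V q' s' = 0" for p q s p' q' s'
  proof -
    obtain c1 c2 c3 c4 where
      c1: "c1 \<in> closed_segment p p'" "D2 V p' q' - D2 V p q' = D2 (D1 V) c1 q' * (p' - p)" and
      c2: "c2 \<in> closed_segment q q'" "D2 V p q' - D2 V p q = D2 (D2 V) p c2 * (q' - q)" and
      c3: "c3 \<in> closed_segment q q'" "D1 V q' s' - D1 V q s' = D1 (D1 V) c3 s' * (q' - q)" and
      c4: "c4 \<in> closed_segment s s'" "D1 V q s' - D1 V q s = D2 (D1 V) q c4 * (s' - s)"
      using D_increment(3)[of p p' q'] D_increment(4)[of q q' p] D_increment(1)[of q q' s']
        D_increment(2)[of s s' q] by blast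
    note c_near = seg[OF c1(1) that(1,4)] seg[OF c2(1) that(2,5)] seg[OF c3(1) that(2,5)]
      seg[OF c4(1) that(3,6)]
    have "\<bar>D2 (D1 V) c1 q' + a0\<bar> \<le> \<epsilon>" "\<bar>D2 (D1 V) q c4 + a0\<bar> \<le> \<epsilon>"
      "\<bar>D2 (D2 V) p c2 - D2 (D2 V) y0 y0\<bar> \<le> \<epsilon>" "\<bar>D1 (D1 V) c3 s' - D1 (D1 V) y0 y0\<bar> \<le> \<epsilon>"
      using near_r(1)[OF c_near(3) that(6)] near_r(2)[OF c_near(1) that(5)]
        near_r(2)[OF that(2) c_near(4)] near_r(3)[OF that(1) c_near(2)]
      by (simp_all add: a0_def)
    then have d: "\<bar>D2 (D1 V) c1 q'\<bar> \<le> a0 + \<epsilon>" "\<bar>D2 (D1 V) q c4\<bar> \<le> a0 + \<epsilon>"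
      "b0 - 2 * \<epsilon> \<le> D2 (D2 V) p c2 + D1 (D1 V) c3 s'"
      using a0 unfolding b0_def by linarith+
    have eq: "(D2 (D2 V) p c2 + D1 (D1 V) c3 s') * (q' - q) =
        - (D2 (D1 V) c1 q' * (p' - p)) - D2 (D1 V) q c4 * (s' - s)"
      using c1(2) c2(2) c3(2) c4(2) that(7,8) by (simp add: distrib_right)
    have "(b0 - 2 * \<epsilon>) * \<bar>q' - q\<bar> \<le> (D2 (D2 V) p c2 + D1 (D1 V) c3 s') * \<bar>q' - q\<bar>"
      using d(3) by (intro mult_right_mono) auto
    also have "\<dots> = \<bar>(D2 (D2 V) p c2 + D1 (D1 V) c3 s') * (q' - q)\<bar>"
      using d(3) den(1) by (simp add: abs_mult)
    also have "\<dots> \<le> \<bar>D2 (D1 V) c1 q' * (p' - p)\<bar> + \<bar>D2 (D1 V) q c4 * (s' - s)\<bar>"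
      unfolding eq by linarith
    also have "\<dots> \<le> (a0 + \<epsilon>) * \<bar>p' - p\<bar> + (a0 + \<epsilon>) * \<bar>s' - s\<bar>"
      unfolding abs_mult by (intro add_mono mult_right_mono d) auto
    finally have "\<bar>q' - q\<bar> \<le> ((a0 + \<epsilon>) * \<bar>p' - p\<bar> + (a0 + \<epsilon>) * \<bar>s' - s\<bar>) / (b0 - 2 * \<epsilon>)"
      using den(1) by (simp add: le_divide_eq mult.commute)
    also have "\<dots> = \<theta> / 2 * (\<bar>p' - p\<bar> + \<bar>s' - s\<bar>)"
    proof -
      have "2 * x / y / 2 = x / y" for x y :: real by simp
      then have "\<theta> / 2 = (a0 + \<epsilon>) / (b0 - 2 * \<epsilon>)" unfolding \<theta>_def .
      moreover have "(x * a + x * b) / y = x / y * (a + b)" for x y a b :: real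
        by (simp add: distrib_left add_divide_distrib)
      ultimately show ?thesis by metis
    qed
    finally show ?thesis .
  qed
  ultimately show ?thesis using that by blast
qed

text \<open>By the twist condition the next entry depends on the two previous ones in a Lipschitz way.\<close>

lemma stationary_forward_Lipschitz:
  assumes "stationary V \<xi>" "stationary V \<eta>"
  shows "\<bar>\<eta> (k + 1) - \<xi> (k + 1)\<bar> \<le> 3 * M / \<delta> * max \<bar>\<eta> k - \<xi> k\<bar> \<bar>\<eta> (k - 1) - \<xi> (k - 1)\<bar>"
proof -
  let ?m = "max \<bar>\<eta> k - \<xi> k\<bar> \<bar>\<eta> (k - 1) - \<xi> (k - 1)\<bar>"
  have st: "D2 V (\<xi> (k - 1)) (\<xi> k) + D1 V (\<xi> k) (\<xi> (k + 1)) = 0"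
    "D2 V (\<eta> (k - 1)) (\<eta> k) + D1 V (\<eta> k) (\<eta> (k + 1)) = 0"
    using assms by (auto simp: stationary_def)
  have "\<delta> * \<bar>\<eta> (k + 1) - \<xi> (k + 1)\<bar> \<le> \<bar>D1 V (\<eta> k) (\<eta> (k + 1)) - D1 V (\<eta> k) (\<xi> (k + 1))\<bar>"
    by (rule D_expanding)
  also have "\<dots> \<le> \<bar>D1 V (\<eta> k) (\<xi> (k + 1)) - D1 V (\<xi> k) (\<xi> (k + 1))\<bar>
      + \<bar>D2 V (\<eta> (k - 1)) (\<eta> k) - D2 V (\<xi> (k - 1)) (\<xi> k)\<bar>"
    using st by linarith
  also have "\<dots> \<le> M * (\<bar>\<eta> k - \<xi> k\<bar> + \<bar>\<xi> (k + 1) - \<xi> (k + 1)\<bar>)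
      + M * (\<bar>\<eta> (k - 1) - \<xi> (k - 1)\<bar> + \<bar>\<eta> k - \<xi> k\<bar>)"
    by (intro add_mono D_Lipschitz)
  also have "\<dots> = M * (\<bar>\<eta> k - \<xi> k\<bar> + \<bar>\<eta> (k - 1) - \<xi> (k - 1)\<bar> + \<bar>\<eta> k - \<xi> k\<bar>)"
    by (simp add: algebra_simps)
  also have "\<dots> \<le> M * (3 * ?m)"
  proof (rule mult_left_mono)
    have "\<bar>\<eta> k - \<xi> k\<bar> \<le> ?m" "\<bar>\<eta> (k - 1) - \<xi> (k - 1)\<bar> \<le> ?m" by simp_all
    then show "\<bar>\<eta> k - \<xi> k\<bar> + \<bar>\<eta> (k - 1) - \<xi> (k - 1)\<bar> + \<bar>\<eta> k - \<xi> k\<bar> \<le> 3 * ?m" by linarith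
  qed (use M_ge in simp)
  finally show ?thesis using \<delta> by (simp add: field_simps)
qed

text \<open>Homoclinic orbits inside a summable envelope form a one-parameter family, parametrised by the
  entry at index \<open>m\<close>, chosen so far to the left that every orbit in the envelope is near the fixed
  point for indices up to \<open>m\<close>, and near its translate from \<open>-m\<close> on. The contraction controls both
  ends, and the Lipschitz step carries the estimate across the middle.\<close>

lemma stationary_difference_decay:
  assumes v: "v summable_on UNIV" "\<And>k. 0 \<le> v k"
  obtains m :: int and D \<theta> :: real where "0 \<le> D" "0 < \<theta>" "\<theta> < 1"
    "\<And>\<xi> \<eta> k. \<lbrakk>\<xi> \<in> confined y0 v; \<eta> \<in> confined y0 v; stationary V \<xi>; stationary V \<eta>\<rbrakk>
      \<Longrightarrow> \<bar>\<eta> k - \<xi> k\<bar> \<le> D * \<theta> ^ nat \<bar>k\<bar> * \<bar>\<eta> m - \<xi> m\<bar>"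
proof -
  obtain r \<theta> where r: "0 < r" "0 < \<theta>" "\<theta> < 1"
    "\<And>p q s p' q' s'. \<lbrakk>\<bar>p - y0\<bar> \<le> r; \<bar>q - y0\<bar> \<le> r; \<bar>s - y0\<bar> \<le> r; \<bar>p' - y0\<bar> \<le> r; \<bar>q' - y0\<bar> \<le> r;
        \<bar>s' - y0\<bar> \<le> r; D2 V p q + D1 V q s = 0; D2 V p' q' + D1 V q' s' = 0\<rbrakk>
      \<Longrightarrow> \<bar>q' - q\<bar> \<le> \<theta> / 2 * (\<bar>p' - p\<bar> + \<bar>s' - s\<bar>)"
    using hyperbolic_contraction by blast
  note v0 = summable_on_int_tendsto_0[OF v(1)]
  have "\<forall>\<^sub>F k in at_top. v k < r" "\<forall>\<^sub>F k in at_bot. v k < r"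
    using order_tendstoD(2)[OF v0(1) r(1)] order_tendstoD(2)[OF v0(2) r(1)] by auto
  then obtain m1 m2 where m12: "\<And>k. k \<ge> m1 \<Longrightarrow> v k < r" "\<And>k. k \<le> m2 \<Longrightarrow> v k < r"
    unfolding eventually_at_top_linorder eventually_at_bot_linorder by blast
  define m where "m = nat (max 1 (max m1 (- m2)))"
  have m: "m \<ge> 1" "\<And>k. k \<ge> int m \<Longrightarrow> v k \<le> r" "\<And>k. k \<le> - int m \<Longrightarrow> v k \<le> r"
  proof -
    have "int m = max 1 (max m1 (- m2))" by (simp add: m_def)
    then have i: "int m \<ge> 1" "int m \<ge> m1" "- int m \<le> m2" by linarith+
    from i(1) show "m \<ge> 1" by simp
    show "v k \<le> r" if "k \<ge> int m" for k using m12(1)[of k] that i by linarith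
    show "v k \<le> r" if "k \<le> - int m" for k using m12(2)[of k] that i by linarith
  qed
  define Kc where "Kc = max 1 (3 * M / \<delta>)"
  define D where "D = Kc ^ (2 * m) / \<theta> ^ m"
  have Kc: "1 \<le> Kc" "3 * M / \<delta> \<le> Kc" by (auto simp: Kc_def)
  have D: "0 \<le> D" using Kc r(2) by (simp add: D_def)
  have "\<bar>\<eta> k - \<xi> k\<bar> \<le> D * \<theta> ^ nat \<bar>k\<bar> * \<bar>\<eta> (- int m) - \<xi> (- int m)\<bar>"
    if conf: "\<xi> \<in> confined y0 v" "\<eta> \<in> confined y0 v" and st: "stationary V \<xi>" "stationary V \<eta>" for \<xi> \<eta> k
  proof -
    define w where "w k = \<bar>\<eta> k - \<xi> k\<bar>" for k
    let ?s = "w (- int m)"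
    have w0: "0 \<le> w k" for k by (simp add: w_def)
    have w2v: "w k \<le> 2 * v k" for k
    proof -
      have "\<bar>\<xi> k - step_profile y0 k\<bar> \<le> v k" "\<bar>\<eta> k - step_profile y0 k\<bar> \<le> v k"
        using conf by (auto simp: confined_def)
      then show ?thesis unfolding w_def by linarith
    qed
    have lim: "(w \<longlongrightarrow> 0) at_top" "(w \<longlongrightarrow> 0) at_bot"
      by (rule tendsto_sandwich[OF _ _ tendsto_const, where h = "\<lambda>k. 2 * v k"];
          use w0 w2v v0 in \<open>auto intro!: tendsto_mult_right_zero\<close>)+
    have eqs: "D2 V (\<xi> (k - 1)) (\<xi> k) + D1 V (\<xi> k) (\<xi> (k + 1)) = 0"
      "D2 V (\<eta> (k - 1)) (\<eta> k) + D1 V (\<eta> k) (\<eta> (k + 1)) = 0" for k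
      using st by (auto simp: stationary_def)
    have near: "\<bar>\<xi> k - step_profile y0 k\<bar> \<le> v k" "\<bar>\<eta> k - step_profile y0 k\<bar> \<le> v k" for k
      using conf by (auto simp: confined_def)
    have left: "\<bar>\<xi> k - y0\<bar> \<le> r" "\<bar>\<eta> k - y0\<bar> \<le> r" if "k \<le> - int m" for k
      using near[of k] m(3)[OF that] that m(1) by (auto simp: step_profile_def)
    have right: "\<bar>\<xi> k - 1 - y0\<bar> \<le> r" "\<bar>\<eta> k - 1 - y0\<bar> \<le> r" if "k \<ge> int m" for k
      using near[of k] m(2)[OF that] that m(1) by (auto simp: step_profile_def algebra_simps)
    have recL: "w k \<le> \<theta> / 2 * (w (k - 1) + w (k + 1))" if "k + 1 \<le> - int m" for k
      unfolding w_def by (rule r(4)) (use left[of k] left[of "k - 1"] left[of "k + 1"] that eqs in auto)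
    have recR: "w k \<le> \<theta> / 2 * (w (k - 1) + w (k + 1))" if "k - 1 \<ge> int m" for k
    proof -
      have per: "D1 V (a - 1) (b - 1) = D1 V a b" "D2 V (a - 1) (b - 1) = D2 V a b" for a b
        using D_periodic[of "a - 1" "b - 1"] by simp_all
      have "\<bar>(\<eta> k - 1) - (\<xi> k - 1)\<bar> \<le> \<theta> / 2 *
          (\<bar>(\<eta> (k - 1) - 1) - (\<xi> (k - 1) - 1)\<bar> + \<bar>(\<eta> (k + 1) - 1) - (\<xi> (k + 1) - 1)\<bar>)"
        by (rule r(4))
          (use right[of k] right[of "k - 1"] right[of "k + 1"] that eqs in \<open>auto simp: per\<close>)
      then show ?thesis by (simp add: w_def)
    qed
    have decL: "w (- int m - int j) \<le> \<theta> ^ j * ?s" for j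
    proof -
      have fl: "filterlim (\<lambda>j. - int m - int j) at_bot sequentially"
        unfolding filterlim_at_bot eventually_sequentially
      proof
        show "\<exists>N. \<forall>n\<ge>N. - int m - int n \<le> Z" for Z
          by (rule exI[of _ "nat \<bar>Z\<bar>"]) linarith
      qed
      have "w (- int m - int j) \<le> \<theta> ^ j * w (- int m - int 0)"
      proof (rule discrete_maximum_principle_decay[where a = "\<lambda>j. w (- int m - int j)"])
        show "w (- int m - int (Suc j)) \<le> \<theta> / 2 * (w (- int m - int j) + w (- int m - int (Suc (Suc j))))" for j
        proof -
          have "- int m - int (Suc j) - 1 = - int m - int (Suc (Suc j))"
            "- int m - int (Suc j) + 1 = - int m - int j" by simp_all
          then show ?thesis
            using recL[of "- int m - int (Suc j)"] by (simp only: add.commute[of "w (- int m - int j)"])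
        qed
        show "(\<lambda>j. w (- int m - int j)) \<longlonglongrightarrow> 0" by (rule filterlim_compose[OF lim(2) fl])
      qed (use r w0 in auto)
      then show ?thesis by simp
    qed
    have decR: "w (int m + int j) \<le> \<theta> ^ j * w (int m)" for j
    proof -
      have fl: "filterlim (\<lambda>j. int m + int j) at_top sequentially"
        unfolding filterlim_at_top eventually_sequentially
      proof
        show "\<exists>N. \<forall>n\<ge>N. Z \<le> int m + int n" for Z
          by (rule exI[of _ "nat \<bar>Z\<bar>"]) linarith
      qed
      have "w (int m + int j) \<le> \<theta> ^ j * w (int m + int 0)"
      proof (rule discrete_maximum_principle_decay[where a = "\<lambda>j. w (int m + int j)"])
        show "w (int m + int (Suc j)) \<le> \<theta> / 2 * (w (int m + int j) + w (int m + int (Suc (Suc j))))" for j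
          using recR[of "int m + int (Suc j)"] by (simp add: algebra_simps)
        show "(\<lambda>j. w (int m + int j)) \<longlonglongrightarrow> 0" by (rule filterlim_compose[OF lim(1) fl])
      qed (use r w0 in auto)
      then show ?thesis by simp
    qed
    \<comment> \<open>Two consecutive entries are propagated together, as the recurrence has order two.\<close>
    have mid: "w (- int m + int i) \<le> Kc ^ i * ?s \<and> w (- int m + int i - 1) \<le> Kc ^ i * ?s" for i
    proof (induction i)
      case 0
      have "\<theta> * ?s \<le> 1 * ?s" using r w0 by (intro mult_right_mono) auto
      then show ?case using decL[of 1] by simp
    next
      case (Suc i)
      let ?k = "- int m + int i"
      have "w (?k + 1) \<le> 3 * M / \<delta> * max (w ?k) (w (?k - 1))"
        unfolding w_def by (rule stationary_forward_Lipschitz[OF st])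
      also have "\<dots> \<le> Kc * (Kc ^ i * ?s)"
        using Suc Kc w0 M_ge \<delta> by (intro mult_mono) (auto simp: max_def)
      finally have "w (?k + 1) \<le> Kc ^ Suc i * ?s" by (simp add: mult.assoc)
      moreover have "w ?k \<le> Kc ^ Suc i * ?s"
      proof -
        have "1 * (Kc ^ i * ?s) \<le> Kc * (Kc ^ i * ?s)"
          using Kc w0 by (intro mult_right_mono) auto
        then show ?thesis using Suc by (simp add: mult.assoc)
      qed
      ultimately show ?case by (simp add: algebra_simps)
    qed
    have Km: "1 \<le> Kc ^ (2 * m)" by (rule one_le_power[OF Kc(1)])
    have "w k \<le> D * \<theta> ^ nat \<bar>k\<bar> * ?s"
    proof -
      consider "k \<le> - int m" | "k \<ge> int m" | "- int m < k" "k < int m" by linarith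
      then show ?thesis
      proof cases
        case 1
        define j where "j = nat (- int m - k)"
        have j: "k = - int m - int j" "nat \<bar>k\<bar> = m + j" using 1 by (auto simp: j_def)
        have "w k \<le> 1 * (\<theta> ^ j * ?s)" using decL[of j] j(1) by simp
        also have "\<dots> \<le> Kc ^ (2 * m) * (\<theta> ^ j * ?s)"
          using Km r w0 by (intro mult_right_mono) auto
        also have "\<dots> = D * \<theta> ^ nat \<bar>k\<bar> * ?s" using r by (simp add: j(2) D_def power_add)
        finally show ?thesis .
      next
        case 2
        define j where "j = nat (k - int m)"
        have j: "k = int m + int j" "nat \<bar>k\<bar> = m + j" using 2 by (auto simp: j_def)
        have "w (int m) \<le> Kc ^ (2 * m) * ?s" using mid[of "2 * m"] by simp
        then have "\<theta> ^ j * w (int m) \<le> \<theta> ^ j * (Kc ^ (2 * m) * ?s)"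
          using r by (intro mult_left_mono) auto
        then have "w k \<le> \<theta> ^ j * (Kc ^ (2 * m) * ?s)" using decR[of j] j(1) by simp
        also have "\<dots> = D * \<theta> ^ nat \<bar>k\<bar> * ?s" using r by (simp add: j(2) D_def power_add)
        finally show ?thesis .
      next
        case 3
        define i where "i = nat (k + int m)"
        have i: "k = - int m + int i" "i \<le> 2 * m" using 3 by (auto simp: i_def)
        have "w k \<le> Kc ^ i * ?s" using mid[of i] i(1) by simp
        also have "\<dots> \<le> Kc ^ (2 * m) * ?s"
          using Kc i w0 by (intro mult_right_mono power_increasing) auto
        also have "\<dots> = D * \<theta> ^ m * ?s" using r by (simp add: D_def)
        also have "\<dots> \<le> D * \<theta> ^ nat \<bar>k\<bar> * ?s"
          using D r w0 3 by (intro mult_right_mono mult_left_mono power_decreasing) auto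
        finally show ?thesis .
      qed
    qed
    then show ?thesis by (simp add: w_def)
  qed
  then show ?thesis using that[of D \<theta> "- int m"] D r by blast
qed

text \<open>The first-order terms of the difference of actions telescope because \<open>\<xi>\<close> is stationary. What
  remains is the Taylor remainder, bounded by \<open>\<Sum>\<^sub>k (\<eta>\<^sub>k - \<xi>\<^sub>k)\<^sup>2\<close> and hence, by the decay, by the square of the
  difference at index \<open>m\<close>.\<close>

lemma stationary_action_difference:
  assumes v: "v summable_on UNIV" "\<And>k. 0 \<le> v k"
  obtains Q m where
    "\<And>\<xi> \<eta>. \<lbrakk>\<xi> \<in> confined y0 v; \<eta> \<in> confined y0 v; stationary V \<xi>; stationary V \<eta>\<rbrakk>
      \<Longrightarrow> \<bar>action V y0 \<eta> - action V y0 \<xi>\<bar> \<le> Q * (\<eta> m - \<xi> m)\<^sup>2"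
proof -
  obtain m D \<theta> where D: "0 \<le> D" "0 < \<theta>" "\<theta> < 1"
    "\<And>\<xi> \<eta> k. \<lbrakk>\<xi> \<in> confined y0 v; \<eta> \<in> confined y0 v; stationary V \<xi>; stationary V \<eta>\<rbrakk>
      \<Longrightarrow> \<bar>\<eta> k - \<xi> k\<bar> \<le> D * \<theta> ^ nat \<bar>k\<bar> * \<bar>\<eta> m - \<xi> m\<bar>"
    using stationary_difference_decay[OF v] by metis
  define t where "t k = \<theta> ^ nat \<bar>k\<bar>" for k :: int
  have t: "t summable_on UNIV" "\<And>k. 0 \<le> t k" "\<And>k. t k \<le> 1"
    using summable_on_int_geometric[of \<theta>] D unfolding t_def[abs_def] by (auto simp: power_le_one)
  have t2: "(\<lambda>k. t k + t (k + 1)) summable_on UNIV"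
    by (intro summable_on_add t summable_on_int_shift)
  define G where "G = (\<Sum>\<^sub>\<infinity>k. t k + t (k + 1))"
  define Q where "Q = 2 * M * D\<^sup>2 * G"
  have "\<bar>action V y0 \<eta> - action V y0 \<xi>\<bar> \<le> Q * (\<eta> m - \<xi> m)\<^sup>2"
    if conf: "\<xi> \<in> confined y0 v" "\<eta> \<in> confined y0 v" and st: "stationary V \<xi>" "stationary V \<eta>" for \<xi> \<eta>
  proof -
    define s where "s = \<bar>\<eta> m - \<xi> m\<bar>"
    define w where "w k = \<eta> k - \<xi> k" for k
    have s0: "0 \<le> s" by (simp add: s_def)
    have w: "\<bar>w k\<bar> \<le> D * s * t k" for k
      using D(4)[OF conf st, of k] by (simp add: w_def s_def t_def mult_ac)
    have w2: "(w k)\<^sup>2 \<le> D\<^sup>2 * s\<^sup>2 * t k" for k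
    proof -
      have "(w k)\<^sup>2 \<le> (D * s * t k)\<^sup>2"
        using power_mono[OF w[of k], of 2] by simp
      also have "\<dots> = D\<^sup>2 * s\<^sup>2 * (t k * t k)" by (simp add: power2_eq_square mult_ac)
      also have "\<dots> \<le> D\<^sup>2 * s\<^sup>2 * (t k * 1)" using t by (intro mult_left_mono) auto
      finally show ?thesis by simp
    qed
    have mem: "\<xi> \<in> summable_connections y0" "\<eta> \<in> summable_connections y0"
      using conf v unfolding summable_connections_def confined_def
      by (auto intro!: summable_on_dominated[OF v(1)])
    define d where "d k = excess V y0 \<eta> k - excess V y0 \<xi> k" for k
    \<comment> \<open>Stationarity of \<open>\<xi>\<close> turns the first-order part of \<open>d k\<close> into \<open>g (k + 1) - g k\<close>.\<close>
    define g where "g k = D2 V (\<xi> (k - 1)) (\<xi> k) * w k" for k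
    define R where "R = infsum v UNIV + 1"
    have box: "\<bar>\<xi> k - y0\<bar> \<le> R" for k
      using conf(1) summable_nonneg_bounded[OF v, of k]
      unfolding confined_def R_def step_profile_def by (auto simp: abs_le_iff split: if_splits dest!: spec[of _ k])
    have dsum: "d summable_on UNIV"
      unfolding d_def using summable_on_add[OF excess_summable[OF mem(2)], of "\<lambda>k. - excess V y0 \<xi> k"]
        excess_summable[OF mem(1)] by (simp add: summable_on_uminus)
    have gsum: "g summable_on UNIV"
    proof (rule summable_on_dominated)
      define c where "c = \<bar>D2 V y0 y0\<bar> + M * (R + R)"
      show "(\<lambda>k. c * (D * s * t k)) summable_on UNIV" by (intro summable_on_cmult_right t)
      show "\<bar>g k\<bar> \<le> c * (D * s * t k)" for k
      proof -
        have "\<bar>D2 V (\<xi> (k - 1)) (\<xi> k) - D2 V y0 y0\<bar> \<le> M * (\<bar>\<xi> (k - 1) - y0\<bar> + \<bar>\<xi> k - y0\<bar>)"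
          by (rule D_Lipschitz)
        also have "\<dots> \<le> M * (R + R)" using M_ge box by (intro mult_left_mono add_mono) auto
        finally have "\<bar>D2 V (\<xi> (k - 1)) (\<xi> k)\<bar> \<le> c" unfolding c_def by linarith
        then show ?thesis unfolding g_def abs_mult by (intro mult_mono w) auto
      qed
    qed
    have gsum': "(\<lambda>k. g (k + 1)) summable_on UNIV" by (rule summable_on_int_shift[OF gsum])
    have "(\<Sum>\<^sub>\<infinity>k. (d k + g k) + - g (k + 1)) = infsum d UNIV + infsum g UNIV + - (\<Sum>\<^sub>\<infinity>k. g (k + 1))"
      using gsum' by (simp add: infsum_add summable_on_add dsum gsum infsum_uminus summable_on_uminus del: add_uminus_conv_diff)
    then have tele: "(\<Sum>\<^sub>\<infinity>k. (d k + g k) + - g (k + 1)) = infsum d UNIV"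
      by (simp add: infsum_int_shift)
    have bound: "\<bar>(d k + g k) + - g (k + 1)\<bar> \<le> (2 * M * D\<^sup>2 * s\<^sup>2) * (t k + t (k + 1))" for k
    proof -
      have st1: "D2 V (\<xi> (k - 1)) (\<xi> k) = - D1 V (\<xi> k) (\<xi> (k + 1))"
        using st(1) unfolding stationary_def by (auto simp: eq_neg_iff_add_eq_0)
      have "(d k + g k) + - g (k + 1) = V (\<eta> k) (\<eta> (k + 1)) - V (\<xi> k) (\<xi> (k + 1))
          - D1 V (\<xi> k) (\<xi> (k + 1)) * (\<eta> k - \<xi> k) - D2 V (\<xi> k) (\<xi> (k + 1)) * (\<eta> (k + 1) - \<xi> (k + 1))"
        unfolding g_def st1 by (simp add: d_def excess_def w_def)
      then have "\<bar>(d k + g k) + - g (k + 1)\<bar> \<le> 2 * M * ((w k)\<^sup>2 + (w (k + 1))\<^sup>2)"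
        using V_Taylor[of "\<eta> k" "\<eta> (k + 1)" "\<xi> k" "\<xi> (k + 1)"] by (simp add: w_def)
      also have "\<dots> \<le> 2 * M * (D\<^sup>2 * s\<^sup>2 * t k + D\<^sup>2 * s\<^sup>2 * t (k + 1))"
        using M_ge by (intro mult_left_mono add_mono w2) auto
      also have "\<dots> = (2 * M * D\<^sup>2 * s\<^sup>2) * (t k + t (k + 1))" by (simp add: algebra_simps)
      finally show ?thesis .
    qed
    have sumb: "(\<lambda>k. (2 * M * D\<^sup>2 * s\<^sup>2) * (t k + t (k + 1))) summable_on UNIV"
      by (intro summable_on_cmult_right t2)
    have "\<bar>infsum d UNIV\<bar> \<le> (\<Sum>\<^sub>\<infinity>k. (2 * M * D\<^sup>2 * s\<^sup>2) * (t k + t (k + 1)))"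
      unfolding tele[symmetric] by (rule infsum_abs_bound[OF sumb bound])
    also have "\<dots> = Q * s\<^sup>2" using t2 by (simp add: infsum_cmult_right G_def Q_def)
    finally have "\<bar>infsum d UNIV\<bar> \<le> Q * (\<eta> m - \<xi> m)\<^sup>2" by (simp add: s_def)
    moreover have "infsum d UNIV = action V y0 \<eta> - action V y0 \<xi>"
    proof -
      have "action V y0 \<eta> = (\<Sum>\<^sub>\<infinity>k. d k + excess V y0 \<xi> k)" by (simp add: action_def d_def)
      also have "\<dots> = infsum d UNIV + action V y0 \<xi>"
        unfolding action_def by (intro infsum_add dsum excess_summable mem)
      finally show ?thesis by simp
    qed
    ultimately show ?thesis by simp
  qed
  then show ?thesis using that by blast
qed

theorem stationary_actions_contain_no_interval:
  assumes v: "v summable_on UNIV" "\<And>k. 0 \<le> v k" and d: "0 < d"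
  shows "\<exists>e\<in>{c..c + d}. \<forall>\<xi>\<in>confined y0 v. stationary V \<xi> \<longrightarrow> action V y0 \<xi> \<noteq> e"
proof -
  obtain Q m where Q: "\<And>\<xi> \<eta>. \<lbrakk>\<xi> \<in> confined y0 v; \<eta> \<in> confined y0 v; stationary V \<xi>; stationary V \<eta>\<rbrakk>
      \<Longrightarrow> \<bar>action V y0 \<eta> - action V y0 \<xi>\<bar> \<le> Q * (\<eta> m - \<xi> m)\<^sup>2"
    using stationary_action_difference[OF v] by blast
  let ?K = "{\<xi> \<in> confined y0 v. stationary V \<xi>}"
  have "\<exists>e\<in>{c..c + d}. e \<notin> action V y0 ` ?K"
  proof (rule quadratic_image_no_interval[where s = "\<lambda>\<xi>. \<xi> m", OF _ _ d])
    show "\<bar>action V y0 \<eta> - action V y0 \<xi>\<bar> \<le> Q * (\<eta> m - \<xi> m)\<^sup>2" if "\<xi> \<in> ?K" "\<eta> \<in> ?K" for \<xi> \<eta>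
      using Q that by blast
    show "\<bar>\<xi> m - step_profile y0 m\<bar> \<le> v m" if "\<xi> \<in> ?K" for \<xi>
      using that by (auto simp: confined_def)
  qed
  then obtain e where "e \<in> {c..c + d}" "e \<notin> action V y0 ` ?K" by blast
  then show ?thesis by (intro bexI[of _ e]) auto
qed

end

section \<open>Invariant graphs\<close>

lemma cyl_proj_eq_iff: "cyl_proj (x, p) = cyl_proj (x', p') \<longleftrightarrow> (\<exists>n::int. x' = x + of_int n) \<and> p' = p"
proof -
  have "cis (2 * pi * x) = cis (2 * pi * x') \<longleftrightarrow>
      sin (2 * pi * x') = sin (2 * pi * x) \<and> cos (2 * pi * x') = cos (2 * pi * x)"
    by (auto simp: complex_eq_iff)
  also have "\<dots> \<longleftrightarrow> (\<exists>n::int. 2 * pi * x' = 2 * pi * x + 2 * pi * of_int n)"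
    by (rule sin_cos_eq_iff)
  also have "\<dots> \<longleftrightarrow> (\<exists>n::int. x' = x + of_int n)"
  proof -
    have "2 * pi * x' = 2 * pi * x + 2 * pi * of_int n \<longleftrightarrow> x' = x + of_int n" for n :: int
    proof -
      have "2 * pi * x' = 2 * pi * x + 2 * pi * of_int n \<longleftrightarrow> (2 * pi) * x' = (2 * pi) * (x + of_int n)"
        by (simp only: distrib_left)
      then show ?thesis by simp
    qed
    then show ?thesis by simp
  qed
  finally show ?thesis by (auto simp: cyl_proj_def)
qed

context twist_generating
begin

lemma twist_map_cyl_proj: "twist_map V (cyl_proj (x, - D1 V x x')) = cyl_proj (x', D2 V x x')"
proof -
  let ?w = "cyl_proj (x, - D1 V x x')"
  have "cyl_proj (inv_into UNIV cyl_proj ?w) = ?w" by (rule f_inv_into_f) simp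
  moreover obtain a b where ab: "inv_into UNIV cyl_proj ?w = (a, b)" by fastforce
  ultimately have "cyl_proj (x, - D1 V x x') = cyl_proj (a, b)" by simp
  then obtain n :: int where n: "a = x + of_int n" "b = - D1 V x x'"
    unfolding cyl_proj_eq_iff by blast
  have "twist_map V ?w = cyl_proj (x' + of_int n, D2 V x x')"
    unfolding twist_map_def ab n by (simp add: twist_lift_translate)
  also have "\<dots> = cyl_proj (x', D2 V x x')"
    using cyl_proj_eq_iff by metis
  finally show ?thesis .
qed

end

text \<open>After projection to the circle and a rotation by \<open>- 2 \<pi> y0\<close> the loop is the standard circle, of
  winding number \<open>1\<close> about \<open>0\<close>, whereas a constant loop has winding number \<open>0\<close>.\<close>

lemma graph_loop_nontrivial:
  fixes y0 :: real and P :: "real \<Rightarrow> real"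
  defines "\<gamma> \<equiv> \<lambda>t. cyl_proj (y0 + t, P (y0 + t))"
  shows "\<not> homotopic_loops cylinder \<gamma> (\<lambda>_. a)"
proof
  assume h: "homotopic_loops cylinder \<gamma> (\<lambda>_. a)"
  define r where "r = (\<lambda>w :: complex \<times> real. fst w * cis (- (2 * pi * y0)))"
  have "homotopic_loops (- {0}) (r \<circ> \<gamma>) (r \<circ> (\<lambda>_. a))"
  proof (rule homotopic_loops_continuous_image[OF h])
    show "continuous_on cylinder r" unfolding r_def by (intro continuous_intros)
    show "r \<in> cylinder \<rightarrow> - {0}" by (auto simp: r_def cylinder_def)
  qed
  then have "winding_number (r \<circ> \<gamma>) 0 = winding_number (r \<circ> (\<lambda>_. a)) 0"
    and "path_image (r \<circ> (\<lambda>_. a)) \<subseteq> - {0}"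
    by (auto dest: winding_number_homotopic_loops homotopic_loops_imp_subset)
  moreover have "r \<circ> \<gamma> = circlepath 0 1"
    by (auto simp: fun_eq_iff r_def \<gamma>_def cyl_proj_def circlepath cis_conv_exp exp_add[symmetric] algebra_simps)
  moreover have "r \<circ> (\<lambda>_. a) = (\<lambda>_. r a)" by (simp add: o_def)
  ultimately have "1 = winding_number (\<lambda>_. r a) 0" "r a \<noteq> 0"
    by (auto simp: winding_number_circlepath_centre path_image_def)
  then show False using winding_number_zero_const[of "r a" 0] by simp
qed

context twist_generating
begin

text \<open>The equation for \<open>\<phi>\<close> says that \<open>F\<close> maps the graph of \<open>P = - V\<^sub>1 (\<cdot>, \<phi> \<cdot>)\<close> to itself, acting by \<open>\<phi>\<close> on
  first coordinates. Since \<open>\<phi>\<close> fixes \<open>y0\<close> and \<open>y0 + 1\<close>, orbits stay bounded, and their rotation number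
  is \<open>0\<close>. A monotone surjection is continuous, so the graph is a curve.\<close>

theorem invariant_graph_imp_not_N2:
  fixes \<phi> :: "real \<Rightarrow> real"
  assumes mono: "strict_mono \<phi>" and surj: "surj \<phi>"
    and fix0: "\<phi> y0 = y0" and fix1: "\<phi> (y0 + 1) = y0 + 1"
    and stat: "\<And>x. x \<in> {y0..y0 + 1} \<Longrightarrow> D2 V x (\<phi> x) + D1 V (\<phi> x) (\<phi> (\<phi> x)) = 0"
  shows "\<not> N2 V"
proof -
  define P where "P x = - D1 V x (\<phi> x)" for x
  define \<gamma> where "\<gamma> = (\<lambda>t. cyl_proj (y0 + t, P (y0 + t)))"
  let ?I = "{y0..y0 + 1}"
  have mono_iff: "\<phi> x \<le> \<phi> y \<longleftrightarrow> x \<le> y" "\<phi> x < \<phi> y \<longleftrightarrow> x < y" for x y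
    using mono by (simp_all add: strict_mono_less_eq strict_mono_less)
  have \<phi>_I: "\<phi> ` ?I = ?I"
  proof
    show "\<phi> ` ?I \<subseteq> ?I" using mono_iff fix0 fix1 by (metis atLeastAtMost_iff image_subsetI)
    show "?I \<subseteq> \<phi> ` ?I"
    proof
      fix y assume y: "y \<in> ?I"
      obtain x where x: "y = \<phi> x" using surj by blast
      then have "\<phi> y0 \<le> \<phi> x" "\<phi> x \<le> \<phi> (y0 + 1)" using y fix0 fix1 by auto
      then show "y \<in> \<phi> ` ?I" using x by (auto simp: mono_iff)
    qed
  qed
  have \<phi>_lt: "\<phi> x \<in> {y0..<y0 + 1}" if "x \<in> {y0..<y0 + 1}" for x
    using that mono_iff(1)[of y0 x] mono_iff(2)[of x "y0 + 1"] fix0 fix1 by auto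
  have cont: "continuous_on UNIV \<phi>"
    by (rule continuous_onI_mono) (use surj in \<open>auto simp: mono_iff\<close>)
  have "continuous_on UNIV (\<lambda>x. (x, \<phi> x))" by (intro continuous_intros cont)
  from continuous_on_compose2[OF C1_plane_continuous[OF C1s(2), of UNIV] this]
  have contP: "continuous_on UNIV P" unfolding P_def by (auto intro!: continuous_intros)
  have cont_proj: "continuous_on UNIV cyl_proj"
    unfolding cyl_proj_def case_prod_unfold by (intro continuous_intros)
  have "continuous_on UNIV (\<lambda>t. (y0 + t, P (y0 + t)))"
    by (intro continuous_intros continuous_on_compose2[OF contP]) auto
  from continuous_on_compose2[OF cont_proj this] have contg: "continuous_on UNIV \<gamma>"
    by (simp add: \<gamma>_def)
  have P1: "P (y0 + 1) = P y0" by (simp add: P_def fix0 fix1 D_periodic)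
  have P_next: "D2 V x (\<phi> x) = P (\<phi> x)" if "x \<in> ?I" for x
    using stat[OF that] by (simp add: P_def)
  have map: "twist_map V (cyl_proj (x, P x)) = cyl_proj (\<phi> x, P (\<phi> x))" if "x \<in> ?I" for x
    using twist_map_cyl_proj[of x "\<phi> x"] P_next[OF that] by (simp add: P_def)
  define \<Gamma> where "\<Gamma> = path_image \<gamma>"
  have \<Gamma>_eq: "\<Gamma> = (\<lambda>x. cyl_proj (x, P x)) ` ?I"
  proof -
    have "(\<lambda>t. y0 + t) ` {0..1} = ?I" by simp
    then have "(\<lambda>x. cyl_proj (x, P x)) ` ?I = (\<lambda>x. cyl_proj (x, P x)) ` (\<lambda>t. y0 + t) ` {0..1}"
      by (simp only:)
    then show ?thesis unfolding \<Gamma>_def path_image_def \<gamma>_def by (simp only: image_image)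
  qed
  have seam: "cyl_proj (y0 + 1, P (y0 + 1)) = cyl_proj (y0, P y0)"
    unfolding P1 cyl_proj_eq_iff by (auto intro: exI[of _ "-1"])
  have "nontrivial_circle \<Gamma>"
    unfolding nontrivial_circle_def
  proof (intro exI[of _ \<gamma>] conjI notI)
    show "simple_path \<gamma>"
      unfolding simple_path_def loop_free_def
    proof (intro conjI ballI impI)
      show "path \<gamma>" unfolding path_def by (rule continuous_on_subset[OF contg]) simp
      fix s t :: real assume st: "s \<in> {0..1}" "t \<in> {0..1}" "\<gamma> s = \<gamma> t"
      then obtain n :: int where n: "t = s + of_int n"
        unfolding \<gamma>_def cyl_proj_eq_iff by auto
      then have "\<bar>of_int n :: real\<bar> \<le> 1" using st by auto
      then have "n = -1 \<or> n = 0 \<or> n = 1" by linarith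
      then show "s = t \<or> s = 0 \<and> t = 1 \<or> s = 1 \<and> t = 0" using n st by auto
    qed
    show "pathfinish \<gamma> = pathstart \<gamma>" using seam by (simp add: pathfinish_def pathstart_def \<gamma>_def)
    show "path_image \<gamma> = \<Gamma>" by (simp add: \<Gamma>_def)
    show "\<Gamma> \<subseteq> cylinder" unfolding \<Gamma>_eq by (auto simp: cyl_proj_def cylinder_def)
    assume "\<exists>a. homotopic_loops cylinder \<gamma> (\<lambda>_. a)"
    then show False using graph_loop_nontrivial unfolding \<gamma>_def by blast
  qed
  moreover have "twist_map V ` \<Gamma> = \<Gamma>"
  proof -
    have "twist_map V ` \<Gamma> = (\<lambda>x. cyl_proj (x, P x)) ` \<phi> ` ?I"
      unfolding \<Gamma>_eq image_image by (rule image_cong) (auto simp: map)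
    then show ?thesis by (simp only: \<phi>_I \<Gamma>_eq)
  qed
  moreover have "rotation_number V w 0" if w: "full_orbit (twist_map V) w" "range w \<subseteq> \<Gamma>" for w
  proof -
    \<comment> \<open>The half-open interval makes the lifted first coordinates unique, so that they follow \<open>\<phi>\<close>.\<close>
    have "\<exists>x\<in>{y0..<y0 + 1}. w k = cyl_proj (x, P x)" for k
    proof -
      from w(2) obtain x where x: "x \<in> ?I" "w k = cyl_proj (x, P x)" unfolding \<Gamma>_eq by blast
      show ?thesis
      proof (cases "x = y0 + 1")
        case True then show ?thesis using x seam by (intro bexI[of _ y0]) auto
      qed (use x in auto)
    qed
    then obtain x where x: "\<And>k. x k \<in> {y0..<y0 + 1}" "\<And>k. w k = cyl_proj (x k, P (x k))" by metis
    have step: "x (k + 1) = \<phi> (x k)" for k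
    proof -
      have "cyl_proj (x (k + 1), P (x (k + 1))) = cyl_proj (\<phi> (x k), P (\<phi> (x k)))"
        using w(1) map[of "x k"] x(1)[of k] unfolding full_orbit_def by (simp flip: x(2))
      then obtain n :: int where n: "\<phi> (x k) = x (k + 1) + of_int n" unfolding cyl_proj_eq_iff by blast
      have "\<phi> (x k) \<in> {y0..<y0 + 1}" "x (k + 1) \<in> {y0..<y0 + 1}" using \<phi>_lt x(1) by blast+
      then have "\<bar>of_int n :: real\<bar> < 1" using n by auto
      then have "n = 0" by linarith
      then show ?thesis using n by simp
    qed
    define q where "q k = (x k, P (x k))" for k
    have "full_orbit (twist_lift V) q"
      unfolding full_orbit_def
    proof
      fix k
      have "twist_lift V (q k) = (\<phi> (x k), D2 V (x k) (\<phi> (x k)))"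
        unfolding q_def by (rule twist_lift_eq) (simp add: P_def)
      then show "q (k + 1) = twist_lift V (q k)"
        using P_next[of "x k"] x(1)[of k] by (simp add: q_def step)
    qed
    moreover have "\<forall>k. cyl_proj (q k) = w k" by (simp add: q_def x(2))
    moreover have "lift_rotation_number q 0"
      unfolding lift_rotation_number_def
    proof (rule tendstoI)
      fix e :: real assume e: "0 < e"
      define B where "B = \<bar>y0\<bar> + 1"
      have "{k. \<not> dist (fst (q k) / real_of_int \<bar>k\<bar>) 0 < e} \<subseteq> {- \<lceil>B / e\<rceil>..\<lceil>B / e\<rceil>}"
      proof
        fix k assume "k \<in> {k. \<not> dist (fst (q k) / real_of_int \<bar>k\<bar>) 0 < e}"
        then have ge: "e \<le> \<bar>x k\<bar> / real_of_int \<bar>k\<bar>" by (simp add: q_def)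
        then have k0: "0 < \<bar>k\<bar>" using e by (cases "k = 0") auto
        then have "e * real_of_int \<bar>k\<bar> \<le> \<bar>x k\<bar>" using ge by (simp add: le_divide_eq)
        also have "\<bar>x k\<bar> \<le> B" using x(1)[of k] by (auto simp: B_def)
        finally have "real_of_int \<bar>k\<bar> \<le> B / e" using e by (simp add: le_divide_eq mult.commute)
        then have "\<bar>k\<bar> \<le> \<lceil>B / e\<rceil>" by linarith
        then show "k \<in> {- \<lceil>B / e\<rceil>..\<lceil>B / e\<rceil>}" by auto
      qed
      then show "\<forall>\<^sub>F k in cofinite. dist (fst (q k) / real_of_int \<bar>k\<bar>) 0 < e"
        unfolding eventually_cofinite by (rule finite_subset) simp
    qed
    ultimately show ?thesis unfolding rotation_number_def by blast
  qed
  ultimately show ?thesis unfolding N2_def by blast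
qed

end

section \<open>The foliation by minimizers\<close>

context twist_generating
begin

text \<open>Both terms of the stationarity equation decrease strictly in the neighbouring entries. If the
  configurations agree at \<open>k\<close> and are ordered at \<open>k - 1\<close> and \<open>k + 1\<close>, they agree there too.\<close>

lemma stationary_touching_eq:
  assumes st: "stationary V \<xi>" "stationary V \<eta>" and le: "\<And>k. \<xi> k \<le> \<eta> k" and eq: "\<xi> k = \<eta> k"
  shows "\<xi> = \<eta>"
proof -
  have step: "\<xi> (k + 1) = \<eta> (k + 1) \<and> \<xi> (k - 1) = \<eta> (k - 1)" if "\<xi> k = \<eta> k" for k
  proof -
    have "D2 V (\<xi> (k - 1)) (\<xi> k) + D1 V (\<xi> k) (\<xi> (k + 1)) = D2 V (\<eta> (k - 1)) (\<xi> k) + D1 V (\<xi> k) (\<eta> (k + 1))"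
      using st[unfolded stationary_def, THEN spec[of _ k]] that by simp
    moreover have "D2 V (\<eta> (k - 1)) (\<xi> k) \<le> D2 V (\<xi> (k - 1)) (\<xi> k)"
      using D_strict_antimono(2)[of "\<xi> (k - 1)" "\<eta> (k - 1)" "\<xi> k"] le[of "k - 1"]
      by (cases "\<xi> (k - 1) = \<eta> (k - 1)") auto
    moreover have "D1 V (\<xi> k) (\<eta> (k + 1)) \<le> D1 V (\<xi> k) (\<xi> (k + 1))"
      using D_strict_antimono(1)[of "\<xi> (k + 1)" "\<eta> (k + 1)" "\<xi> k"] le[of "k + 1"]
      by (cases "\<xi> (k + 1) = \<eta> (k + 1)") auto
    ultimately have "D2 V (\<eta> (k - 1)) (\<xi> k) = D2 V (\<xi> (k - 1)) (\<xi> k)"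
      "D1 V (\<xi> k) (\<eta> (k + 1)) = D1 V (\<xi> k) (\<xi> (k + 1))" by linarith+
    then show ?thesis unfolding D_inj by simp
  qed
  have "\<xi> j = \<eta> j" for j
    by (induction j rule: int_induct[where k = k]) (use eq step in auto)
  then show ?thesis by (simp add: fun_eq_iff)
qed

end

locale minimizing_connection = twist_generating +
  fixes y0 :: real and z :: "int \<Rightarrow> real"
  assumes z_mem: "z \<in> summable_connections y0"
    and z_bounds: "y0 < z k" "z k < y0 + 1" and z_mono: "z k < z (k + 1)"
    and z_min: "\<xi> \<in> summable_connections y0 \<Longrightarrow> \<xi> 0 \<in> {y0<..<y0 + 1} \<Longrightarrow> action V y0 z \<le> action V y0 \<xi>"
begin

definition minimizers :: "(int \<Rightarrow> real) set" where
  "minimizers = {\<xi> \<in> summable_connections y0. \<xi> 0 \<in> {y0<..<y0 + 1} \<and> action V y0 \<xi> = action V y0 z}"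

lemma minimizersI:
  assumes "\<xi> \<in> summable_connections y0" "\<xi> 0 \<in> {y0<..<y0 + 1}" "action V y0 \<xi> \<le> action V y0 z"
  shows "\<xi> \<in> minimizers"
  using assms z_min[of \<xi>] by (auto simp: minimizers_def)

text \<open>The constraint on the entry at index \<open>0\<close> is open, so every single entry may be varied freely.\<close>

lemma minimizer_stationary:
  assumes "\<xi> \<in> minimizers"
  shows "stationary V \<xi>"
proof (rule locally_minimal_imp_stationary)
  show mem: "\<xi> \<in> summable_connections y0" using assms by (simp add: minimizers_def)
  fix j
  have "\<forall>\<^sub>F t in nhds (\<xi> j). (\<xi>(j := t)) 0 \<in> {y0<..<y0 + 1}"
  proof (cases "j = 0")
    case True
    then show ?thesis
      using assms eventually_nhds_in_open[of "{y0<..<y0 + 1}" "\<xi> 0"] by (simp add: minimizers_def)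
  qed (use assms in \<open>simp add: minimizers_def\<close>)
  then show "\<forall>\<^sub>F t in nhds (\<xi> j). action V y0 \<xi> \<le> action V y0 (\<xi>(j := t))"
  proof (rule eventually_mono)
    fix t assume in_I: "(\<xi>(j := t)) 0 \<in> {y0<..<y0 + 1}"
    have "action V y0 \<xi> = action V y0 z" using assms by (simp add: minimizers_def)
    then show "action V y0 \<xi> \<le> action V y0 (\<xi>(j := t))"
      using z_min[OF action_update(1)[OF mem] in_I] by (rule ord_eq_le_trans)
  qed
qed

text \<open>Maximum and minimum have together at most the action of the pair, and neither can be below the
  minimal value.\<close>

lemma max_minimizers:
  assumes "\<xi> \<in> minimizers" "\<eta> \<in> minimizers"
  shows "(\<lambda>k. max (\<xi> k) (\<eta> k)) \<in> minimizers"
proof (rule minimizersI)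
  have mem: "\<xi> \<in> summable_connections y0" "\<eta> \<in> summable_connections y0"
    and a: "action V y0 \<xi> = action V y0 z" "action V y0 \<eta> = action V y0 z"
    and b: "\<xi> 0 \<in> {y0<..<y0 + 1}" "\<eta> 0 \<in> {y0<..<y0 + 1}"
    using assms by (auto simp: minimizers_def)
  show "(\<lambda>k. max (\<xi> k) (\<eta> k)) \<in> summable_connections y0"
    by (rule summable_connections_max_min(1)[OF mem])
  show "max (\<xi> 0) (\<eta> 0) \<in> {y0<..<y0 + 1}" using b by auto
  have "action V y0 z \<le> action V y0 (\<lambda>k. min (\<xi> k) (\<eta> k))"
    by (rule z_min[OF summable_connections_max_min(2)[OF mem]]) (use b in auto)
  then show "action V y0 (\<lambda>k. max (\<xi> k) (\<eta> k)) \<le> action V y0 z"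
    using action_max_min[OF mem] a by linarith
qed

text \<open>The maximum of the two is a minimizer lying above \<open>\<xi>\<close> and touching it at \<open>k\<close>; both being stationary,
  it equals \<open>\<xi>\<close>.\<close>

lemma minimizers_ordered:
  assumes "\<xi> \<in> minimizers" "\<eta> \<in> minimizers" "\<eta> k \<le> \<xi> k"
  shows "\<eta> j \<le> \<xi> j"
proof -
  have "\<xi> = (\<lambda>k. max (\<xi> k) (\<eta> k))"
    by (rule stationary_touching_eq[where k = k])
      (use assms in \<open>auto intro: minimizer_stationary max_minimizers\<close>)
  then show ?thesis by (metis max.cobounded2)
qed

lemma minimizers_unique:
  assumes "\<xi> \<in> minimizers" "\<eta> \<in> minimizers" "\<eta> k = \<xi> k"
  shows "\<eta> = \<xi>"
  using minimizers_ordered[of \<xi> \<eta> k] minimizers_ordered[of \<eta> \<xi> k] assms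
  by (auto simp: fun_eq_iff intro!: antisym)

lemma z_shift_minimizer: "(\<lambda>k. z (k + n)) \<in> minimizers"
  using z_bounds summable_connections_shift[OF z_mem] by (auto simp: minimizers_def action_shift)

lemma between_shifts:
  assumes "x \<in> {y0<..<y0 + 1}"
  obtains m n where "z m \<le> x" "x \<le> z n"
proof -
  have "\<forall>\<^sub>F k in at_bot. z k < x" "\<forall>\<^sub>F k in at_top. x < z k"
    using order_tendstoD(2)[OF summable_connections_tendsto(1)[OF z_mem], of x]
      order_tendstoD(1)[OF summable_connections_tendsto(2)[OF z_mem], of x] assms by auto
  then obtain m n where "z m < x" "x < z n"
    unfolding eventually_at_bot_linorder eventually_at_top_linorder by blast
  then show ?thesis using that[of m n] by simp
qed

text \<open>The definition of a minimizer confines the entry at index \<open>0\<close> only; comparison with shifts of \<open>z\<close>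
  confines all others.\<close>

lemma minimizer_bounds:
  assumes "\<xi> \<in> minimizers"
  shows "\<xi> k \<in> {y0<..<y0 + 1}"
proof -
  have "\<xi> 0 \<in> {y0<..<y0 + 1}" using assms by (simp add: minimizers_def)
  then obtain m n where "z m \<le> \<xi> 0" "\<xi> 0 \<le> z n" by (rule between_shifts)
  then have "z (k + m) \<le> \<xi> k" "\<xi> k \<le> z (k + n)"
    using minimizers_ordered[OF assms z_shift_minimizer[of m], of 0 k]
      minimizers_ordered[OF z_shift_minimizer[of n] assms, of 0 k] by auto
  then show ?thesis using z_bounds(1)[of "k + m"] z_bounds(2)[of "k + n"] by auto
qed

lemma minimizer_shift:
  assumes "\<xi> \<in> minimizers"
  shows "(\<lambda>k. \<xi> (k + n)) \<in> minimizers"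
  using assms minimizer_bounds[OF assms, of n] summable_connections_shift[of \<xi> y0 n]
  by (auto simp: minimizers_def action_shift)

lemma z_le: "m \<le> n \<Longrightarrow> z m \<le> z n"
  by (induction n rule: int_ge_induct) (auto intro: order_trans less_imp_le z_mono)

text \<open>Cutting a connection at shifts of \<open>z\<close> does not raise its action: the discarded parts compete with
  minimizers. This places minimizing sequences inside one summable envelope.\<close>

lemma squeeze_between_shifts:
  assumes \<xi>: "\<xi> \<in> summable_connections y0" "\<xi> 0 \<in> {y0<..<y0 + 1}"
    and m: "z m \<le> \<xi> 0" "\<xi> 0 \<le> z n"
  obtains \<eta> where "\<eta> \<in> summable_connections y0" "\<eta> 0 = \<xi> 0" "action V y0 \<eta> \<le> action V y0 \<xi>"
    "\<And>k. z (k + m) \<le> \<eta> k" "\<And>k. \<eta> k \<le> z (k + n)"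
proof -
  let ?a = "\<lambda>k. z (k + m)" and ?b = "\<lambda>k. z (k + n)"
  have a: "?a \<in> summable_connections y0" "?b \<in> summable_connections y0"
    "action V y0 ?a = action V y0 z" "action V y0 ?b = action V y0 z"
    using z_shift_minimizer[of m] z_shift_minimizer[of n] by (auto simp: minimizers_def)
  define \<mu> where "\<mu> = (\<lambda>k. max (\<xi> k) (z (k + m)))"
  define \<eta> where "\<eta> = (\<lambda>k. min (\<mu> k) (z (k + n)))"
  have \<mu>: "\<mu> \<in> summable_connections y0" "\<mu> 0 = \<xi> 0"
    using summable_connections_max_min(1)[OF \<xi>(1) a(1)] m by (simp_all add: \<mu>_def)
  have "action V y0 z \<le> action V y0 (\<lambda>k. min (\<xi> k) (z (k + m)))"
    by (rule z_min[OF summable_connections_max_min(2)[OF \<xi>(1) a(1)]]) (use z_bounds \<xi>(2) in auto)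
  then have 1: "action V y0 \<mu> \<le> action V y0 \<xi>"
    using action_max_min[OF \<xi>(1) a(1)] a(3) unfolding \<mu>_def by linarith
  have "action V y0 z \<le> action V y0 (\<lambda>k. max (\<mu> k) (z (k + n)))"
    by (rule z_min[OF summable_connections_max_min(1)[OF \<mu>(1) a(2)]]) (use z_bounds \<xi>(2) \<mu>(2) in auto)
  then have 2: "action V y0 \<eta> \<le> action V y0 \<mu>"
    using action_max_min[OF \<mu>(1) a(2)] a(4) unfolding \<eta>_def by linarith
  have "z m \<le> z n" using m by simp
  then have "m \<le> n" using z_le[of n m] z_mono[of n] z_le[of "n + 1" m] by linarith
  then have "\<And>k. z (k + m) \<le> \<eta> k" using z_le by (simp add: \<eta>_def \<mu>_def)
  moreover have "\<eta> \<in> summable_connections y0" "\<eta> 0 = \<xi> 0"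
    using summable_connections_max_min(2)[OF \<mu>(1) a(2)] \<mu>(2) m(2) by (simp_all add: \<eta>_def)
  ultimately show ?thesis using that[of \<eta>] 1 2 by (simp add: \<eta>_def)
qed

text \<open>The direct method: a minimizing sequence, squeezed between two shifts of \<open>z\<close>, has a pointwise limit
  point, and the action is continuous along dominated sequences.\<close>

lemma minimizer_through:
  assumes x: "x \<in> {y0<..<y0 + 1}"
    and approx: "\<And>\<epsilon>. 0 < \<epsilon> \<Longrightarrow> \<exists>\<xi>\<in>summable_connections y0. \<xi> 0 = x \<and> action V y0 \<xi> < action V y0 z + \<epsilon>"
  shows "\<exists>\<xi>\<in>minimizers. \<xi> 0 = x"
proof -
  obtain m n where mn: "z m \<le> x" "x \<le> z n" using between_shifts[OF x] by blast
  have "\<exists>\<eta>. \<eta> 0 = x \<and> action V y0 \<eta> < action V y0 z + 1 / real (Suc i) \<and>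
      (\<forall>k. z (k + m) \<le> \<eta> k \<and> \<eta> k \<le> z (k + n))" for i
  proof -
    obtain \<xi> where \<xi>: "\<xi> \<in> summable_connections y0" "\<xi> 0 = x" "action V y0 \<xi> < action V y0 z + 1 / real (Suc i)"
      using approx[of "1 / real (Suc i)"] by auto
    obtain \<eta> where "\<eta> \<in> summable_connections y0" "\<eta> 0 = \<xi> 0" "action V y0 \<eta> \<le> action V y0 \<xi>"
      "\<And>k. z (k + m) \<le> \<eta> k" "\<And>k. \<eta> k \<le> z (k + n)"
      using squeeze_between_shifts[of \<xi> m n] \<xi> x mn by auto
    then show ?thesis using \<xi> by (intro exI[of _ \<eta>]) auto
  qed
  then obtain \<eta> where \<eta>: "\<And>i. \<eta> i 0 = x" "\<And>i. action V y0 (\<eta> i) < action V y0 z + 1 / real (Suc i)"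
    "\<And>i k. z (k + m) \<le> \<eta> i k" "\<And>i k. \<eta> i k \<le> z (k + n)" by metis
  define v where "v k = \<bar>z (k + m) - step_profile y0 k\<bar> + \<bar>z (k + n) - step_profile y0 k\<bar>" for k
  have v: "v summable_on UNIV" "\<And>k. 0 \<le> v k"
  proof -
    show "v summable_on UNIV" unfolding v_def[abs_def]
      using summable_connections_shift[OF z_mem, of m] summable_connections_shift[OF z_mem, of n]
      by (intro summable_on_add) (auto simp: summable_connections_def)
  qed (simp add: v_def)
  have dom: "\<bar>\<eta> i k - step_profile y0 k\<bar> \<le> v k" for i k
    using \<eta>(3)[of k i] \<eta>(4)[of i k] unfolding v_def by linarith
  obtain r g where g: "strict_mono r" "\<And>k. (\<lambda>i. \<eta> (r i) k) \<longlonglongrightarrow> g k" "\<And>k. \<bar>g k - step_profile y0 k\<bar> \<le> v k"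
    using pointwise_convergent_subsequence[of \<eta> "step_profile y0" v] dom by metis
  have g0: "g 0 = x" using g(2)[of 0] \<eta>(1) by (simp add: LIMSEQ_const_iff)
  have "(\<lambda>i. action V y0 (\<eta> (r i))) \<longlonglongrightarrow> action V y0 g"
    by (rule action_tendsto[OF v dom g(2)])
  moreover have "(\<lambda>i. action V y0 z + 1 / real (Suc (r i))) \<longlonglongrightarrow> action V y0 z + 0"
    using LIMSEQ_subseq_LIMSEQ[OF LIMSEQ_Suc[OF lim_1_over_n] g(1)]
    by (intro tendsto_add tendsto_const) (simp add: o_def)
  ultimately have "action V y0 g \<le> action V y0 z + 0"
    by (rule LIMSEQ_le) (use \<eta>(2) less_imp_le in blast)
  moreover have "g \<in> summable_connections y0"
    unfolding summable_connections_def mem_Collect_eq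
    by (rule summable_on_dominated[OF v(1)]) (use g(3) in simp)
  ultimately have "g \<in> minimizers" using g0 x by (intro minimizersI) auto
  then show ?thesis using g0 by blast
qed

text \<open>\<open>\<phi>\<close> sends \<open>\<xi> 0\<close> to \<open>\<xi> 1\<close> along minimizers, and is extended by the identity outside the open interval so
  that it is an increasing bijection of the whole line. Uniqueness and shift invariance give
  surjectivity and \<open>\<phi> (\<phi> (\<xi> 0)) = \<xi> 2\<close>.\<close>

lemma minimizer_foliation:
  assumes fol: "\<And>x. x \<in> {y0<..<y0 + 1} \<Longrightarrow> \<exists>\<xi>\<in>minimizers. \<xi> 0 = x"
  obtains \<phi> where "strict_mono \<phi>" "surj \<phi>" "\<phi> y0 = y0" "\<phi> (y0 + 1) = y0 + 1"
    "\<And>x. x \<in> {y0<..<y0 + 1} \<Longrightarrow> D2 V x (\<phi> x) + D1 V (\<phi> x) (\<phi> (\<phi> x)) = 0"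
proof -
  obtain m where m: "\<And>x. x \<in> {y0<..<y0 + 1} \<Longrightarrow> m x \<in> minimizers"
    "\<And>x. x \<in> {y0<..<y0 + 1} \<Longrightarrow> m x 0 = x"
    using fol by metis
  have m_shift: "m (\<xi> k) = (\<lambda>j. \<xi> (j + k))" if "\<xi> \<in> minimizers" for \<xi> k
    using m[OF minimizer_bounds[OF that, of k]] minimizers_unique[OF minimizer_shift[OF that, of k], of "m (\<xi> k)" 0]
    by simp
  define \<phi> where "\<phi> x = (if x \<in> {y0<..<y0 + 1} then m x 1 else x)" for x
  have in_I: "\<phi> x \<in> {y0<..<y0 + 1}" if "x \<in> {y0<..<y0 + 1}" for x
    using minimizer_bounds[OF m(1)[OF that], of 1] that by (simp add: \<phi>_def)
  have "strict_mono \<phi>"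
  proof (rule strict_monoI)
    fix x y :: real assume xy: "x < y"
    show "\<phi> x < \<phi> y"
    proof (cases "x \<in> {y0<..<y0 + 1} \<and> y \<in> {y0<..<y0 + 1}")
      case True
      then have "\<not> m y 1 \<le> m x 1"
        using minimizers_ordered[of "m x" "m y" 1 0] m xy by fastforce
      then show ?thesis using True by (simp add: \<phi>_def)
    next
      case False
      then show ?thesis using xy in_I[of x] in_I[of y] by (auto simp: \<phi>_def split: if_splits)
    qed
  qed
  moreover have "surj \<phi>"
  proof -
    have "\<exists>x. y = \<phi> x" for y
    proof (cases "y \<in> {y0<..<y0 + 1}")
      case True
      have b: "m y (-1) \<in> {y0<..<y0 + 1}" by (rule minimizer_bounds[OF m(1)[OF True]])
      have "\<phi> (m y (-1)) = y"
        using b m_shift[OF m(1)[OF True], of "-1"] m(2)[OF True] by (simp add: \<phi>_def)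
      then show ?thesis by metis
    next
      case False
      then show ?thesis by (intro exI[of _ y]) (auto simp: \<phi>_def)
    qed
    then show ?thesis by (simp add: surj_def)
  qed
  moreover have "\<phi> y0 = y0" "\<phi> (y0 + 1) = y0 + 1" by (auto simp: \<phi>_def)
  moreover have "D2 V x (\<phi> x) + D1 V (\<phi> x) (\<phi> (\<phi> x)) = 0" if x: "x \<in> {y0<..<y0 + 1}" for x
  proof -
    have 1: "\<phi> x = m x 1" using x by (simp add: \<phi>_def)
    have "m (m x 1) = (\<lambda>j. m x (j + 1))" by (rule m_shift[OF m(1)[OF x]])
    then have 2: "\<phi> (\<phi> x) = m x 2" using in_I[OF x] 1 by (simp add: \<phi>_def)
    have "D2 V (m x (1 - 1)) (m x 1) + D1 V (m x 1) (m x (1 + 1)) = 0"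
      using minimizer_stationary[OF m(1)[OF x]] unfolding stationary_def by blast
    then show ?thesis using 1 2 m(2)[OF x] by simp
  qed
  ultimately show ?thesis using that by blast
qed

end

section \<open>Positivity of the gradient constant\<close>

context twist_generating
begin

lemma diagonal_critical:
  assumes "\<And>x. V y0 y0 \<le> V x x"
  shows "D1 V y0 y0 + D2 V y0 y0 = 0"
proof -
  have "((\<lambda>t. V t t) has_real_derivative D1 V y0 y0 * 1 + D2 V y0 y0 * 1) (at y0)"
    by (rule C1_plane_curve[OF C1s(1)]) (auto intro!: derivative_intros)
  from DERIV_local_min[OF this, of 1] assms show ?thesis by simp
qed

text \<open>At a minimum of \<open>x \<mapsto> V(x, x)\<close> the second derivative is non-negative. If it vanished, \<open>DF\<close> would have the
  eigenvalue \<open>1\<close>, as is seen by differentiating \<open>F\<close> along the curve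
  \<open>t \<mapsto> (t, - V\<^sub>1 (t, t))\<close>, whose image is explicitly \<open>t \<mapsto> (t, V\<^sub>2 (t, t))\<close>.\<close>

lemma hyperbolic_minimum:
  assumes min: "\<And>x. V y0 y0 \<le> V x x" and hyp: "hyperbolic_fixed_point V (y0, - D1 V y0 y0)"
  shows "0 < D1 (D1 V) y0 y0 + 2 * D2 (D1 V) y0 y0 + D2 (D2 V) y0 y0"
proof -
  let ?B = "D1 (D1 V) y0 y0 + 2 * D2 (D1 V) y0 y0 + D2 (D2 V) y0 y0"
  let ?g = "\<lambda>t. D1 V t t + D2 V t t"
  have d1: "((\<lambda>t. V t t) has_real_derivative ?g t) (at t)" for t
    using C1_plane_curve[OF C1s(1), of "\<lambda>t. t" 1 t "\<lambda>t. t" 1] by (simp add: DERIV_ident)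
  have d11: "((\<lambda>t. D1 V t t) has_real_derivative D1 (D1 V) y0 y0 + D2 (D1 V) y0 y0) (at y0)"
    using C1_plane_curve[OF C1s(2), of "\<lambda>t. t" 1 y0 "\<lambda>t. t" 1] by (simp add: DERIV_ident)
  have d22: "((\<lambda>t. D2 V t t) has_real_derivative D2 (D1 V) y0 y0 + D2 (D2 V) y0 y0) (at y0)"
    using C1_plane_curve[OF C1s(3), of "\<lambda>t. t" 1 y0 "\<lambda>t. t" 1] by (simp add: DERIV_ident mixed)
  have d2: "(?g has_real_derivative ?B) (at y0)"
    using DERIV_add[OF d11 d22] by (simp add: algebra_simps)
  have g0: "?g y0 = 0" by (rule diagonal_critical[OF min])
  have "\<not> ?B < 0"
  proof
    assume "?B < 0"
    from DERIV_neg_dec_right[OF d2 this] obtain d where d: "d > 0" "\<And>h. 0 < h \<Longrightarrow> h < d \<Longrightarrow> ?g (y0 + h) < ?g y0"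
      by blast
    obtain \<xi> where \<xi>: "y0 < \<xi>" "\<xi> < y0 + d / 2" "V (y0 + d / 2) (y0 + d / 2) - V y0 y0 = (y0 + d / 2 - y0) * ?g \<xi>"
      using MVT2[of y0 "y0 + d / 2" "\<lambda>t. V t t" ?g] d1 d(1) by auto
    have "?g \<xi> < 0" using d(2)[of "\<xi> - y0"] \<xi>(1,2) d(1) g0 by simp
    then have "(y0 + d / 2 - y0) * ?g \<xi> < 0" using d(1) by (intro mult_pos_neg) auto
    then show False using \<xi>(3) min[of "y0 + d / 2"] by linarith
  qed
  moreover have "?B \<noteq> 0"
  proof
    assume B: "?B = 0"
    define p where "p = D1 (D1 V) y0 y0 + D2 (D1 V) y0 y0"
    have Bp: "D2 (D1 V) y0 y0 + D2 (D2 V) y0 y0 = - p" using B by (simp add: p_def)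
    let ?F = "twist_lift V" and ?L = "twist_deriv V (y0, - D1 V y0 y0)"
    have L: "(?F has_derivative ?L) (at (y0, - D1 V y0 y0))"
      using hyp unfolding hyperbolic_fixed_point_def twist_deriv_def
      by (simp add: frechet_derivative_works)
    have c: "((\<lambda>t. (t, - D1 V t t)) has_derivative (\<lambda>s. (s, - (p * s)))) (at y0)"
      using d11 unfolding p_def has_field_derivative_def
      by (intro has_derivative_Pair has_derivative_ident has_derivative_minus) auto
    have "((\<lambda>t. ?F (t, - D1 V t t)) has_derivative (\<lambda>s. ?L (s, - (p * s)))) (at y0)"
      by (rule has_derivative_compose[OF c L])
    moreover have "?F (t, - D1 V t t) = (t, D2 V t t)" for t by (rule twist_lift_eq) simp
    ultimately have "((\<lambda>t. (t, D2 V t t)) has_derivative (\<lambda>s. ?L (s, - (p * s)))) (at y0)" by simp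
    moreover have "((\<lambda>t. (t, D2 V t t)) has_derivative (\<lambda>s. (s, - p * s))) (at y0)"
      using d22 unfolding Bp has_field_derivative_def
      by (rule has_derivative_Pair[OF has_derivative_ident])
    ultimately have "(\<lambda>s. ?L (s, - (p * s))) = (\<lambda>s. (s, - p * s))" by (rule has_derivative_unique)
    from fun_cong[OF this, of 1] have fixp: "?L (1, - p) = (1, - p)" by simp
    have "?L 0 = 0" by (rule linear_0) (rule has_derivative_linear[OF L])
    with fixp have "complex_eigenvalue ?L 1"
      unfolding complex_eigenvalue_def by (intro exI[of _ "(1, - p)"] exI[of _ 0]) (simp add: zero_prod_def)
    then show False using hyp unfolding hyperbolic_fixed_point_def by force
  qed
  ultimately show ?thesis by linarith
qed

text \<open>Beyond a large index the connection is replaced by its limits. Continuity of \<open>V\<close> makes the two joining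
  terms small, and the partial sums in between are eventually below \<open>c\<close>.\<close>

lemma truncated_connection:
  assumes \<xi>: "\<xi> \<in> connections y0 x" and s: "has_bi_sum (\<lambda>k. V (\<xi> k) (\<xi> (k + 1)) - V y0 y0) s"
    and less: "s < ereal c" and \<epsilon>: "0 < \<epsilon>"
  shows "\<exists>\<eta>\<in>summable_connections y0. \<eta> 0 = x \<and> action V y0 \<eta> < c + 2 * \<epsilon>"
proof -
  have lim: "(\<xi> \<longlongrightarrow> y0) at_bot" "(\<xi> \<longlongrightarrow> y0 + 1) at_top" and x: "\<xi> 0 = x"
    using \<xi> by (auto simp: connections_def)
  have "\<forall>\<^sub>F mn in sequentially \<times>\<^sub>F sequentially. ereal (bi_partial_sum (excess V y0 \<xi>) mn) < ereal c"
    using order_tendstoD(2)[OF s[unfolded has_bi_sum_def] less] by (simp add: excess_def[abs_def])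
  then obtain n0 where n0: "\<And>m n. m \<ge> n0 \<Longrightarrow> n \<ge> n0 \<Longrightarrow> bi_partial_sum (excess V y0 \<xi>) (m, n) < c"
    unfolding eventually_prod_sequentially by auto
  have "((\<lambda>k. V y0 (\<xi> k) - V y0 y0) \<longlongrightarrow> V y0 y0 - V y0 y0) at_bot"
    by (intro tendsto_intros V_continuous lim)
  then have "\<forall>\<^sub>F k in at_bot. V y0 (\<xi> k) - V y0 y0 < \<epsilon>" using \<epsilon> by (intro order_tendstoD) auto
  then obtain k1 where k1: "\<And>k. k \<le> k1 \<Longrightarrow> V y0 (\<xi> k) - V y0 y0 < \<epsilon>"
    unfolding eventually_at_bot_linorder by blast
  have "((\<lambda>k. V (\<xi> k) (y0 + 1) - V y0 y0) \<longlongrightarrow> V (y0 + 1) (y0 + 1) - V y0 y0) at_top"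
    by (intro tendsto_intros V_continuous lim)
  then have "\<forall>\<^sub>F k in at_top. V (\<xi> k) (y0 + 1) - V y0 y0 < \<epsilon>"
    using \<epsilon> by (intro order_tendstoD) (auto simp: periodic)
  then obtain k2 where k2: "\<And>k. k \<ge> k2 \<Longrightarrow> V (\<xi> k) (y0 + 1) - V y0 y0 < \<epsilon>"
    unfolding eventually_at_top_linorder by blast
  \<comment> \<open>The cut is so far out that each of the two joining terms costs less than \<open>\<epsilon>\<close>.\<close>
  define n where "n = n0 + nat \<bar>k1\<bar> + nat \<bar>k2\<bar>"
  have n: "n \<ge> n0" "- int n \<le> k1" "int n + 1 \<ge> k2" by (auto simp: n_def)
  define \<eta> where "\<eta> k = (if k < - int n then y0 else if k > int n + 1 then y0 + 1 else \<xi> k)" for k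
  have "\<eta> \<in> summable_connections y0"
    unfolding summable_connections_def mem_Collect_eq
    by (rule summable_on_finite_support(1)[of "{- int n..int n + 1}"]) (auto simp: \<eta>_def step_profile_def)
  moreover have "\<eta> 0 = x" by (simp add: \<eta>_def x)
  moreover have "action V y0 \<eta> < c + 2 * \<epsilon>"
  proof -
    have supp: "excess V y0 \<eta> k = 0" if "k \<notin> insert (- int n - 1) (insert (int n + 1) {- int n..int n})" for k
      using that by (auto simp: excess_def \<eta>_def periodic)
    have "action V y0 \<eta> = sum (excess V y0 \<eta>) (insert (- int n - 1) (insert (int n + 1) {- int n..int n}))"
      unfolding action_def by (rule summable_on_finite_support(2)) (simp, erule supp)
    also have "\<dots> = excess V y0 \<eta> (- int n - 1) + (excess V y0 \<eta> (int n + 1) + sum (excess V y0 \<eta>) {- int n..int n})"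
      by (subst sum.insert, simp, simp)+ simp
    also have "excess V y0 \<eta> (- int n - 1) = V y0 (\<xi> (- int n)) - V y0 y0" by (simp add: excess_def \<eta>_def)
    also have "excess V y0 \<eta> (int n + 1) = V (\<xi> (int n + 1)) (y0 + 1) - V y0 y0" by (simp add: excess_def \<eta>_def)
    also have "sum (excess V y0 \<eta>) {- int n..int n} = bi_partial_sum (excess V y0 \<xi>) (n, n)"
      unfolding bi_partial_sum_def by (auto intro!: sum.cong simp: excess_def \<eta>_def)
    finally show ?thesis
      using k1[OF n(2)] k2[OF n(3)] n0[OF n(1) n(1)] by linarith
  qed
  ultimately show ?thesis by blast
qed

lemma S_le_action:
  assumes "\<xi> \<in> summable_connections y0"
  shows "S V y0 (\<xi> 0) \<le> ereal (action V y0 \<xi>)"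
  unfolding S_def
proof (rule Inf_lower, intro CollectI bexI)
  show "has_bi_sum (\<lambda>k. V (\<xi> k) (\<xi> (k + 1)) - V y0 y0) (ereal (action V y0 \<xi>))"
    by (rule has_bi_sum_action[OF assms])
  show "\<xi> \<in> connections y0 (\<xi> 0)"
    using summable_connections_tendsto[OF assms] by (simp add: connections_def)
qed

text \<open>The infimum defining \<open>S\<close> runs over all connections, with merely convergent sums; truncation shows
  that summable connections give the same value.\<close>

lemma action_approx_S:
  assumes "S V y0 x = ereal c" "0 < \<epsilon>"
  shows "\<exists>\<xi>\<in>summable_connections y0. \<xi> 0 = x \<and> action V y0 \<xi> < c + \<epsilon>"
proof -
  have "S V y0 x < ereal (c + \<epsilon> / 3)" using assms by simp
  then obtain s \<xi> where "\<xi> \<in> connections y0 x" "has_bi_sum (\<lambda>k. V (\<xi> k) (\<xi> (k + 1)) - V y0 y0) s"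
    "s < ereal (c + \<epsilon> / 3)"
    unfolding S_def Inf_less_iff by blast
  then have "\<exists>\<eta>\<in>summable_connections y0. \<eta> 0 = x \<and> action V y0 \<eta> < c + \<epsilon> / 3 + 2 * (\<epsilon> / 3)"
    by (rule truncated_connection) (use assms(2) in simp)
  moreover have "c + \<epsilon> / 3 + 2 * (\<epsilon> / 3) = c + \<epsilon>" by simp
  ultimately show ?thesis by (simp only:)
qed

lemma S_minimal_connection:
  assumes "\<xi> \<in> minimal_connections V y0" "\<xi> \<in> summable_connections y0"
  shows "S V y0 (\<xi> 0) = ereal (action V y0 \<xi>)"
proof -
  have "has_bi_sum (\<lambda>k. V (\<xi> k) (\<xi> (k + 1)) - V y0 y0) (S V y0 (\<xi> 0))"
    using assms(1) by (auto simp: minimal_connections_def connections_def)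
  then show ?thesis using has_bi_sum_unique[OF _ has_bi_sum_action[OF assms(2)]] by blast
qed

lemma bi_sum_excess_diff:
  assumes "\<xi> \<in> summable_connections y0" "\<eta> \<in> summable_connections y0"
  shows "bi_sum (\<lambda>k. V (\<xi> k) (\<xi> (k + 1)) - V (\<eta> k) (\<eta> (k + 1))) = action V y0 \<xi> - action V y0 \<eta>"
proof -
  have eq: "(\<lambda>k. V (\<xi> k) (\<xi> (k + 1)) - V (\<eta> k) (\<eta> (k + 1))) = (\<lambda>k. excess V y0 \<xi> k + - excess V y0 \<eta> k)"
    by (simp add: excess_def)
  have s: "excess V y0 \<xi> summable_on UNIV" "(\<lambda>k. - excess V y0 \<eta> k) summable_on UNIV"
    using excess_summable assms by (simp_all add: summable_on_uminus)
  have "bi_sum (\<lambda>k. excess V y0 \<xi> k + - excess V y0 \<eta> k) = (\<Sum>\<^sub>\<infinity>k. excess V y0 \<xi> k + - excess V y0 \<eta> k)"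
    by (rule bi_sum_eq_infsum[OF summable_on_add[OF s]])
  also have "\<dots> = action V y0 \<xi> - action V y0 \<eta>"
    unfolding infsum_add[OF s] by (simp add: action_def infsum_uminus)
  finally show ?thesis unfolding eq .
qed

text \<open>Membership matters because \<open>l2_norm\<close> takes the value \<open>0\<close> on sequences that are not square summable, so
  a small norm bounds the entries only within \<open>l2\<close>.\<close>

lemma gradient_l2:
  assumes crit: "D1 V y0 y0 + D2 V y0 y0 = 0"
    and v: "v summable_on UNIV" "\<And>k. 0 \<le> v k" and \<xi>: "\<xi> \<in> confined y0 v"
  shows "(\<lambda>k. D2 V (\<xi> (k - 1)) (\<xi> k) + D1 V (\<xi> k) (\<xi> (k + 1))) \<in> l2"
proof -
  define g where "g \<xi> k = D2 V (\<xi> (k - 1)) (\<xi> k) + D1 V (\<xi> k) (\<xi> (k + 1))" for \<xi> :: "int \<Rightarrow> real" and k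
  define c where "c k = \<bar>g (step_profile y0) k\<bar>" for k
  define w where "w k = M * (v (k + -1) + v k) + M * (v k + v (k + 1)) + c k" for k
  have c: "c summable_on UNIV"
  proof (rule summable_on_finite_support(1)[of "{0, 1}"])
    show "c k = 0" if "k \<notin> {0, 1}" for k
      using that crit D_periodic[of y0 y0] by (auto simp: c_def g_def step_profile_def)
  qed simp
  have w: "w summable_on UNIV" unfolding w_def[abs_def]
    by (intro summable_on_add summable_on_cmult_right v c summable_on_int_shift)
  have gw: "\<bar>g \<xi> k\<bar> \<le> w k" for k
  proof -
    have d: "\<bar>\<xi> k - step_profile y0 k\<bar> \<le> v k" for k using \<xi> by (simp add: confined_def)
    have "\<bar>D2 V (\<xi> (k - 1)) (\<xi> k) - D2 V (step_profile y0 (k - 1)) (step_profile y0 k)\<bar> \<le> M * (v (k + -1) + v k)"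
      by (rule order_trans[OF D_Lipschitz(2)]) (use M_ge d[of "k - 1"] d[of k] in \<open>auto intro!: mult_left_mono add_mono\<close>)
    moreover have "\<bar>D1 V (\<xi> k) (\<xi> (k + 1)) - D1 V (step_profile y0 k) (step_profile y0 (k + 1))\<bar> \<le> M * (v k + v (k + 1))"
      by (rule order_trans[OF D_Lipschitz(1)]) (use M_ge d[of "k + 1"] d[of k] in \<open>auto intro!: mult_left_mono add_mono\<close>)
    ultimately show ?thesis unfolding w_def c_def g_def by linarith
  qed
  have w0: "0 \<le> w k" for k using gw[of k] by linarith
  have "(\<lambda>k. (g \<xi> k)\<^sup>2) summable_on UNIV"
  proof (rule summable_on_dominated)
    show "(\<lambda>k. infsum w UNIV * w k) summable_on UNIV" by (rule summable_on_cmult_right[OF w])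
    show "\<bar>(g \<xi> k)\<^sup>2\<bar> \<le> infsum w UNIV * w k" for k
    proof -
      have "\<bar>(g \<xi> k)\<^sup>2\<bar> = \<bar>g \<xi> k\<bar> * \<bar>g \<xi> k\<bar>" by (simp add: power2_eq_square)
      also have "\<dots> \<le> w k * w k" by (intro mult_mono gw w0) auto
      also have "\<dots> \<le> infsum w UNIV * w k"
        by (intro mult_right_mono summable_nonneg_bounded[OF w] w0)
      finally show ?thesis .
    qed
  qed
  then show ?thesis by (simp add: l2_def g_def)
qed

text \<open>Compactness: the limit keeps the action, by dominated convergence, and each entry of its gradient
  is a limit of entries bounded by the norms.\<close>

lemma stationary_limit_of_small_gradients:
  assumes crit: "D1 V y0 y0 + D2 V y0 y0 = 0"
    and v: "v summable_on UNIV" "\<And>k. 0 \<le> v k"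
    and small: "\<And>\<epsilon>. 0 < \<epsilon> \<Longrightarrow> \<exists>\<xi>\<in>confined y0 v. action V y0 \<xi> = c \<and>
      (l2_norm (\<lambda>k. D2 V (\<xi> (k - 1)) (\<xi> k) + D1 V (\<xi> k) (\<xi> (k + 1))))\<^sup>2 < \<epsilon>"
  shows "\<exists>\<xi>\<in>confined y0 v. stationary V \<xi> \<and> action V y0 \<xi> = c"
proof -
  define g where "g \<xi> k = D2 V (\<xi> (k - 1)) (\<xi> k) + D1 V (\<xi> k) (\<xi> (k + 1))" for \<xi> :: "int \<Rightarrow> real" and k
  have "\<exists>\<xi>\<in>confined y0 v. action V y0 \<xi> = c \<and> (l2_norm (g \<xi>))\<^sup>2 < 1 / real (Suc n)" for n
    using small[of "1 / real (Suc n)"] by (simp add: g_def[abs_def])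
  then obtain \<xi> where \<xi>: "\<And>n. \<xi> n \<in> confined y0 v" "\<And>n. action V y0 (\<xi> n) = c"
    "\<And>n. (l2_norm (g (\<xi> n)))\<^sup>2 < 1 / real (Suc n)" by metis
  have dom: "\<bar>\<xi> n k - step_profile y0 k\<bar> \<le> v k" for n k using \<xi>(1) by (simp add: confined_def)
  obtain r \<eta> where r: "strict_mono r" "\<And>k. (\<lambda>n. \<xi> (r n) k) \<longlonglongrightarrow> \<eta> k" "\<And>k. \<bar>\<eta> k - step_profile y0 k\<bar> \<le> v k"
    using pointwise_convergent_subsequence[of \<xi> "step_profile y0" v] dom by metis
  have "stationary V \<eta>"
    unfolding stationary_def
  proof
    fix k
    have "(\<lambda>n. g (\<xi> (r n)) k) \<longlonglongrightarrow> g \<eta> k"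
      unfolding g_def by (intro tendsto_add DV_continuous r(2))
    then have "(\<lambda>n. (g (\<xi> (r n)) k)\<^sup>2) \<longlonglongrightarrow> (g \<eta> k)\<^sup>2" by (rule tendsto_power)
    moreover have "(\<lambda>n. 1 / real (Suc (r n))) \<longlonglongrightarrow> 0"
      using LIMSEQ_subseq_LIMSEQ[OF LIMSEQ_Suc[OF lim_1_over_n] r(1)] by (simp add: o_def)
    moreover have "(g (\<xi> n) k)\<^sup>2 \<le> 1 / real (Suc n)" for n
    proof -
      have "g (\<xi> n) \<in> l2" using gradient_l2[OF crit v \<xi>(1)] by (simp add: g_def[abs_def])
      from l2_finite_bound[OF this, of "{k}"] have "\<bar>g (\<xi> n) k\<bar> \<le> l2_norm (g (\<xi> n))"
        by (simp add: L2_set_def)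
      then have "\<bar>g (\<xi> n) k\<bar>\<^sup>2 \<le> (l2_norm (g (\<xi> n)))\<^sup>2" by (intro power_mono) auto
      then show ?thesis using \<xi>(3)[of n] by simp
    qed
    ultimately have "(g \<eta> k)\<^sup>2 \<le> 0" by (intro LIMSEQ_le) blast+
    then show "D2 V (\<eta> (k - 1)) (\<eta> k) + D1 V (\<eta> k) (\<eta> (k + 1)) = 0" by (simp add: g_def)
  qed
  moreover have "(\<lambda>n. action V y0 (\<xi> (r n))) \<longlonglongrightarrow> action V y0 \<eta>"
    by (rule action_tendsto[OF v dom r(2)])
  then have "action V y0 \<eta> = c" by (simp add: \<xi>(2) LIMSEQ_const_iff)
  ultimately show ?thesis using r(3) by (intro bexI[of _ \<eta>]) (auto simp: confined_def)
qed

end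

lemma powi_neg_eq: "lam powi (- int n) = (1 / lam) ^ n" for lam :: real
  by (simp add: power_int_minus power_one_over inverse_eq_divide)

text \<open>The interlacing \<open>zt k < z k < zt (k + 1)\<close> transfers the decay of \<open>zt\<close> to \<open>z\<close>; only at the jump, \<open>k = 0\<close>, the
  trivial bound \<open>1\<close> is used.\<close>

lemma homoclinic_pair_summable:
  fixes lam \<kappa> y0 :: real
  assumes lam: "1 < lam" and \<kappa>: "0 < \<kappa>"
    and order: "\<And>k. y0 < zt k" "\<And>k. zt k < z k" "\<And>k. z k < zt (k + 1)" "\<And>k. zt (k + 1) < y0 + 1"
    and left: "\<And>j::nat. \<bar>zt (- int j) - y0\<bar> \<le> \<kappa> * lam powi (- (int j + 1))"
    and right: "\<And>j::nat. \<bar>zt (int j) - y0 - 1\<bar> \<le> \<kappa> * lam powi (- (int j + 1))"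
  shows "zt \<in> summable_connections y0" "z \<in> summable_connections y0"
proof -
  define q where "q = 1 / lam"
  have q: "0 \<le> q" "q < 1" using lam by (auto simp: q_def)
  have powi: "lam powi (- (int j + 1)) = q ^ Suc j" for j
    using powi_neg_eq[of lam "Suc j"] by (simp add: q_def add.commute)
  have qS: "\<kappa> * q ^ Suc j \<le> \<kappa> * q ^ j" for j
    using q \<kappa> by (intro mult_left_mono power_decreasing) auto
  have geo: "(\<lambda>k. \<kappa> * q ^ nat \<bar>k\<bar>) summable_on (UNIV :: int set)"
    by (intro summable_on_cmult_right summable_on_int_geometric q)
  show "zt \<in> summable_connections y0"
    unfolding summable_connections_def mem_Collect_eq
  proof (rule summable_on_dominated[OF geo])
    fix k :: int
    show "\<bar>\<bar>zt k - step_profile y0 k\<bar>\<bar> \<le> \<kappa> * q ^ nat \<bar>k\<bar>"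
    proof (cases "k \<le> 0")
      case True
      have "k = - int (nat \<bar>k\<bar>)" using True by simp
      then show ?thesis using left[of "nat \<bar>k\<bar>"] qS[of "nat \<bar>k\<bar>"] True unfolding powi step_profile_def by simp
    next
      case False
      have "k = int (nat \<bar>k\<bar>)" using False by simp
      then show ?thesis using right[of "nat \<bar>k\<bar>"] qS[of "nat \<bar>k\<bar>"] False unfolding powi step_profile_def
        by (simp add: diff_diff_eq)
    qed
  qed
  have geo1: "(\<lambda>k. \<kappa> * q ^ nat \<bar>k\<bar> + (if k = 0 then 1 else 0)) summable_on (UNIV :: int set)"
    by (intro summable_on_add geo summable_on_int_point)
  show "z \<in> summable_connections y0"
    unfolding summable_connections_def mem_Collect_eq
  proof (rule summable_on_dominated[OF geo1])
    fix k :: int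
    have nn: "0 \<le> \<kappa> * q ^ nat \<bar>k\<bar>" using \<kappa> q by simp
    have z: "y0 < z k" "z k < zt (k + 1)" "zt k < z k" "z k < y0 + 1"
      using order(1)[of k] order(2)[of k] order(3)[of k] order(4)[of k] by linarith+
    consider "k < 0" | "k = 0" | "k > 0" by linarith
    then show "\<bar>\<bar>z k - step_profile y0 k\<bar>\<bar> \<le> \<kappa> * q ^ nat \<bar>k\<bar> + (if k = 0 then 1 else 0)"
    proof cases
      case 1
      define j where "j = nat (- k - 1)"
      have j: "k + 1 = - int j" "nat \<bar>k\<bar> = Suc j" using 1 by (auto simp: j_def)
      have "z k - y0 \<le> \<kappa> * q ^ nat \<bar>k\<bar>" using left[of j] z(2) unfolding powi j by linarith
      then show ?thesis using 1 z(1) by (simp add: step_profile_def)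
    next
      case 2
      then show ?thesis using z nn by (simp add: step_profile_def)
    next
      case 3
      have k: "k = int (nat \<bar>k\<bar>)" using 3 by simp
      have "\<bar>zt k - y0 - 1\<bar> \<le> \<kappa> * q ^ nat \<bar>k\<bar>"
        using right[of "nat \<bar>k\<bar>"] qS[of "nat \<bar>k\<bar>"] unfolding powi using 3 by simp
      then have "y0 + 1 - z k \<le> \<kappa> * q ^ nat \<bar>k\<bar>" using z(3) by linarith
      then show ?thesis using 3 z(4) by (simp add: step_profile_def)
    qed
  qed
qed

theorem proposition3p1:
  fixes V :: "real \<Rightarrow> real \<Rightarrow> real"
    and y0 p0 lam \<kappa>1 :: real
    and z zt :: "int \<Rightarrow> real"
  assumes "A1 V" and "A2 V" and "A3 V"
    and "N1 V y0 p0"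
    and "homoclinic_pair V y0 z zt"
    and "lam > 1" and "\<exists>v. v \<noteq> 0 \<and> twist_deriv V (y0, p0) v = lam *\<^sub>R v"
    and "\<kappa>1 > 0"
    and "\<forall>j::nat. \<bar>zt (- int j) - y0\<bar> \<le> \<kappa>1 * lam powi (- (int j + 1))"
    and "\<forall>j::nat. \<bar>zt (int j) - y0 - 1\<bar> \<le> \<kappa>1 * lam powi (- (int j + 1))"
    and "N2 V"
  shows "Delta1 V z zt \<kappa>1 lam \<ge> Delta1t V z zt \<kappa>1 lam \<and> Delta1t V z zt \<kappa>1 lam > 0"
proof
  show "Delta1t V z zt \<kappa>1 lam \<le> Delta1 V z zt \<kappa>1 lam"
    unfolding Delta1_def Delta1t_def by (intro SUP_mono' INF_superset_mono) (auto simp: N_def)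
  obtain \<delta> M where "twist_generating V \<delta> M" using twist_generatingI assms(1-3) by blast
  then interpret twist_generating V \<delta> M .
  have ymin: "V y0 y0 \<le> V x x" for x using assms(4) by (auto simp: N1_def)
  have hyp: "0 < D1 (D1 V) y0 y0 + 2 * D2 (D1 V) y0 y0 + D2 (D2 V) y0 y0"
    by (rule hyperbolic_minimum) (use assms(4) in \<open>auto simp: N1_def\<close>)
  interpret hyperbolic_generating V \<delta> M y0 by unfold_locales (rule hyp)
  have crit: "D1 V y0 y0 + D2 V y0 y0 = 0" by (rule diagonal_critical[OF ymin])
  have min: "z \<in> minimal_connections V y0" "zt \<in> minimal_connections V y0"
    and argmin: "is_arg_min (S V y0) (\<lambda>x. x \<in> {y0<..<y0 + 1}) (z 0)"
    and argmax: "is_arg_max (S V y0) (\<lambda>x. x \<in> {y0<..<y0 + 1}) (zt 0)"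
    and order: "\<And>k. y0 < zt k" "\<And>k. zt k < z k" "\<And>k. z k < zt (k + 1)" "\<And>k. zt (k + 1) < y0 + 1"
    using assms(5) by (auto simp: homoclinic_pair_def)
  have mem: "zt \<in> summable_connections y0" "z \<in> summable_connections y0"
    using homoclinic_pair_summable[of lam \<kappa>1 y0 zt z] assms(6,8-10) order by blast+
  have S_z: "S V y0 (z 0) = ereal (action V y0 z)" and S_zt: "S V y0 (zt 0) = ereal (action V y0 zt)"
    using S_minimal_connection min mem by blast+
  have S_ge: "ereal (action V y0 z) \<le> S V y0 x" if "x \<in> {y0<..<y0 + 1}" for x
    using argmin that unfolding is_arg_min_def S_z by (meson linorder_not_less)
  have S_le: "S V y0 x \<le> ereal (action V y0 zt)" if "x \<in> {y0<..<y0 + 1}" for x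
    using argmax that unfolding is_arg_max_def S_zt by (meson linorder_not_less)
  have barrier: "peierls_barrier V z zt = action V y0 zt - action V y0 z"
    unfolding peierls_barrier_def by (rule bi_sum_excess_diff[OF mem])
  have "z 0 \<in> {y0<..<y0 + 1}" using argmin by (simp add: is_arg_min_def)
  from S_le[OF this] have nonneg: "action V y0 z \<le> action V y0 zt" by (simp add: S_z)
  show "0 < Delta1t V z zt \<kappa>1 lam"
  proof (rule ccontr)
    assume "\<not> ?thesis"
    then have le0: "Delta1t V z zt \<kappa>1 lam \<le> 0" by simp
    define v where "v k = \<bar>z k - step_profile y0 k\<bar> + u \<kappa>1 lam k" for k
    have u_eq: "u \<kappa>1 lam k = 2 * \<kappa>1 * (1 / lam) ^ nat \<bar>k\<bar>" for k
      using powi_neg_eq[of lam "nat \<bar>k\<bar>"] by (simp add: u_def)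
    have u: "u \<kappa>1 lam summable_on UNIV" "0 \<le> u \<kappa>1 lam k" for k
      unfolding u_eq[abs_def]
      using assms(6,8) summable_on_cmult_right[OF summable_on_int_geometric[of "1 / lam"]] by auto
    have v: "v summable_on UNIV" "\<And>k. 0 \<le> v k"
      unfolding v_def using mem(2) u by (auto simp: summable_connections_def intro: summable_on_add)
    have crit_energy: "\<exists>\<xi>\<in>confined y0 v. stationary V \<xi> \<and> action V y0 \<xi> = action V y0 z + e"
      if e: "e \<in> {0..peierls_barrier V z zt / 2}" for e
    proof (rule stationary_limit_of_small_gradients[OF crit v])
      fix \<epsilon> :: real assume "0 < \<epsilon>"
      have "(INF h \<in> Nt V z \<kappa>1 lam e. ereal ((l2_norm (gradE V z h))\<^sup>2)) \<le> Delta1t V z zt \<kappa>1 lam"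
        unfolding Delta1t_def by (rule SUP_upper[OF e])
      also have "\<dots> < ereal \<epsilon>" using le0 \<open>0 < \<epsilon>\<close> by (simp add: order_le_less_trans)
      finally obtain h where h: "h \<in> Nt V z \<kappa>1 lam e" "(l2_norm (gradE V z h))\<^sup>2 < \<epsilon>"
        unfolding INF_less_iff by auto
      define \<xi> where "\<xi> k = z k + h k" for k
      have conf: "\<xi> \<in> confined y0 v"
      proof -
        have "\<bar>h k\<bar> \<le> u \<kappa>1 lam k" for k using h(1) by (simp add: Nt_def)
        then have "\<bar>z k + h k - step_profile y0 k\<bar> \<le> \<bar>z k - step_profile y0 k\<bar> + u \<kappa>1 lam k" for k
          using abs_triangle_ineq[of "z k - step_profile y0 k" "h k"] by (smt (verit))
        then show ?thesis by (simp add: confined_def \<xi>_def v_def)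
      qed
      then have "\<xi> \<in> summable_connections y0"
        unfolding summable_connections_def confined_def
        by (auto intro!: summable_on_dominated[OF v(1)])
      from bi_sum_excess_diff[OF this mem(2)] have "E V z h = action V y0 \<xi> - action V y0 z"
        by (simp add: E_def \<xi>_def)
      then have "action V y0 \<xi> = action V y0 z + e" using h(1) by (simp add: Nt_def)
      moreover have "gradE V z h = (\<lambda>k. D2 V (\<xi> (k - 1)) (\<xi> k) + D1 V (\<xi> k) (\<xi> (k + 1)))"
        by (simp add: fun_eq_iff gradE_def \<xi>_def)
      ultimately show "\<exists>\<xi>\<in>confined y0 v. action V y0 \<xi> = action V y0 z + e \<and>
        (l2_norm (\<lambda>k. D2 V (\<xi> (k - 1)) (\<xi> k) + D1 V (\<xi> k) (\<xi> (k + 1))))\<^sup>2 < \<epsilon>"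
        using conf h(2) by (intro bexI[of _ \<xi>]) auto
    qed
    show False
    proof (cases "action V y0 z < action V y0 zt")
      case True
      then have "0 < peierls_barrier V z zt / 2" by (simp add: barrier)
      from stationary_actions_contain_no_interval[OF v this, of "action V y0 z"]
      obtain e where e: "e \<in> {action V y0 z..action V y0 z + peierls_barrier V z zt / 2}"
        "\<And>\<xi>. \<xi> \<in> confined y0 v \<Longrightarrow> stationary V \<xi> \<Longrightarrow> action V y0 \<xi> \<noteq> e" by blast
      then show False using crit_energy[of "e - action V y0 z"] by auto
    next
      case False
      then have S_eq: "S V y0 x = ereal (action V y0 z)" if "x \<in> {y0<..<y0 + 1}" for x
        using S_ge[OF that] S_le[OF that] nonneg by (metis antisym linorder_not_less order_antisym)
      interpret minimizing_connection V \<delta> M y0 z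
      proof unfold_locales
        show "z \<in> summable_connections y0" by (rule mem)
        show "y0 < z k" "z k < y0 + 1" "z k < z (k + 1)" for k
          using order(1)[of k] order(2)[of k] order(2)[of "k + 1"] order(3)[of k] order(4)[of k] by linarith+
        show "action V y0 z \<le> action V y0 \<xi>"
          if "\<xi> \<in> summable_connections y0" "\<xi> 0 \<in> {y0<..<y0 + 1}" for \<xi>
          using S_le_action[OF that(1)] S_eq[OF that(2)] by simp
      qed
      have "\<exists>\<xi>\<in>minimizers. \<xi> 0 = x" if "x \<in> {y0<..<y0 + 1}" for x
        by (rule minimizer_through[OF that action_approx_S[OF S_eq[OF that]]])
      then obtain \<phi> where \<phi>: "strict_mono \<phi>" "surj \<phi>" "\<phi> y0 = y0" "\<phi> (y0 + 1) = y0 + 1"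
        "\<And>x. x \<in> {y0<..<y0 + 1} \<Longrightarrow> D2 V x (\<phi> x) + D1 V (\<phi> x) (\<phi> (\<phi> x)) = 0"
        using minimizer_foliation by blast
      have "D2 V x (\<phi> x) + D1 V (\<phi> x) (\<phi> (\<phi> x)) = 0" if "x \<in> {y0..y0 + 1}" for x
      proof -
        have "x = y0 \<or> x = y0 + 1 \<or> x \<in> {y0<..<y0 + 1}" using that by simp linarith
        then consider "x = y0" | "x = y0 + 1" | "x \<in> {y0<..<y0 + 1}" by blast
        then show ?thesis
          by cases (use \<phi>(3-5) crit D_periodic[of y0 y0] in auto)
      qed
      from invariant_graph_imp_not_N2[OF \<phi>(1-4) this] show False using assms(11) by simp
    qed
  qed
qed

end
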